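(* Let $A\in\mathbb{R}^{M\times N}$ have i.i.d. standard normal entries $\mathcal{N}(0,1)$, let $\mathcal{C}_1,\dots,\mathcal{C}_L\subset\mathbb{R}^N$ be convex sets, and let $x^{\natural}\in\bigcup_{i=1}^L\mathcal{C}_i$ be a fixed $K$-sparse vector. Let $a_M=\mathbb{E}\|g\|_2$ where $g\sim\mathcal{N}(0,I_{M\times M})$. Suppose that $\epsilon>0$, $a_M\ge\omega(\mathcal{T})$, and $(1-2\epsilon)a_M\ge\omega(\widetilde{\mathcal{C}}_{i,j})$ for all $1\le i,j\le L$. Let $\mathcal{E}$ be the event $$\mathcal{E}=\Big\{\bigcup_{i,j}\big(\operatorname{Null}(A)\cap\mathcal{T}\cap\widetilde{\mathcal{C}}_{i,j}\big)=\{0\}\Big\}.$$ Then $$\Pr(\mathcal{E})\ \ge\ 1-\min(\mathcal{P}_1,\mathcal{P}_2),$$ where $$\mathcal{P}_1=\Pr\Big(\min_{u\in\mathcal{T}^c\setminus\{0\}}\|Au\|_2>0\Big),\qquad \mathcal{P}_2=\Pr\Big(\min_{u\in\bigcap_{i,j}\widetilde{\mathcal{C}}_{i,j}^{\,c}\setminus\{0\}}\|Au\|_2>0\Big),$$ and these can be bounded as $$\mathcal{P}_1\le\min\Big\{1,\ \exp\Big(-\frac{(a_M-\omega(\mathcal{T}))^2}{2}\Big)\Big\},$$ $$\mathcal{P}_2\le\min\Big\{1,\ \frac32\exp\Big(-\frac{\epsilon^2a_M^2}{2}\Big)+\sum_{i\le j}\exp\Big(-\frac{\big((1-2\epsilo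n)a_M-\omega(\widetilde{\mathcal{C}}_{i,j})\big)^2}{2}\Big)\Big\}.$$
   Context: $\operatorname{Null}(A)$ is the null space of $A$ and $S^{N-1}$ is the Euclidean unit sphere of $\mathbb{R}^N$. A superscript $c$ on a set denotes its complement in $\mathbb{R}^N$. A vector is $K$-sparse if it has at most $K$ nonzero entries. The tangent cone of $\|\cdot\|_1$ at $x^{\natural}$ is $\mathcal{T}=\{e\in\mathbb{R}^N:\ \|x^{\natural}+te\|_1\le\|x^{\natural}\|_1\text{ for some }t>0\}$. For $1\le i,j\le L$, $\widetilde{\mathcal{C}}_{i,j}=\{z\in\mathbb{R}^N:\ z=t(x_1-x_2)\text{ for some }t>0,\ x_1\in\mathcal{C}_i,\ x_2\in\mathcal{C}_j\}$. For a cone $U\subset\mathbb{R}^N$, $\omega(U)$ denotes the Gaussian width of its spherical part, $\omega(U)=\mathbb{E}\sup_{x\in U\cap S^{N-1}}\langle g,x\rangle$ with $g\sim\mathcal{N}(0,I_{N\times N})$.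
   Formalization: P_1 and P_2 are taken as the probabilities that min‖Au‖>0 fails over T∖{0} and over the union of the C̃_{i,j} minus 0 (complement moved from set to event); as printed the bound on P_1 fails, e.g. N=1, M=2, x=1, C_1={1}, where P_1=1. *)

theory Defs
  imports "HOL-Probability.Probability"
begin

definition l1_norm :: "real ^ 'n \<Rightarrow> real" where
  "l1_norm x = (\<Sum>k\<in>UNIV. \<bar>x $ k\<bar>)"

definition sparse :: "nat \<Rightarrow> real ^ 'n \<Rightarrow> bool" where
  "sparse K x \<longleftrightarrow> card {k. x $ k \<noteq> 0} \<le> K"

definition null_space :: "real ^ 'n ^ 'm \<Rightarrow> (real ^ 'n) set" where
  "null_space A = {u. A *v u = 0}"

definition l1_tangent_cone :: "real ^ 'n \<Rightarrow> (real ^ 'n) set" where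
  "l1_tangent_cone x = {e. \<exists>t>0. l1_norm (x + t *\<^sub>R e) \<le> l1_norm x}"

definition difference_cone :: "(real ^ 'n) set \<Rightarrow> (real ^ 'n) set \<Rightarrow> (real ^ 'n) set" where
  "difference_cone C D = {z. \<exists>t>0. \<exists>x\<^sub>1\<in>C. \<exists>x\<^sub>2\<in>D. z = t *\<^sub>R (x\<^sub>1 - x\<^sub>2)}"

definition std_gaussian :: "(real ^ 'n) measure" where
  "std_gaussian = density lborel (\<lambda>g. ennreal (\<Prod>k\<in>UNIV. std_normal_density (g $ k)))"

(* The supremum of an empty set of reals is unspecified in HOL, so the cones {} and {0},
   whose spherical part is empty, are given the customary width 0. *)
definition gaussian_width :: "(real ^ 'n) set \<Rightarrow> real" where
  "gaussian_width U =
     (if U \<inter> sphere 0 1 = {} then 0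
      else (LINT g|std_gaussian. (SUP x\<in>U \<inter> sphere 0 1. g \<bullet> x)))"

definition iid_std_normal_entries :: "'w measure \<Rightarrow> ('w \<Rightarrow> real ^ 'n ^ 'm) \<Rightarrow> bool" where
  "iid_std_normal_entries \<Omega> A \<longleftrightarrow>
     prob_space.indep_vars \<Omega> (\<lambda>_. borel) (\<lambda>(i, j) w. A w $ i $ j) UNIV \<and>
     (\<forall>i j. distributed \<Omega> lborel (\<lambda>w. A w $ i $ j) (\<lambda>x. ennreal (std_normal_density x)))"

(* "min of norm (A *v u) over u in U - {0} is > 0", read as: every value is positive.
   When U is a cone that is not contained in {0}, the infimum over U - {0} is always 0,
   because norm (A *v (s *\<^sub>R u)) = s * norm (A *v u) for s > 0.
   The failure probabilities P\<^sub>1 and P\<^sub>2 are those of the complementary event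
   \<not> min_norm_pos A U; taking min_norm_pos A (- U) instead would make the bounds false
   (if A is injective almost surely, that event has probability 1). *)
definition min_norm_pos :: "real ^ 'n ^ 'm \<Rightarrow> (real ^ 'n) set \<Rightarrow> bool" where
  "min_norm_pos A U \<longleftrightarrow> (\<forall>u\<in>U - {0}. 0 < norm (A *v u))"

(* Probability with respect to the completion. Cones generated by arbitrary convex sets need
   not be Borel, so events such as "A has a nonzero null vector in the cone" are in general
   measurable only up to null sets, whereas Sigma_Algebra.measure is 0 on non-measurable sets.
   On sets \<Omega> this agrees with measure \<Omega>. *)
definition Pr :: "'w measure \<Rightarrow> ('w \<Rightarrow> bool) \<Rightarrow> real" where
  "Pr \<Omega> Q = measure (completion \<Omega>) {w \<in> space \<Omega>. Q w}"

end

theory Submission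
  imports Defs
begin

text \<open>
  By Gordon's comparison, the smoothed minimum of \<open>norm (A u)\<close> over a finite net of the spherical part of
  a cone has expectation at least \<open>a\<^sub>M\<close> minus the Gaussian width, and it is a 1-Lipschitz function of the
  Gaussian matrix \<open>A\<close>, so it vanishes with probability at most \<open>exp (- (a\<^sub>M - width)\<^sup>2 / 2)\<close>. Both the
  comparison and the concentration inequality come from cutting a Gaussian vector into \<open>n\<close> independent
  increments of variance \<open>1 / n\<close> and expanding one increment to second order: the error of a step is of
  order \<open>n powr (- 3 / 2)\<close>. Applied to \<open>T\<close> and to each difference cone with \<open>i \<le> j\<close> (the cones for
  \<open>(i, j)\<close> and \<open>(j, i)\<close> are opposite), this gives the bounds on \<open>P\<^sub>1\<close> and \<open>P\<^sub>2\<close>; the term with the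
  factor \<open>3 / 2\<close> is slack.

  The cones need not be Borel. For a convex cone, however, the event of meeting the null space lies between
  the events for its relative interior and for its closure, which are Borel and differ by a null set.
\<close>

section \<open>The standard Gaussian measure on a Euclidean space\<close>

text \<open>Two smoothings make second-order expansions possible: \<open>norm v\<close> becomes
  \<open>norm (\<delta>, v)\<close> and the minimum over the net becomes
  \<open>softmin \<beta>\<close>. The constants of one step may depend on \<open>\<beta>\<close> and
  \<open>\<delta>\<close>, because the number of increments tends to infinity first and removes
  them; the smoothing is taken away only afterwards. Expanding finitely many increments asks for
  uniform Taylor remainders, never for derivatives of integrals. The scalar \<open>t\<close> added
  to \<open>norm (A u)\<close> gives both processes the same increment law at each single
  \<open>u\<close>. What remains to compare are covariances, ordered by
  \<open>0 \<le> (1 - G u \<bullet> G w) * (1 - u \<bullet> w)\<close>. A finite net controls all of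
  the spherical part only for bounded \<open>A\<close>, hence the detour through balls of matrices.
  The boundary event is null because pushing a boundary null vector in a relative interior direction
  puts it into the relative interior: in a suitable one-parameter family of matrices the event
  occurs at most once.\<close>

definition gauss :: "'a::euclidean_space measure" where
  "gauss = density lborel (\<lambda>x. ennreal (\<Prod>b\<in>Basis. std_normal_density (x \<bullet> b)))"

lemma sets_gauss [simp, measurable_cong]: "sets gauss = sets borel"
  by (simp add: gauss_def)

lemma space_gauss [simp]: "space gauss = UNIV"
  by (simp add: gauss_def)

lemma nn_integral_gauss_prod:
  fixes f :: "'a::euclidean_space \<Rightarrow> real \<Rightarrow> ennreal"
  assumes [measurable]: "\<And>b. b \<in> Basis \<Longrightarrow> f b \<in> borel_measurable borel"
  shows "(\<integral>\<^sup>+x. (\<Prod>b\<in>Basis. f b (x \<bullet> b)) \<partial>gauss)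
    = (\<Prod>b\<in>Basis. (\<integral>\<^sup>+t. f b t \<partial>density lborel std_normal_density))"
proof -
  have "(\<integral>\<^sup>+x. (\<Prod>b\<in>Basis. f b (x \<bullet> b)) \<partial>gauss)
      = (\<integral>\<^sup>+x. (\<Prod>b\<in>Basis. ennreal (std_normal_density (x \<bullet> b)) * f b (x \<bullet> b)) \<partial>lborel)"
    unfolding gauss_def by (subst nn_integral_density) (auto simp: prod.distrib prod_ennreal)
  also have "\<dots> = (\<Prod>b\<in>Basis. (\<integral>\<^sup>+t. ennreal (std_normal_density t) * f b t \<partial>lborel))"
    by (subst nn_integral_lborel_prod) auto
  also have "\<dots> = (\<Prod>b\<in>Basis. (\<integral>\<^sup>+t. f b t \<partial>density lborel std_normal_density))"
    by (intro prod.cong refl, subst nn_integral_density) auto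
  finally show ?thesis .
qed

lemma emeasure_gauss_cylinder:
  fixes S :: "'a::euclidean_space \<Rightarrow> real set"
  assumes [measurable]: "\<And>b. b \<in> Basis \<Longrightarrow> S b \<in> sets borel"
  shows "emeasure gauss {x. \<forall>b\<in>Basis. x \<bullet> b \<in> S b}
    = (\<Prod>b\<in>Basis. emeasure (density lborel std_normal_density) (S b))"
proof -
  have [measurable]: "{x. \<forall>b\<in>Basis. x \<bullet> b \<in> S b} \<in> sets borel"
    by measurable
  have "emeasure gauss {x. \<forall>b\<in>Basis. x \<bullet> b \<in> S b}
      = (\<integral>\<^sup>+x. indicator {x. \<forall>b\<in>Basis. x \<bullet> b \<in> S b} x \<partial>gauss)"
    by simp
  also have "\<dots> = (\<integral>\<^sup>+x. (\<Prod>b\<in>Basis. indicator (S b) (x \<bullet> b)) \<partial>gauss)"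
    by (intro nn_integral_cong) (auto simp: indicator_def)
  also have "\<dots> = (\<Prod>b\<in>Basis. (\<integral>\<^sup>+t. indicator (S b) t \<partial>density lborel std_normal_density))"
    by (rule nn_integral_gauss_prod) auto
  finally show ?thesis by simp
qed

interpretation std_normal: prob_space "density lborel std_normal_density"
  by (rule prob_space_normal_density) simp

interpretation gauss: prob_space gauss
proof
  show "emeasure gauss (space (gauss :: 'a measure)) = 1"
    using emeasure_gauss_cylinder[where S="\<lambda>_::'a. UNIV"] std_normal.emeasure_space_1 by simp
qed

lemma distr_gauss_inner_Basis:
  fixes b :: "'a::euclidean_space"
  assumes "b \<in> Basis"
  shows "distr gauss borel (\<lambda>x. x \<bullet> b) = density lborel std_normal_density"
proof (rule measure_eqI)
  fix S assume "S \<in> sets (distr (gauss::'a measure) borel (\<lambda>x. x \<bullet> b))"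
  then have S [measurable]: "S \<in> sets borel" by simp
  have "emeasure (distr gauss borel (\<lambda>x. x \<bullet> b)) S = emeasure gauss ((\<lambda>x. x \<bullet> b) -` S)"
    by (subst emeasure_distr) auto
  also have "(\<lambda>x. x \<bullet> b) -` S = {x. \<forall>c\<in>Basis. x \<bullet> c \<in> (if c = b then S else UNIV)}"
    using assms by auto
  also have "emeasure gauss \<dots> = (\<Prod>c\<in>Basis. emeasure (density lborel std_normal_density) (if c = b then S else UNIV))"
    by (rule emeasure_gauss_cylinder) auto
  also have "\<dots> = (\<Prod>c\<in>Basis. if c = b then emeasure (density lborel std_normal_density) S else 1)"
    using std_normal.emeasure_space_1 by (intro prod.cong) auto
  also have "\<dots> = emeasure (density lborel std_normal_density) S"
    using assms by simp
  finally show "emeasure (distr gauss borel (\<lambda>x. x \<bullet> b)) S = emeasure (density lborel std_normal_density) S" .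
qed simp

lemma distributed_gauss_inner_Basis:
  fixes b :: "'a::euclidean_space"
  assumes "b \<in> Basis"
  shows "distributed gauss lborel (\<lambda>x. x \<bullet> b) std_normal_density"
proof -
  have "distr gauss lborel (\<lambda>x. x \<bullet> b) = distr gauss borel (\<lambda>x. x \<bullet> b)"
    by (rule distr_cong) auto
  then show ?thesis
    using distr_gauss_inner_Basis[OF assms] by (simp add: distributed_def)
qed

lemma indep_vars_gauss_Basis:
  "gauss.indep_vars (\<lambda>_. borel) (\<lambda>b x. x \<bullet> b) (Basis :: 'a::euclidean_space set)"
proof (subst gauss.indep_vars_iff_distr_eq_PiM')
  interpret product_sigma_finite "\<lambda>b::'a. density lborel std_normal_density"
    by unfold_locales
  have "distr gauss (Pi\<^sub>M Basis (\<lambda>_. borel)) (\<lambda>x. \<lambda>b\<in>Basis. x \<bullet> b) = Pi\<^sub>M Basis (\<lambda>b::'a. density lborel std_normal_density)"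
  proof (rule PiM_eqI)
    show "sets (distr gauss (Pi\<^sub>M Basis (\<lambda>_. borel)) (\<lambda>x. \<lambda>b\<in>Basis. x \<bullet> b)) = sets (Pi\<^sub>M Basis (\<lambda>b::'a. density lborel std_normal_density))"
      by (simp cong: sets_PiM_cong)
    fix S :: "'a \<Rightarrow> real set"
    assume "\<And>i. i \<in> Basis \<Longrightarrow> S i \<in> sets (density lborel std_normal_density)"
    then have [measurable]: "\<And>i. i \<in> Basis \<Longrightarrow> S i \<in> sets borel" by simp
    have "emeasure (distr gauss (Pi\<^sub>M Basis (\<lambda>_. borel)) (\<lambda>x. \<lambda>b\<in>Basis. x \<bullet> b)) (Pi\<^sub>E Basis S)
        = emeasure gauss ((\<lambda>x. \<lambda>b\<in>Basis. x \<bullet> b) -` Pi\<^sub>E Basis S \<inter> space gauss)"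
      by (rule emeasure_distr) (auto intro!: sets_PiM_I_finite)
    also have "(\<lambda>x. \<lambda>b\<in>Basis. x \<bullet> b) -` Pi\<^sub>E Basis S \<inter> space gauss = {x. \<forall>b\<in>Basis. x \<bullet> b \<in> S b}"
      by auto
    also have "emeasure gauss \<dots> = (\<Prod>i\<in>Basis. emeasure (density lborel std_normal_density) (S i))"
      by (rule emeasure_gauss_cylinder) auto
    finally show "emeasure (distr gauss (Pi\<^sub>M Basis (\<lambda>_. borel)) (\<lambda>x. \<lambda>b\<in>Basis. x \<bullet> b)) (Pi\<^sub>E Basis S)
        = (\<Prod>i\<in>Basis. emeasure (density lborel std_normal_density) (S i))" .
  qed simp
  also have "\<dots> = Pi\<^sub>M Basis (\<lambda>b::'a. distr gauss borel (\<lambda>x. x \<bullet> b))"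
    by (intro PiM_cong refl) (simp add: distr_gauss_inner_Basis)
  finally show "distr gauss (Pi\<^sub>M Basis (\<lambda>_. borel)) (\<lambda>x. \<lambda>b\<in>Basis. x \<bullet> b) = Pi\<^sub>M Basis (\<lambda>b::'a. distr gauss borel (\<lambda>x. x \<bullet> b))" .
qed auto

text \<open>Open boxes generate the Borel sets, are stable under intersection and exhaust the
  space.\<close>

lemma measure_eqI_box:
  fixes M N :: "'a::euclidean_space measure"
  assumes "prob_space M" and sM: "sets M = sets borel" and sN: "sets N = sets borel"
    and eq: "\<And>l u. emeasure M (box l u) = emeasure N (box l u)"
  shows "M = N"
proof (rule measure_eqI_generator_eq)
  let ?E = "range (\<lambda>(a, b). box a b::'a set)"
  let ?A = "\<lambda>n::nat. box (- (real n *\<^sub>R One)) (real n *\<^sub>R One) :: 'a set"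
  interpret prob_space M by fact
  show "Int_stable ?E"
    by (auto simp: Int_stable_def box_Int_box)
  show "?E \<subseteq> Pow UNIV" "sets M = sigma_sets UNIV ?E" "sets N = sigma_sets UNIV ?E"
    by (simp_all add: borel_eq_box sM sN)
  show "range ?A \<subseteq> ?E" "(\<Union>i. ?A i) = UNIV"
    unfolding UN_box_eq_UNIV by auto
  show "emeasure M (?A i) \<noteq> \<infinity>" for i
    by simp
  show "emeasure M X = emeasure N X" if "X \<in> ?E" for X
    using that eq by auto
qed

text \<open>Independence factorises the probability of a box. The bijection \<open>e\<close> from an
  arbitrary index set lets matrix entries, indexed by pairs, serve as coordinates.\<close>

lemma distr_eq_gauss:
  fixes X :: "'w \<Rightarrow> 'a::euclidean_space" and e :: "'i \<Rightarrow> 'a"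
  assumes "prob_space M" and [measurable]: "X \<in> borel_measurable M" and e: "bij_betw e I Basis"
    and ind: "prob_space.indep_vars M (\<lambda>_. borel) (\<lambda>i w. X w \<bullet> e i) I"
    and dist: "\<And>i. i \<in> I \<Longrightarrow> distributed M lborel (\<lambda>w. X w \<bullet> e i) std_normal_density"
  shows "distr M borel X = gauss"
proof (rule measure_eqI_box)
  interpret prob_space M by fact
  show "prob_space (distr M borel X)"
    by (rule prob_space_distr) simp
  fix l u :: 'a
  let ?S = "\<lambda>b. {l \<bullet> b <..< u \<bullet> b}"
  have eI: "e ` I = Basis" using e by (simp add: bij_betw_def)
  have I: "finite I" "I \<noteq> {}" "e ` I = Basis"
  proof -
    show "finite I" using bij_betw_finite[OF e] by simp
    show "I \<noteq> {}" using eI by (metis image_is_empty nonempty_Basis)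
  qed (rule eI)
  have 1: "emeasure M ((\<lambda>w. X w \<bullet> e i) -` ?S (e i) \<inter> space M) = emeasure (density lborel std_normal_density) (?S (e i))"
    if "i \<in> I" for i
  proof -
    have "emeasure M ((\<lambda>w. X w \<bullet> e i) -` ?S (e i) \<inter> space M) = emeasure (distr M lborel (\<lambda>w. X w \<bullet> e i)) (?S (e i))"
      using dist[OF that] by (subst emeasure_distr) (auto simp: distributed_def)
    then show ?thesis
      using dist[OF that] by (simp add: distributed_def)
  qed
  have "emeasure (distr M borel X) (box l u) = emeasure M (X -` box l u \<inter> space M)"
    by (rule emeasure_distr) auto
  also have "X -` box l u \<inter> space M = (\<Inter>i\<in>I. (\<lambda>w. X w \<bullet> e i) -` ?S (e i) \<inter> space M)"
    using I(2) by (auto simp: box_def I(3)[symmetric])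
  also have "emeasure M \<dots> = (\<Prod>i\<in>I. emeasure M ((\<lambda>w. X w \<bullet> e i) -` ?S (e i) \<inter> space M))"
    using indep_varsD_finite[OF ind I(2,1), of "\<lambda>i. ?S (e i)"] by (simp add: emeasure_eq_measure prod_ennreal)
  also have "\<dots> = (\<Prod>i\<in>I. emeasure (density lborel std_normal_density) (?S (e i)))"
    by (intro prod.cong refl 1)
  also have "\<dots> = (\<Prod>b\<in>Basis. emeasure (density lborel std_normal_density) (?S b))"
    by (rule prod.reindex_bij_betw[OF e])
  also have "\<dots> = emeasure gauss (box l u)"
    by (subst emeasure_gauss_cylinder[symmetric]) (auto simp: box_def)
  finally show "emeasure (distr M borel X) (box l u) = emeasure gauss (box l u)" .
qed auto

text \<open>The disjoint supports of the vectors \<open>a b\<close> make the coordinates of the image independent.\<close>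

lemma distr_gauss_image:
  fixes T :: "'a::euclidean_space \<Rightarrow> 'b::euclidean_space" and a :: "'b \<Rightarrow> 'a"
  assumes [measurable]: "T \<in> borel_measurable borel"
    and T: "\<And>b x. b \<in> Basis \<Longrightarrow> T x \<bullet> b = x \<bullet> a b"
    and norm: "\<And>b. b \<in> Basis \<Longrightarrow> norm (a b) = 1"
    and disj: "\<And>b b' i. b \<in> Basis \<Longrightarrow> b' \<in> Basis \<Longrightarrow> b \<noteq> b' \<Longrightarrow> i \<in> Basis \<Longrightarrow> (a b \<bullet> i) * (a b' \<bullet> i) = 0"
  shows "distr gauss borel T = gauss"
proof (rule distr_eq_gauss[where e="\<lambda>b. b"])
  define K where "K b = {i\<in>Basis. a b \<bullet> i \<noteq> 0}" for b
  have K: "finite (K b)" "K b \<subseteq> Basis" for b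
    by (auto simp: K_def)
  have sum_K: "x \<bullet> a b = (\<Sum>i\<in>K b. (a b \<bullet> i) * (x \<bullet> i))" for x b
  proof -
    have "x \<bullet> a b = (\<Sum>i\<in>Basis. (a b \<bullet> i) * (x \<bullet> i))"
      by (subst euclidean_inner) (simp add: mult.commute)
    also have "\<dots> = (\<Sum>i\<in>K b. (a b \<bullet> i) * (x \<bullet> i))"
      by (rule sum.mono_neutral_right) (auto simp: K_def)
    finally show ?thesis .
  qed
  have "gauss.indep_vars (\<lambda>b. Pi\<^sub>M (K b) (\<lambda>_. borel)) (\<lambda>b x. restrict (\<lambda>i. x \<bullet> i) (K b)) Basis"
  proof (rule gauss.indep_vars_restrict[OF indep_vars_gauss_Basis K(2)])
    show "disjoint_family_on K Basis"
      using disj by (fastforce simp: disjoint_family_on_def K_def)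
  qed
  then have "gauss.indep_vars (\<lambda>b. borel) (\<lambda>b x. (\<Sum>i\<in>K b. (a b \<bullet> i) * restrict (\<lambda>i. x \<bullet> i) (K b) i)) Basis"
    by (rule gauss.indep_vars_compose2[where Y="\<lambda>b f. \<Sum>i\<in>K b. (a b \<bullet> i) * f i"]) auto
  moreover have "(\<Sum>i\<in>K b. (a b \<bullet> i) * restrict (\<lambda>i. x \<bullet> i) (K b) i) = T x \<bullet> b" if "b \<in> Basis" for b x
    using that by (simp add: T sum_K)
  ultimately show "gauss.indep_vars (\<lambda>b. borel) (\<lambda>b x. T x \<bullet> b) Basis"
    by (subst (asm) gauss.indep_vars_cong) auto
  fix b :: 'b assume b: "b \<in> Basis"
  have "(norm (a b))\<^sup>2 = (\<Sum>i\<in>K b. (a b \<bullet> i)\<^sup>2)"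
    unfolding power2_norm_eq_inner unfolding power2_eq_square by (rule sum_K)
  with norm[OF b] have sq: "(\<Sum>i\<in>K b. (a b \<bullet> i)\<^sup>2) = 1"
    by simp
  have "distributed gauss lborel (\<lambda>x. \<Sum>i\<in>K b. (a b \<bullet> i) * (x \<bullet> i))
     (normal_density (\<Sum>i\<in>K b. 0) (sqrt (\<Sum>i\<in>K b. \<bar>a b \<bullet> i\<bar>\<^sup>2)))"
  proof (rule gauss.sum_indep_normal)
    show "K b \<noteq> {}" using sq by auto
    have "gauss.indep_vars (\<lambda>_. borel) (\<lambda>i x. x \<bullet> i) (K b)"
      by (rule gauss.indep_vars_subset[OF indep_vars_gauss_Basis K(2)])
    then show "gauss.indep_vars (\<lambda>_. borel) (\<lambda>i x. (a b \<bullet> i) * (x \<bullet> i)) (K b)"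
      by (rule gauss.indep_vars_compose2[where Y="\<lambda>i t. (a b \<bullet> i) * t"]) auto
    fix i assume i: "i \<in> K b"
    then show "0 < \<bar>a b \<bullet> i\<bar>" by (simp add: K_def)
    have "distributed gauss lborel (\<lambda>x. x \<bullet> i) std_normal_density"
      using i by (intro distributed_gauss_inner_Basis) (auto simp: K_def)
    from gauss.normal_density_affine[OF this, of "a b \<bullet> i" 0] i
    show "distributed gauss lborel (\<lambda>x. (a b \<bullet> i) * (x \<bullet> i)) (normal_density 0 \<bar>a b \<bullet> i\<bar>)"
      by (simp add: K_def)
  qed (rule K)
  then show "distributed gauss lborel (\<lambda>x. T x \<bullet> b) std_normal_density"
    using sq b by (simp add: T sum_K)
qed (auto intro: gauss.prob_space_axioms simp: bij_betw_def)

text \<open>The basis of a product type is the disjoint union of the two embedded bases, so the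
  density factorises. This makes Fubini's theorem available for Gaussians on product types.\<close>

lemma gauss_pair: "(gauss :: ('a::euclidean_space \<times> 'b::euclidean_space) measure) = gauss \<Otimes>\<^sub>M gauss"
proof -
  have fin: "sigma_finite_measure (gauss :: 'b measure)"
    by unfold_locales
  have P: "(\<Prod>b\<in>(Basis :: ('a \<times> 'b) set). std_normal_density ((x, y) \<bullet> b))
     = (\<Prod>b\<in>Basis. std_normal_density (x \<bullet> b)) * (\<Prod>b\<in>Basis. std_normal_density (y \<bullet> b))" for x :: 'a and y :: 'b
    unfolding Basis_prod_def
    by (subst prod.union_disjoint) (auto simp: prod.reindex inj_on_def)
  have "(gauss \<Otimes>\<^sub>M gauss :: ('a \<times> 'b) measure) =
    density (lborel \<Otimes>\<^sub>M lborel) (\<lambda>(x, y). ennreal (\<Prod>b\<in>Basis. std_normal_density (x \<bullet> b)) * ennreal (\<Prod>b\<in>Basis. std_normal_density (y \<bullet> b)))"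
    unfolding gauss_def
    by (rule pair_measure_density) (use fin in \<open>auto simp: gauss_def intro: lborel.sigma_finite_measure_axioms\<close>)
  also have "\<dots> = gauss"
    unfolding gauss_def lborel_prod
    by (intro arg_cong2[where f=density] refl ext) (auto simp: P ennreal_mult'[symmetric] prod_nonneg)
  finally show ?thesis ..
qed

lemma gauss_integral_pair:
  fixes f :: "'a::euclidean_space \<times> 'b::euclidean_space \<Rightarrow> real"
  assumes "integrable gauss f"
  shows "(\<integral>x. (\<integral>y. f (x, y) \<partial>gauss) \<partial>gauss) = integral\<^sup>L gauss f"
    and "integrable gauss (\<lambda>x. \<integral>y. f (x, y) \<partial>gauss)"
proof -
  interpret pair_sigma_finite "gauss :: 'a measure" "gauss :: 'b measure"
    by unfold_locales
  show "(\<integral>x. (\<integral>y. f (x, y) \<partial>gauss) \<partial>gauss) = integral\<^sup>L gauss f"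
    "integrable gauss (\<lambda>x. \<integral>y. f (x, y) \<partial>gauss)"
    using assms integral_fst'[of f] integrable_fst'[of f] by (simp_all add: gauss_pair)
qed

lemma integral_gauss_image:
  fixes T :: "'a::euclidean_space \<Rightarrow> 'b::euclidean_space" and f :: "'b \<Rightarrow> real"
  assumes "distr gauss borel T = gauss" "T \<in> borel_measurable borel" "f \<in> borel_measurable borel"
  shows "(\<integral>x. f (T x) \<partial>gauss) = (\<integral>x. f x \<partial>gauss)"
proof -
  have "(\<integral>x. f x \<partial>gauss) = (\<integral>x. f x \<partial>distr gauss borel T)"
    by (simp add: assms)
  also have "\<dots> = (\<integral>x. f (T x) \<partial>gauss)"
    using assms by (subst integral_distr) auto
  finally show ?thesis ..
qed

lemma distr_gauss_uminus: "distr gauss borel (\<lambda>x. - x) = (gauss :: 'a::euclidean_space measure)"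
  by (rule distr_gauss_image[where a="\<lambda>b. - b"]) (auto simp: inner_Basis)

lemma distr_gauss_rotate:
  fixes c d :: real
  assumes "c\<^sup>2 + d\<^sup>2 = 1"
  shows "distr gauss borel (\<lambda>(x, y). c *\<^sub>R x + d *\<^sub>R y) = (gauss :: 'a::euclidean_space measure)"
proof (rule distr_gauss_image[where a="\<lambda>b. (c *\<^sub>R b, d *\<^sub>R b)"])
  fix b b' :: 'a and i :: "'a \<times> 'a" assume *: "b \<in> Basis" "b' \<in> Basis" "b \<noteq> b'" "i \<in> Basis"
  then consider u where "u \<in> Basis" "i = (u, 0)" | u where "u \<in> Basis" "i = (0, u)"
    by (auto simp: Basis_prod_def)
  then show "((c *\<^sub>R b, d *\<^sub>R b) \<bullet> i) * ((c *\<^sub>R b', d *\<^sub>R b') \<bullet> i) = 0"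
    by cases (use * in \<open>auto simp: inner_Basis\<close>)
next
  show "(\<lambda>(x, y). c *\<^sub>R x + d *\<^sub>R y) \<in> borel_measurable (borel :: ('a \<times> 'a) measure)"
    by (intro borel_measurable_continuous_onI) (auto simp: split_beta intro!: continuous_intros)
qed (use assms in \<open>auto simp: inner_add_left split_beta norm_Pair power_mult_distrib\<close>)

lemma distr_gauss_inner:
  fixes a :: "'a::euclidean_space"
  assumes "norm a = 1"
  shows "distr gauss borel (\<lambda>x. x \<bullet> a) = (gauss :: real measure)"
  by (rule distr_gauss_image[where a="\<lambda>_. a"]) (use assms in auto)

section \<open>Exponential integrability and moments\<close>

lemma integrable_exp_norm:
  "integrable gauss (\<lambda>x::'a::euclidean_space. exp (c * norm x))"
proof -
  have 1: "integrable lborel (\<lambda>t::real. std_normal_density t * exp (k * t))" for k :: real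
  proof -
    \<comment> \<open>Completing the square: up to the factor \<open>exp (k\<^sup>2 / 2)\<close>,
      tilting by \<open>exp (k * t)\<close> moves the mean to \<open>k\<close>.\<close>
    have "integrable lborel (\<lambda>t. exp (k\<^sup>2 / 2) * normal_density k 1 t)"
      by (intro integrable_mult_right) auto
    moreover have "exp (k\<^sup>2 / 2) * normal_density k 1 t = std_normal_density t * exp (k * t)" for t
    proof -
      have "k\<^sup>2 / 2 + - ((t - k)\<^sup>2 / 2) = - (t\<^sup>2 / 2) + k * t"
        by (simp add: power2_eq_square field_simps)
      then show ?thesis
        by (simp add: normal_density_def exp_add[symmetric])
    qed
    ultimately show ?thesis by simp
  qed
  have 2: "(\<integral>\<^sup>+t. ennreal (exp (\<bar>c\<bar> * \<bar>t\<bar>)) \<partial>density lborel std_normal_density) < \<infinity>"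
  proof -
    have "integrable lborel (\<lambda>t. std_normal_density t * exp (\<bar>c\<bar> * t) + std_normal_density t * exp (- \<bar>c\<bar> * t))"
      by (intro Bochner_Integration.integrable_add 1)
    then have "integrable lborel (\<lambda>t. std_normal_density t * exp (\<bar>c\<bar> * \<bar>t\<bar>))"
    proof (rule Bochner_Integration.integrable_bound)
      have "exp (\<bar>c\<bar> * \<bar>t\<bar>) \<le> exp (\<bar>c\<bar> * t) + exp (- \<bar>c\<bar> * t)" for t
        by (cases "t \<ge> 0") auto
      then have "std_normal_density t * exp (\<bar>c\<bar> * \<bar>t\<bar>)
          \<le> std_normal_density t * exp (\<bar>c\<bar> * t) + std_normal_density t * exp (- \<bar>c\<bar> * t)" for t
        by (metis distrib_left mult_left_mono normal_density_nonneg)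
      then show "AE t in lborel. norm (std_normal_density t * exp (\<bar>c\<bar> * \<bar>t\<bar>))
          \<le> norm (std_normal_density t * exp (\<bar>c\<bar> * t) + std_normal_density t * exp (- \<bar>c\<bar> * t))"
        by (intro AE_I2) (simp add: abs_mult)
    qed auto
    then have "integrable (density lborel std_normal_density) (\<lambda>t. exp (\<bar>c\<bar> * \<bar>t\<bar>))"
      by (subst integrable_real_density) auto
    then show ?thesis
      by (simp add: integrable_iff_bounded)
  qed
  have "(\<integral>\<^sup>+x. (\<Prod>b\<in>(Basis::'a set). ennreal (exp (\<bar>c\<bar> * \<bar>x \<bullet> b\<bar>))) \<partial>gauss) < \<infinity>"
    by (subst nn_integral_gauss_prod) (use 2 in \<open>auto simp: power_less_top_ennreal\<close>)
  \<comment> \<open>Bounding the norm by the sum of the absolute coordinates turns the exponential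
    into a product of one-dimensional factors.\<close>
  moreover have "ennreal (exp (c * norm x)) \<le> (\<Prod>b\<in>Basis. ennreal (exp (\<bar>c\<bar> * \<bar>x \<bullet> b\<bar>)))" for x :: 'a
  proof -
    have "c * norm x \<le> \<bar>c\<bar> * norm x" by (intro mult_right_mono) auto
    also have "\<dots> \<le> \<bar>c\<bar> * (\<Sum>b\<in>Basis. \<bar>x \<bullet> b\<bar>)"
      by (intro mult_left_mono norm_le_l1) auto
    finally show ?thesis
      by (simp add: prod_ennreal exp_sum[symmetric] sum_distrib_left)
  qed
  ultimately have "(\<integral>\<^sup>+x. ennreal (exp (c * norm x)) \<partial>(gauss::'a measure)) < \<infinity>"
    by (meson nn_integral_mono order_le_less_trans)
  then show ?thesis
    by (simp add: integrable_iff_bounded)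
qed

lemma integrable_gauss_exp_bound:
  fixes f :: "'a::euclidean_space \<Rightarrow> 'b::euclidean_space"
  assumes "f \<in> borel_measurable borel" "\<And>x. norm (f x) \<le> B * exp (c * norm x)"
  shows "integrable gauss f"
proof (rule Bochner_Integration.integrable_bound)
  show "integrable gauss (\<lambda>x::'a. B * exp (c * norm x))"
    by (intro integrable_mult_right integrable_exp_norm)
  show "AE x in gauss. norm (f x) \<le> norm (B * exp (c * norm x))"
    using assms(2) by (intro AE_I2) (smt (verit) real_norm_def)
qed (use assms in simp)

lemma gauss_inner_moments:
  fixes a :: "'a::euclidean_space"
  shows gauss_inner_mean: "(\<integral>x. x \<bullet> a \<partial>gauss) = 0"
    and gauss_inner_square: "(\<integral>x. (x \<bullet> a)\<^sup>2 \<partial>gauss) = (norm a)\<^sup>2"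
proof -
  have "(\<integral>x. (- x) \<bullet> a \<partial>gauss) = (\<integral>x. x \<bullet> a \<partial>gauss)"
    by (rule integral_gauss_image[OF distr_gauss_uminus]) auto
  then show "(\<integral>x. x \<bullet> a \<partial>gauss) = 0"
    by simp
  show "(\<integral>x. (x \<bullet> a)\<^sup>2 \<partial>gauss) = (norm a)\<^sup>2"
  proof (cases "a = 0")
    case False
    define e where "e = sgn a"
    have e: "norm e = 1" and a: "a = norm a *\<^sub>R e"
      using False by (auto simp: e_def norm_sgn sgn_div_norm)
    have "(\<integral>x. (x \<bullet> e)\<^sup>2 \<partial>gauss) = (\<integral>t. t\<^sup>2 \<partial>(gauss :: real measure))"
      by (rule integral_gauss_image[OF distr_gauss_inner[OF e]]) auto
    also have "\<dots> = (\<integral>t. std_normal_density t * t^(2*1) \<partial>lborel)"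
      unfolding gauss_def by (subst integral_density) auto
    also have "\<dots> = 1"
      by (subst integral_std_normal_moment_even) simp
    finally have *: "(\<integral>x. (x \<bullet> e)\<^sup>2 \<partial>gauss) = 1" .
    have "(\<integral>x. (x \<bullet> a)\<^sup>2 \<partial>gauss) = (\<integral>x. (norm a)\<^sup>2 * (x \<bullet> e)\<^sup>2 \<partial>gauss)"
      by (subst a) (simp add: power_mult_distrib)
    then show ?thesis by (simp add: *)
  qed simp
qed

lemma std_gaussian_eq_gauss: "(std_gaussian :: (real^'n) measure) = gauss"
proof -
  have "(\<Prod>b\<in>Basis. std_normal_density (x \<bullet> b)) = (\<Prod>k\<in>UNIV. std_normal_density (x $ k))" for x :: "real^'n"
    by (simp add: Basis_vec_def UNION_singleton_eq_range prod.reindex axis_eq_axis inj_on_def inner_axis)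
  then show ?thesis
    by (simp add: std_gaussian_def gauss_def)
qed

section \<open>Gaussian concentration\<close>

lemma measure_gauss_UNIV [simp]: "measure gauss UNIV = 1"
  using gauss.prob_space by simp

text \<open>A single term of the exponential series gives \<open>t ^ k \<le> fact k * exp t\<close>.
  The shift \<open>m\<close> makes room for the mean that is subtracted when an increment is
  centred.\<close>

lemma integrable_gauss_growth:
  assumes "0 \<le> m"
  shows "integrable gauss (\<lambda>x::'a::euclidean_space. (norm x + m) ^ k * exp (c * (norm x + m)))"
proof (rule integrable_gauss_exp_bound)
  fix x :: 'a
  have p: "0 \<le> norm x + m" using assms by simp
  have "(norm x + m) ^ k \<le> fact k * exp (norm x + m)"
  proof -
    have "(norm x + m) ^ k / fact k \<le> exp (norm x + m)"
      using p sum_le_suminf[OF summable_exp_generic[of "norm x + m"], of "{k}"]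
      by (simp add: exp_def divide_inverse mult.commute)
    then show ?thesis by (simp add: field_simps)
  qed
  then have "(norm x + m) ^ k * exp (c * (norm x + m)) \<le> (fact k * exp (norm x + m)) * exp (c * (norm x + m))"
    by (rule mult_right_mono) simp
  also have "\<dots> = (fact k * exp (m * (1 + c))) * exp ((1 + c) * norm x)"
    by (simp add: mult_exp_exp algebra_simps)
  finally show "norm ((norm x + m) ^ k * exp (c * (norm x + m))) \<le> (fact k * exp (m * (1 + c))) * exp ((1 + c) * norm x)"
    using p by (simp add: abs_mult power_abs)
qed measurable

lemma integrable_gauss_norm_power: "integrable gauss (\<lambda>x::'a::euclidean_space. norm x ^ k)"
  using integrable_gauss_growth[of 0 k 0] by simp

lemma lipschitz_on_borel_measurable:
  fixes F :: "'a::euclidean_space \<Rightarrow> real"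
  assumes "L-lipschitz_on UNIV F"
  shows "F \<in> borel_measurable borel"
  by (rule borel_measurable_continuous_onI) (rule lipschitz_on_continuous_on[OF assms])

lemma lipschitz_increment:
  fixes F :: "'a::euclidean_space \<Rightarrow> real"
  assumes "L-lipschitz_on UNIV F"
  shows "\<bar>F (x + y) - F x\<bar> \<le> L * norm y"
  using lipschitz_onD[OF assms, of "x + y" x] by (simp add: dist_norm)

lemma lipschitz_growth:
  fixes F :: "'a::euclidean_space \<Rightarrow> real"
  assumes "L-lipschitz_on UNIV F"
  shows "\<bar>F (z + r *\<^sub>R x)\<bar> \<le> \<bar>F z\<bar> + L * \<bar>r\<bar> * norm x"
  using lipschitz_increment[OF assms, of z "r *\<^sub>R x"] by simp

lemma integrable_gauss_lipschitz:
  fixes F :: "'a::euclidean_space \<Rightarrow> real"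
  assumes F: "L-lipschitz_on UNIV F"
  shows "integrable gauss (\<lambda>x. F (z + r *\<^sub>R x))"
proof (rule integrable_gauss_exp_bound)
  fix x :: 'a
  have 1: "\<bar>F z\<bar> * 1 \<le> \<bar>F z\<bar> * exp (1 * norm x)"
    by (intro mult_left_mono) auto
  have "norm x \<le> exp (1 * norm x)"
    using exp_ge_add_one_self[of "norm x"] unfolding mult_1 by linarith
  then have 2: "L * \<bar>r\<bar> * norm x \<le> L * \<bar>r\<bar> * exp (1 * norm x)"
    using lipschitz_on_nonneg[OF F] by (intro mult_left_mono) auto
  show "norm (F (z + r *\<^sub>R x)) \<le> (\<bar>F z\<bar> + L * \<bar>r\<bar>) * exp (1 * norm x)"
    using lipschitz_growth[OF F, of z r x] 1 2 by (simp add: algebra_simps)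
qed (use lipschitz_on_borel_measurable[OF F] in measurable)

lemma integrable_gauss_exp_lipschitz:
  fixes F :: "'a::euclidean_space \<Rightarrow> real"
  assumes F: "L-lipschitz_on UNIV F"
  shows "integrable gauss (\<lambda>x. exp (c * F (z + r *\<^sub>R x)))"
proof (rule integrable_gauss_exp_bound)
  fix x :: 'a
  have "c * F (z + r *\<^sub>R x) \<le> \<bar>c\<bar> * \<bar>F (z + r *\<^sub>R x)\<bar>"
    by (metis abs_ge_self abs_mult)
  also have "\<dots> \<le> \<bar>c\<bar> * (\<bar>F z\<bar> + L * \<bar>r\<bar> * norm x)"
    by (intro mult_left_mono lipschitz_growth[OF F]) simp
  finally show "norm (exp (c * F (z + r *\<^sub>R x))) \<le> exp (\<bar>c\<bar> * \<bar>F z\<bar>) * exp ((\<bar>c\<bar> * (L * \<bar>r\<bar>)) * norm x)"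
    by (simp add: mult_exp_exp algebra_simps)
qed (use lipschitz_on_borel_measurable[OF F] in measurable)

text \<open>Semigroup property of Gaussian averages: independent parts of variance \<open>s\<close>
  and \<open>t\<close> form one of variance \<open>s + t\<close>, by the rotation with
  \<open>c = sqrt s / sqrt (s + t)\<close>. It serves to split off one increment.\<close>

lemma gauss_add:
  fixes f :: "'a::euclidean_space \<Rightarrow> real"
  assumes f: "f \<in> borel_measurable borel"
    and st: "0 \<le> s" "0 \<le> t" "0 < s + t"
    and int: "integrable gauss (\<lambda>w. f (x + sqrt (s + t) *\<^sub>R w))"
  shows "(\<integral>u. (\<integral>v. f (x + sqrt s *\<^sub>R u + sqrt t *\<^sub>R v) \<partial>gauss) \<partial>gauss) = (\<integral>w. f (x + sqrt (s + t) *\<^sub>R w) \<partial>gauss)"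
    and "integrable gauss (\<lambda>u. \<integral>v. f (x + sqrt s *\<^sub>R u + sqrt t *\<^sub>R v) \<partial>gauss)"
proof -
  define c d where "c = sqrt s / sqrt (s + t)" and "d = sqrt t / sqrt (s + t)"
  have cd: "c\<^sup>2 + d\<^sup>2 = 1"
    using st by (simp add: c_def d_def power_divide add_divide_distrib[symmetric])
  define T where "T = (\<lambda>(u::'a, v::'a). c *\<^sub>R u + d *\<^sub>R v)"
  have T: "distr gauss borel T = gauss"
    unfolding T_def by (rule distr_gauss_rotate[OF cd])
  have mT: "T \<in> borel_measurable borel"
    unfolding T_def
    by (intro borel_measurable_continuous_onI) (auto simp: split_beta intro!: continuous_intros)
  have eq: "f (x + sqrt (s + t) *\<^sub>R T p) = (case p of (u, v) \<Rightarrow> f (x + sqrt s *\<^sub>R u + sqrt t *\<^sub>R v))" for p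
    using st by (simp add: T_def c_def d_def split_beta scaleR_add_right add.assoc)
  have mf: "(\<lambda>w. f (x + sqrt (s + t) *\<^sub>R w)) \<in> borel_measurable borel"
    using f by measurable
  have "integrable (distr gauss borel T) (\<lambda>w. f (x + sqrt (s + t) *\<^sub>R w))"
    using int by (simp add: T)
  then have I: "integrable gauss (\<lambda>(u, v). f (x + sqrt s *\<^sub>R u + sqrt t *\<^sub>R v))"
    using mf mT by (subst (asm) integrable_distr_eq) (auto simp: eq)
  have "(\<integral>w. f (x + sqrt (s + t) *\<^sub>R w) \<partial>gauss) = (\<integral>p. f (x + sqrt (s + t) *\<^sub>R T p) \<partial>gauss)"
    by (rule integral_gauss_image[OF T mT mf, symmetric])
  with gauss_integral_pair[OF I] show
    "(\<integral>u. (\<integral>v. f (x + sqrt s *\<^sub>R u + sqrt t *\<^sub>R v) \<partial>gauss) \<partial>gauss) = (\<integral>w. f (x + sqrt (s + t) *\<^sub>R w) \<partial>gauss)"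
    "integrable gauss (\<lambda>u. \<integral>v. f (x + sqrt s *\<^sub>R u + sqrt t *\<^sub>R v) \<partial>gauss)"
    by (simp_all add: eq)
qed

lemma exp_le_cubic: "exp (z::real) \<le> 1 + z + z\<^sup>2 / 2 + \<bar>z\<bar> ^ 3 * exp \<bar>z\<bar>"
proof -
  obtain t where t: "\<bar>t\<bar> \<le> \<bar>z\<bar>" "exp z = (\<Sum>m<3. z ^ m / fact m) + exp t / fact 3 * z ^ 3"
    using Maclaurin_exp_le[of z 3] by auto
  have "exp t / fact 3 * z ^ 3 \<le> \<bar>exp t / fact 3 * z ^ 3\<bar>" by (rule abs_ge_self)
  also have "\<dots> = \<bar>z\<bar> ^ 3 * (exp t / 6)"
    by (simp add: abs_mult power_abs fact_numeral)
  also have "\<dots> \<le> \<bar>z\<bar> ^ 3 * exp \<bar>z\<bar>"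
  proof (rule mult_left_mono)
    have "exp t / 6 \<le> exp t" by simp
    also have "exp t \<le> exp \<bar>z\<bar>" using t(1) by simp
    finally show "exp t / 6 \<le> exp \<bar>z\<bar>" .
  qed simp
  finally show ?thesis
    using t(2) by (simp add: eval_nat_numeral)
qed

text \<open>Centring the increment kills the linear term of the expansion, the quadratic term
  contributes \<open>l\<^sup>2 * h / 2\<close> up to order \<open>h * sqrt h\<close>, and
  \<open>1 + z \<le> exp z\<close> restores the exponential form. \<open>K\<close> is fixed before
  \<open>F\<close>, \<open>D\<close>, \<open>x\<close> and \<open>h\<close>, because each step
  treats a different function and the errors have to add up uniformly.\<close>

lemma gauss_exp_increment:
  fixes C l :: real
  assumes C: "0 \<le> C" and l: "0 \<le> l"
  obtains K where "0 \<le> K"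
    and "\<And>(F::'a::euclidean_space \<Rightarrow> real) D x h. 1-lipschitz_on UNIV F \<Longrightarrow> norm D \<le> 1 \<Longrightarrow>
      (\<And>y. \<bar>F (x + y) - F x - D \<bullet> y\<bar> \<le> C * (norm y)\<^sup>2) \<Longrightarrow> 0 \<le> h \<Longrightarrow> h \<le> 1 \<Longrightarrow>
      (\<integral>g. exp (- l * F (x + sqrt h *\<^sub>R g)) \<partial>gauss)
        \<le> exp (- l * (\<integral>g. F (x + sqrt h *\<^sub>R g) \<partial>gauss) + l\<^sup>2 * h / 2 + K * (h * sqrt h))"
proof
  define m where "m = (\<integral>g. norm (g::'a) \<partial>gauss)"
  have m: "0 \<le> m" unfolding m_def by simp
  \<comment> \<open>After division by \<open>h * sqrt h\<close>, \<open>q\<close> majorises the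
    cubic remainder of the exponential and \<open>p\<close> the error of replacing the squared
    increment by the square of its linear part.\<close>
  define q where "q g = l ^ 3 * ((norm g + m) ^ 3 * exp (l * (norm g + m)))" for g :: 'a
  define p where "p g = 2 * C * norm g ^ 3 + C\<^sup>2 * norm g ^ 4" for g :: 'a
  define K where "K = l\<^sup>2 / 2 * (\<integral>g. p g \<partial>gauss) + (\<integral>g. q g \<partial>gauss)"
  have iq: "integrable gauss q"
    unfolding q_def by (intro integrable_mult_right integrable_gauss_growth m)
  have ip: "integrable gauss p"
    unfolding p_def by (intro integrable_mult_right Bochner_Integration.integrable_add integrable_gauss_norm_power)
  show K: "0 \<le> K"
    unfolding K_def using C l m
    by (intro add_nonneg_nonneg mult_nonneg_nonneg integral_nonneg) (auto simp: p_def q_def)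
  fix F :: "'a \<Rightarrow> real" and D x :: 'a and h :: real
  assume F: "1-lipschitz_on UNIV F" and D: "norm D \<le> 1"
    and R: "\<And>y. \<bar>F (x + y) - F x - D \<bullet> y\<bar> \<le> C * (norm y)\<^sup>2" and h: "0 \<le> h" "h \<le> 1"
  note [measurable] = lipschitz_on_borel_measurable[OF F]
  define Z where "Z g = F (x + sqrt h *\<^sub>R g) - F x" for g
  define e where "e = (\<integral>g. Z g \<partial>gauss)"
  have iF: "integrable gauss (\<lambda>g. F (x + sqrt h *\<^sub>R g))"
    by (rule integrable_gauss_lipschitz[OF F])
  have iZ: "integrable gauss Z"
    unfolding Z_def by (intro Bochner_Integration.integrable_diff iF) simp
  have Z: "\<bar>Z g\<bar> \<le> sqrt h * norm g" for g
    using lipschitz_increment[OF F, of x "sqrt h *\<^sub>R g"] h by (simp add: Z_def)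
  have "\<bar>e\<bar> \<le> (\<integral>g. \<bar>Z g\<bar> \<partial>gauss)"
    unfolding e_def by (rule integral_abs_bound)
  also have "\<dots> \<le> (\<integral>g. sqrt h * norm g \<partial>(gauss :: 'a measure))"
    using integrable_gauss_norm_power[of 1] iZ Z
    by (intro integral_mono integrable_mult_right integrable_abs) auto
  finally have e: "\<bar>e\<bar> \<le> sqrt h * m"
    by (simp add: m_def)
  have sq: "Z g ^ 2 \<le> h * (g \<bullet> D)\<^sup>2 + (h * sqrt h) * p g" for g
  proof -
    define r where "r = Z g - sqrt h * (g \<bullet> D)"
    have r: "\<bar>r\<bar> \<le> C * h * (norm g)\<^sup>2"
      using R[of "sqrt h *\<^sub>R g"] h by (simp add: r_def Z_def power_mult_distrib inner_commute mult.assoc)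
    have gD: "\<bar>g \<bullet> D\<bar> \<le> norm g"
      using Cauchy_Schwarz_ineq2[of g D] mult_left_le[OF D norm_ge_zero[of g]] by linarith
    have "Z g = sqrt h * (g \<bullet> D) + r" by (simp add: r_def)
    then have "Z g ^ 2 = h * (g \<bullet> D)\<^sup>2 + 2 * sqrt h * ((g \<bullet> D) * r) + r\<^sup>2"
      using h by (simp add: power2_sum power_mult_distrib)
    moreover have "(g \<bullet> D) * r \<le> norm g * (C * h * (norm g)\<^sup>2)"
    proof -
      have "(g \<bullet> D) * r \<le> \<bar>g \<bullet> D\<bar> * \<bar>r\<bar>" by (metis abs_ge_self abs_mult)
      also have "\<dots> \<le> norm g * (C * h * (norm g)\<^sup>2)"
        by (intro mult_mono gD r) auto
      finally show ?thesis .
    qed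
    then have "2 * sqrt h * ((g \<bullet> D) * r) \<le> 2 * sqrt h * (norm g * (C * h * (norm g)\<^sup>2))"
      using h by (intro mult_left_mono) auto
    moreover have "r\<^sup>2 \<le> (h * sqrt h) * (C\<^sup>2 * norm g ^ 4)"
    proof -
      have "r\<^sup>2 \<le> (C * h * (norm g)\<^sup>2)\<^sup>2"
        using r by (metis abs_ge_zero power2_abs power_mono)
      also have "\<dots> = (h * h) * (C\<^sup>2 * norm g ^ 4)"
        by (simp add: power_mult_distrib power2_eq_square eval_nat_numeral mult_ac)
      \<comment> \<open>\<open>h \<le> 1\<close> allows the higher order \<open>h * h\<close> to be
        absorbed into \<open>h * sqrt h\<close>.\<close>
      also have "\<dots> \<le> (h * sqrt h) * (C\<^sup>2 * norm g ^ 4)"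
      proof (intro mult_right_mono mult_left_mono)
        show "h \<le> sqrt h" using h
          by (intro real_le_rsqrt) (simp add: power2_eq_square mult_left_le)
      qed (use h in auto)
      finally show ?thesis .
    qed
    ultimately show ?thesis
      by (simp add: p_def algebra_simps power2_eq_square power3_eq_cube)
  qed
  have iD: "integrable gauss (\<lambda>g. (g \<bullet> D)\<^sup>2)"
  proof (rule Bochner_Integration.integrable_bound[OF integrable_gauss_norm_power[of 2]])
    have "(g \<bullet> D)\<^sup>2 \<le> (norm g)\<^sup>2" for g
      using Cauchy_Schwarz_ineq2[of g D] mult_left_le[OF D norm_ge_zero[of g]]
      by (intro abs_le_square_iff[THEN iffD1]) simp
    then show "AE g in gauss. norm ((g \<bullet> D)\<^sup>2) \<le> norm ((norm g)\<^sup>2)"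
      by (intro AE_I2) simp
  qed simp
  have iZ2: "integrable gauss (\<lambda>g. (Z g)\<^sup>2)"
  proof (rule Bochner_Integration.integrable_bound)
    show "integrable gauss (\<lambda>g. h * (g \<bullet> D)\<^sup>2 + (h * sqrt h) * p g)"
      by (intro Bochner_Integration.integrable_add integrable_mult_right iD ip)
    show "AE g in gauss. norm ((Z g)\<^sup>2) \<le> norm (h * (g \<bullet> D)\<^sup>2 + (h * sqrt h) * p g)"
    proof (rule AE_I2)
      show "norm ((Z g)\<^sup>2) \<le> norm (h * (g \<bullet> D)\<^sup>2 + (h * sqrt h) * p g)" for g
        using sq[of g] abs_ge_self[of "h * (g \<bullet> D)\<^sup>2 + (h * sqrt h) * p g"] by simp
    qed
  qed (simp add: Z_def)
  have EZ2: "(\<integral>g. (Z g)\<^sup>2 \<partial>gauss) \<le> h + h * sqrt h * (\<integral>g. p g \<partial>gauss)"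
  proof -
    have "(\<integral>g. (Z g)\<^sup>2 \<partial>gauss) \<le> (\<integral>g. h * (g \<bullet> D)\<^sup>2 + (h * sqrt h) * p g \<partial>gauss)"
      by (intro integral_mono iZ2 sq Bochner_Integration.integrable_add integrable_mult_right iD ip)
    also have "\<dots> = h * (norm D)\<^sup>2 + h * sqrt h * (\<integral>g. p g \<partial>gauss)"
      using iD ip by (simp add: gauss_inner_square)
    also have "h * (norm D)\<^sup>2 \<le> h * 1"
      using h D by (intro mult_left_mono) (auto simp: power_le_one)
    finally show ?thesis by simp
  qed
  define W where "W g = Z g - e" for g
  have iW: "integrable gauss W"
    unfolding W_def using iZ by simp
  have EW: "(\<integral>g. W g \<partial>gauss) = 0"
    unfolding W_def using iZ by (simp add: e_def)
  have W2: "(W g)\<^sup>2 = (Z g)\<^sup>2 - 2 * e * Z g + e\<^sup>2" for g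
    by (simp add: W_def power2_diff)
  have iW2: "integrable gauss (\<lambda>g. (W g)\<^sup>2)"
    unfolding W2 using iZ iZ2 by simp
  have EW2: "(\<integral>g. (W g)\<^sup>2 \<partial>gauss) \<le> (\<integral>g. (Z g)\<^sup>2 \<partial>gauss)"
  proof -
    have "(\<integral>g. (W g)\<^sup>2 \<partial>gauss) = (\<integral>g. (Z g)\<^sup>2 \<partial>gauss) - 2 * e * e + e\<^sup>2"
      unfolding W2 using iZ iZ2 by (simp add: e_def)
    then show ?thesis by (simp add: power2_eq_square)
  qed
  have W: "\<bar>l * W g\<bar> \<le> sqrt h * (l * (norm g + m))" for g
  proof -
    have "\<bar>W g\<bar> \<le> sqrt h * (norm g + m)"
      using Z[of g] e by (simp add: W_def algebra_simps)
    then have "l * \<bar>W g\<bar> \<le> l * (sqrt h * (norm g + m))"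
      using l by (intro mult_left_mono)
    then show ?thesis using l by (simp add: abs_mult mult_ac)
  qed
  have cub: "\<bar>l * W g\<bar> ^ 3 * exp \<bar>l * W g\<bar> \<le> (h * sqrt h) * q g" for g
  proof -
    have 1: "\<bar>l * W g\<bar> ^ 3 \<le> (sqrt h * (l * (norm g + m))) ^ 3"
      by (intro power_mono W) auto
    have "sqrt h * (l * (norm g + m)) \<le> 1 * (l * (norm g + m))"
      using h l m by (intro mult_right_mono) auto
    then have 2: "exp \<bar>l * W g\<bar> \<le> exp (l * (norm g + m))"
      using W[of g] by simp
    have "\<bar>l * W g\<bar> ^ 3 * exp \<bar>l * W g\<bar> \<le> (sqrt h * (l * (norm g + m))) ^ 3 * exp (l * (norm g + m))"
      using 1 2 h l m by (intro mult_mono) auto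
    also have "\<dots> = (h * sqrt h) * q g"
      using h by (simp add: q_def power_mult_distrib power3_eq_cube)
    finally show ?thesis .
  qed
  have pt: "exp (- l * W g) \<le> 1 + - l * W g + l\<^sup>2 / 2 * (W g)\<^sup>2 + (h * sqrt h) * q g" for g
    using exp_le_cubic[of "- l * W g"] cub[of g] by (simp add: power_mult_distrib)
  have split: "exp (- l * F (x + sqrt h *\<^sub>R g)) = exp (- l * (F x + e)) * exp (- l * W g)" for g
    by (simp add: W_def Z_def mult_exp_exp algebra_simps)
  have iE: "integrable gauss (\<lambda>g. exp (- l * W g))"
  proof -
    have "integrable gauss (\<lambda>g. exp (l * (F x + e)) * exp (- l * F (x + sqrt h *\<^sub>R g)))"
      by (intro integrable_mult_right integrable_gauss_exp_lipschitz[OF F])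
    then show ?thesis
      by (simp add: W_def Z_def mult_exp_exp algebra_simps)
  qed
  have "(\<integral>g. exp (- l * W g) \<partial>gauss)
      \<le> (\<integral>g. 1 + - l * W g + l\<^sup>2 / 2 * (W g)\<^sup>2 + (h * sqrt h) * q g \<partial>gauss)"
    by (intro integral_mono iE pt Bochner_Integration.integrable_add integrable_mult_right iW iW2 iq) simp
  also have "\<dots> = 1 + - l * (\<integral>g. W g \<partial>gauss) + l\<^sup>2 / 2 * (\<integral>g. (W g)\<^sup>2 \<partial>gauss) + (h * sqrt h) * (\<integral>g. q g \<partial>gauss)"
    using iW iW2 iq by simp
  also have "\<dots> \<le> 1 + l\<^sup>2 / 2 * (h + h * sqrt h * (\<integral>g. p g \<partial>gauss)) + (h * sqrt h) * (\<integral>g. q g \<partial>gauss)"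
    using EW EW2 EZ2 h by (intro add_mono mult_left_mono) auto
  also have "\<dots> = 1 + (l\<^sup>2 * h / 2 + K * (h * sqrt h))"
    by (simp add: K_def algebra_simps)
  also have "\<dots> \<le> exp (l\<^sup>2 * h / 2 + K * (h * sqrt h))"
    by (rule exp_ge_add_one_self)
  finally have fin: "(\<integral>g. exp (- l * W g) \<partial>gauss) \<le> exp (l\<^sup>2 * h / 2 + K * (h * sqrt h))" .
  have EF: "(\<integral>g. F (x + sqrt h *\<^sub>R g) \<partial>gauss) = F x + e"
    using iF by (simp add: e_def Z_def)
  have "(\<integral>g. exp (- l * F (x + sqrt h *\<^sub>R g)) \<partial>gauss) = exp (- l * (F x + e)) * (\<integral>g. exp (- l * W g) \<partial>gauss)"
    unfolding split by simp
  also have "\<dots> \<le> exp (- l * (F x + e)) * exp (l\<^sup>2 * h / 2 + K * (h * sqrt h))"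
    by (intro mult_left_mono fin) simp
  finally show "(\<integral>g. exp (- l * F (x + sqrt h *\<^sub>R g)) \<partial>gauss)
      \<le> exp (- l * (\<integral>g. F (x + sqrt h *\<^sub>R g) \<partial>gauss) + l\<^sup>2 * h / 2 + K * (h * sqrt h))"
    by (simp add: EF mult_exp_exp algebra_simps)
qed

lemma lipschitz_gauss_average:
  fixes F :: "'a::euclidean_space \<Rightarrow> real"
  assumes F: "L-lipschitz_on UNIV F"
  shows "L-lipschitz_on UNIV (\<lambda>x. \<integral>g. F (x + r *\<^sub>R g) \<partial>gauss)"
proof (rule lipschitz_onI)
  fix x y :: 'a
  have "dist (\<integral>g. F (x + r *\<^sub>R g) \<partial>gauss) (\<integral>g. F (y + r *\<^sub>R g) \<partial>gauss)
      = \<bar>\<integral>g. F (x + r *\<^sub>R g) - F (y + r *\<^sub>R g) \<partial>gauss\<bar>"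
    using integrable_gauss_lipschitz[OF F] by (simp add: dist_norm)
  also have "\<dots> \<le> (\<integral>g. \<bar>F (x + r *\<^sub>R g) - F (y + r *\<^sub>R g)\<bar> \<partial>gauss)"
    by (rule integral_abs_bound)
  also have "\<dots> \<le> (\<integral>g. L * dist x y \<partial>(gauss::'a measure))"
  proof (intro integral_mono integrable_abs Bochner_Integration.integrable_diff integrable_gauss_lipschitz[OF F])
    show "\<bar>F (x + r *\<^sub>R g) - F (y + r *\<^sub>R g)\<bar> \<le> L * dist x y" for g
      using lipschitz_onD[OF F, of "x + r *\<^sub>R g" "y + r *\<^sub>R g"] by (simp add: dist_real_def)
  qed simp
  finally show "dist (\<integral>g. F (x + r *\<^sub>R g) \<partial>gauss) (\<integral>g. F (y + r *\<^sub>R g) \<partial>gauss) \<le> L * dist x y"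
    by simp
qed (rule lipschitz_on_nonneg[OF F])

text \<open>The smoothness assumption is an expansion with uniform quadratic remainder; averaging
  \<open>F\<close> and \<open>D\<close> preserves it with the same \<open>C\<close>, so every
  intermediate average admits the one-step bound with the same \<open>K\<close>. An increment costs
  the factor \<open>exp (l\<^sup>2 * h / 2)\<close>; with \<open>h = 1 / n\<close> the
  \<open>n\<close> factors multiply to \<open>exp (l\<^sup>2 / 2)\<close>, and \<open>C\<close>
  disappears in the limit.\<close>

theorem gauss_concentration:
  fixes F :: "'a::euclidean_space \<Rightarrow> real" and D :: "'a \<Rightarrow> 'a"
  assumes F: "1-lipschitz_on UNIV F" and D: "D \<in> borel_measurable borel" "\<And>x. norm (D x) \<le> 1"
    and C: "0 \<le> C" and R: "\<And>x y. \<bar>F (x + y) - F x - D x \<bullet> y\<bar> \<le> C * (norm y)\<^sup>2"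
    and l: "0 \<le> l"
  shows "(\<integral>g. exp (- l * F g) \<partial>gauss) \<le> exp (- l * (\<integral>g. F g \<partial>gauss) + l\<^sup>2 / 2)"
proof -
  note [measurable] = lipschitz_on_borel_measurable[OF F] D(1)
  define \<Phi> where "\<Phi> t x = (\<integral>g. F (x + sqrt t *\<^sub>R g) \<partial>gauss)" for t x
  define E where "E t x = (\<integral>g. D (x + sqrt t *\<^sub>R g) \<partial>gauss)" for t x
  have iF: "integrable gauss (\<lambda>g. F (x + r *\<^sub>R g))" for x r
    by (rule integrable_gauss_lipschitz[OF F])
  have \<Phi>L: "1-lipschitz_on UNIV (\<Phi> t)" for t
    unfolding \<Phi>_def by (rule lipschitz_gauss_average[OF F])
  have iD: "integrable gauss (\<lambda>g. D (x + r *\<^sub>R g))" for x r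
    using D(2) by (intro gauss.integrable_const_bound[where B=1] AE_I2) auto
  have E: "norm (E t x) \<le> 1" for t x
  proof -
    have "norm (E t x) \<le> (\<integral>g. norm (D (x + sqrt t *\<^sub>R g)) \<partial>gauss)"
      unfolding E_def by (rule integral_norm_bound)
    also have "\<dots> \<le> (\<integral>g. 1 \<partial>(gauss :: 'a measure))"
      using D(2) iD by (intro integral_mono integrable_norm) auto
    finally show ?thesis by simp
  qed
  have ER: "\<bar>\<Phi> t (x + y) - \<Phi> t x - E t x \<bullet> y\<bar> \<le> C * (norm y)\<^sup>2" for t x y
  proof -
    have iDy: "integrable gauss (\<lambda>g. D (x + sqrt t *\<^sub>R g) \<bullet> y)"
      using iD by simp
    have eq: "\<Phi> t (x + y) - \<Phi> t x - E t x \<bullet> y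
        = (\<integral>g. F (x + y + sqrt t *\<^sub>R g) - F (x + sqrt t *\<^sub>R g) - D (x + sqrt t *\<^sub>R g) \<bullet> y \<partial>gauss)"
      unfolding \<Phi>_def E_def using iF iD iDy by (simp add: integral_inner_left)
    have "\<bar>\<Phi> t (x + y) - \<Phi> t x - E t x \<bullet> y\<bar> \<le> (\<integral>g. \<bar>F (x + y + sqrt t *\<^sub>R g) - F (x + sqrt t *\<^sub>R g) - D (x + sqrt t *\<^sub>R g) \<bullet> y\<bar> \<partial>gauss)"
      unfolding eq by (rule integral_abs_bound)
    also have "\<dots> \<le> (\<integral>g. C * (norm y)\<^sup>2 \<partial>(gauss :: 'a measure))"
    proof (intro integral_mono integrable_abs Bochner_Integration.integrable_diff iF iDy)
      show "\<bar>F (x + y + sqrt t *\<^sub>R g) - F (x + sqrt t *\<^sub>R g) - D (x + sqrt t *\<^sub>R g) \<bullet> y\<bar> \<le> C * (norm y)\<^sup>2" for g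
        using R[of "x + sqrt t *\<^sub>R g" y] by (simp add: add_ac)
    qed simp
    finally show ?thesis by simp
  qed
  obtain K where K: "0 \<le> K"
    and step: "\<And>(F::'a \<Rightarrow> real) D x h. 1-lipschitz_on UNIV F \<Longrightarrow> norm D \<le> 1 \<Longrightarrow>
      (\<And>y. \<bar>F (x + y) - F x - D \<bullet> y\<bar> \<le> C * (norm y)\<^sup>2) \<Longrightarrow> 0 \<le> h \<Longrightarrow> h \<le> 1 \<Longrightarrow>
      (\<integral>g. exp (- l * F (x + sqrt h *\<^sub>R g)) \<partial>gauss)
        \<le> exp (- l * (\<integral>g. F (x + sqrt h *\<^sub>R g) \<partial>gauss) + l\<^sup>2 * h / 2 + K * (h * sqrt h))"
    using gauss_exp_increment[OF C l, where 'a='a] by blast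
  have main: "(\<integral>g. exp (- l * F g) \<partial>gauss) \<le> exp (- l * (\<integral>g. F g \<partial>gauss) + l\<^sup>2 / 2 + K * sqrt (1 / real n))"
    if n: "0 < n" for n
  proof -
    define h where "h = 1 / real n"
    have h: "0 < h" "h \<le> 1" using n by (auto simp: h_def)
    \<comment> \<open>The induction covers all starting points: the hypothesis averages the last
      \<open>k\<close> increments at the point reached by the first one. This leaves
      \<open>\<Phi> (real k * h)\<close> to be averaged over a single increment.\<close>
    have ind: "(\<integral>g. exp (- l * F (x + sqrt (real k * h) *\<^sub>R g)) \<partial>gauss)
        \<le> exp (- l * \<Phi> (real k * h) x + real k * (l\<^sup>2 * h / 2 + K * (h * sqrt h)))" for k x
    proof (induction k arbitrary: x)
      case 0
      show ?case by (simp add: \<Phi>_def)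
    next
      case (Suc k)
      define a where "a = real k * (l\<^sup>2 * h / 2 + K * (h * sqrt h))"
      have S: "real (Suc k) * h = h + real k * h" by (simp add: algebra_simps)
      have iexp: "integrable gauss (\<lambda>w. exp (- l * F (x + r *\<^sub>R w)))" for r
        by (rule integrable_gauss_exp_lipschitz[OF F])
      have pos: "0 < h + real k * h" using h by (simp add: add_pos_nonneg)
      have [measurable]: "(\<lambda>x. exp (- l * F x)) \<in> borel_measurable borel" by measurable
      note A = gauss_add[of "\<lambda>x. exp (- l * F x)" h "real k * h" x, OF _ _ _ pos iexp]
      note B = gauss_add[of F h "real k * h" x, OF _ _ _ pos iF]
      have "(\<integral>g. exp (- l * F (x + sqrt (real (Suc k) * h) *\<^sub>R g)) \<partial>gauss)
          = (\<integral>u. (\<integral>v. exp (- l * F (x + sqrt h *\<^sub>R u + sqrt (real k * h) *\<^sub>R v)) \<partial>gauss) \<partial>gauss)"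
        unfolding S by (rule A(1)[symmetric]) (use h in auto)
      also have "\<dots> \<le> (\<integral>u. exp a * exp (- l * \<Phi> (real k * h) (x + sqrt h *\<^sub>R u)) \<partial>gauss)"
      proof (intro integral_mono integrable_mult_right integrable_gauss_exp_lipschitz[OF \<Phi>L])
        show "integrable gauss (\<lambda>u. \<integral>v. exp (- l * F (x + sqrt h *\<^sub>R u + sqrt (real k * h) *\<^sub>R v)) \<partial>gauss)"
          by (rule A(2)) (use h in auto)
        show "(\<integral>v. exp (- l * F (x + sqrt h *\<^sub>R u + sqrt (real k * h) *\<^sub>R v)) \<partial>gauss)
            \<le> exp a * exp (- l * \<Phi> (real k * h) (x + sqrt h *\<^sub>R u))" for u
          using Suc.IH[of "x + sqrt h *\<^sub>R u"] by (simp add: a_def mult_exp_exp add_ac)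
      qed
      also have "\<dots> = exp a * (\<integral>u. exp (- l * \<Phi> (real k * h) (x + sqrt h *\<^sub>R u)) \<partial>gauss)"
        by simp
      also have "\<dots> \<le> exp a * exp (- l * (\<integral>u. \<Phi> (real k * h) (x + sqrt h *\<^sub>R u) \<partial>gauss) + l\<^sup>2 * h / 2 + K * (h * sqrt h))"
        by (intro mult_left_mono step[OF \<Phi>L E ER]) (use h in auto)
      also have "(\<integral>u. \<Phi> (real k * h) (x + sqrt h *\<^sub>R u) \<partial>gauss) = \<Phi> (real (Suc k) * h) x"
        unfolding S \<Phi>_def by (rule B(1)) (use h in auto)
      also have "exp a * exp (- l * \<Phi> (real (Suc k) * h) x + l\<^sup>2 * h / 2 + K * (h * sqrt h))
          = exp (- l * \<Phi> (real (Suc k) * h) x + real (Suc k) * (l\<^sup>2 * h / 2 + K * (h * sqrt h)))"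
        by (simp add: a_def mult_exp_exp algebra_simps)
      finally show ?case .
    qed
    have nh: "real n * h = 1" using n by (simp add: h_def)
    have "real n * (l\<^sup>2 * h / 2 + K * (h * sqrt h)) = l\<^sup>2 * (real n * h) / 2 + K * (real n * h * sqrt h)"
      by (simp add: algebra_simps)
    also have "\<dots> = l\<^sup>2 / 2 + K * sqrt (1 / real n)"
      unfolding nh by (simp add: h_def)
    finally show ?thesis
      using ind[of 0 n] unfolding nh by (simp add: \<Phi>_def algebra_simps)
  qed
  show ?thesis
  proof (rule LIMSEQ_le_const)
    have "(\<lambda>n. sqrt (1 / real n)) \<longlonglongrightarrow> sqrt 0"
      by (intro tendsto_real_sqrt lim_1_over_n)
    then have "(\<lambda>n. exp (- l * (\<integral>g. F g \<partial>gauss) + l\<^sup>2 / 2 + K * sqrt (1 / real n)))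
      \<longlonglongrightarrow> exp (- l * (\<integral>g. F g \<partial>gauss) + l\<^sup>2 / 2 + K * sqrt 0)"
      by (intro tendsto_intros)
    then show "(\<lambda>n. exp (- l * (\<integral>g. F g \<partial>gauss) + l\<^sup>2 / 2 + K * sqrt (1 / real n)))
      \<longlonglongrightarrow> exp (- l * (\<integral>g. F g \<partial>gauss) + l\<^sup>2 / 2)"
      by simp
    show "\<exists>N. \<forall>n\<ge>N. (\<integral>g. exp (- l * F g) \<partial>gauss) \<le> exp (- l * (\<integral>g. F g \<partial>gauss) + l\<^sup>2 / 2 + K * sqrt (1 / real n))"
      using main by (intro exI[of _ 1]) auto
  qed
qed

section \<open>Lindeberg replacement\<close>

text \<open>Each map rotates one component against a fresh independent copy and leaves the other
  alone, so that increments can be added to either variable separately.\<close>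

lemma distr_gauss_rotate_pair:
  fixes c d :: real
  assumes cd: "c\<^sup>2 + d\<^sup>2 = 1"
  shows "distr gauss borel (\<lambda>(z, x). (c *\<^sub>R fst z + d *\<^sub>R x, snd z)) = (gauss :: ('a::euclidean_space \<times> 'b::euclidean_space) measure)" (is ?A)
    and "distr gauss borel (\<lambda>(z, y). (fst z, c *\<^sub>R snd z + d *\<^sub>R y)) = (gauss :: ('a \<times> 'b) measure)" (is ?B)
proof -
  show ?A
  proof (rule distr_gauss_image[where a="\<lambda>b. ((c *\<^sub>R fst b, snd b), d *\<^sub>R fst b)"])
    show "(\<lambda>(z, x). (c *\<^sub>R fst z + d *\<^sub>R x, snd z)) \<in> borel_measurable (borel :: (('a \<times> 'b) \<times> 'a) measure)"
      by (intro borel_measurable_continuous_onI) (auto simp: split_beta intro!: continuous_intros)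
    show "(((c *\<^sub>R fst b, snd b), d *\<^sub>R fst b) \<bullet> i) * (((c *\<^sub>R fst b', snd b'), d *\<^sub>R fst b') \<bullet> i) = 0"
      if "b \<in> Basis" "b' \<in> Basis" "b \<noteq> b'" "i \<in> Basis" for b b' :: "'a \<times> 'b" and i :: "('a \<times> 'b) \<times> 'a"
      using that by (auto simp: Basis_prod_def inner_Basis split: if_splits)
  qed (use cd in \<open>auto simp: Basis_prod_def split_beta norm_Pair power_mult_distrib inner_add_left\<close>)
  show ?B
  proof (rule distr_gauss_image[where a="\<lambda>b. ((fst b, c *\<^sub>R snd b), d *\<^sub>R snd b)"])
    show "(\<lambda>(z, y). (fst z, c *\<^sub>R snd z + d *\<^sub>R y)) \<in> borel_measurable (borel :: (('a \<times> 'b) \<times> 'b) measure)"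
      by (intro borel_measurable_continuous_onI) (auto simp: split_beta intro!: continuous_intros)
    show "(((fst b, c *\<^sub>R snd b), d *\<^sub>R snd b) \<bullet> i) * (((fst b', c *\<^sub>R snd b'), d *\<^sub>R snd b') \<bullet> i) = 0"
      if "b \<in> Basis" "b' \<in> Basis" "b \<noteq> b'" "i \<in> Basis" for b b' :: "'a \<times> 'b" and i :: "('a \<times> 'b) \<times> 'b"
      using that by (auto simp: Basis_prod_def inner_Basis split: if_splits)
  qed (use cd in \<open>auto simp: Basis_prod_def split_beta norm_Pair power_mult_distrib inner_add_left\<close>)
qed

lemma gauss_add_fst:
  fixes f :: "'a::euclidean_space \<times> 'b::euclidean_space \<Rightarrow> real"
  assumes f: "f \<in> borel_measurable borel" and st: "0 \<le> s" "0 \<le> t" "0 < s + t"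
    and int: "integrable gauss (\<lambda>z. f (sqrt (s + t) *\<^sub>R fst z, r *\<^sub>R snd z))"
  shows "(\<integral>z. (\<integral>x. f ((sqrt s *\<^sub>R fst z, r *\<^sub>R snd z) + (sqrt t *\<^sub>R x, 0)) \<partial>gauss) \<partial>gauss)
      = (\<integral>z. f (sqrt (s + t) *\<^sub>R fst z, r *\<^sub>R snd z) \<partial>gauss)"
    and "integrable gauss (\<lambda>z. \<integral>x. f ((sqrt s *\<^sub>R fst z, r *\<^sub>R snd z) + (sqrt t *\<^sub>R x, 0)) \<partial>gauss)"
proof -
  define c d where "c = sqrt s / sqrt (s + t)" and "d = sqrt t / sqrt (s + t)"
  have cd: "c\<^sup>2 + d\<^sup>2 = 1"
    using st by (simp add: c_def d_def power_divide add_divide_distrib[symmetric])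
  define T where "T = (\<lambda>(z::'a\<times>'b, x::'a). (c *\<^sub>R fst z + d *\<^sub>R x, snd z))"
  define g where "g = (\<lambda>z. f (sqrt (s + t) *\<^sub>R fst z, r *\<^sub>R snd z))"
  have T: "distr gauss borel T = gauss"
    unfolding T_def by (rule distr_gauss_rotate_pair[OF cd])
  have mT: "T \<in> borel_measurable borel"
    unfolding T_def by (intro borel_measurable_continuous_onI) (auto simp: split_beta intro!: continuous_intros)
  have mg: "g \<in> borel_measurable borel"
    unfolding g_def
    by (rule measurable_compose[OF _ f]) (intro borel_measurable_continuous_onI continuous_intros)
  have eq: "g (T p) = (case p of (z, x) \<Rightarrow> f ((sqrt s *\<^sub>R fst z, r *\<^sub>R snd z) + (sqrt t *\<^sub>R x, 0)))" for p
    using st by (simp add: T_def c_def d_def g_def split_beta scaleR_add_right)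
  have "integrable (distr gauss borel T) g"
    using int by (simp add: T g_def)
  then have "integrable gauss (\<lambda>p. g (T p))"
    using mg mT by (subst (asm) integrable_distr_eq) auto
  note * = gauss_integral_pair[OF this, unfolded integral_gauss_image[OF T mT mg], unfolded eq prod.case]
  from * show "(\<integral>z. (\<integral>x. f ((sqrt s *\<^sub>R fst z, r *\<^sub>R snd z) + (sqrt t *\<^sub>R x, 0)) \<partial>gauss) \<partial>gauss)
      = (\<integral>z. f (sqrt (s + t) *\<^sub>R fst z, r *\<^sub>R snd z) \<partial>gauss)"
    "integrable gauss (\<lambda>z. \<integral>x. f ((sqrt s *\<^sub>R fst z, r *\<^sub>R snd z) + (sqrt t *\<^sub>R x, 0)) \<partial>gauss)"
    unfolding g_def by this
qed

lemma gauss_add_snd: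
  fixes f :: "'a::euclidean_space \<times> 'b::euclidean_space \<Rightarrow> real"
  assumes f: "f \<in> borel_measurable borel" and st: "0 \<le> s" "0 \<le> t" "0 < s + t"
    and int: "integrable gauss (\<lambda>z. f (r *\<^sub>R fst z, sqrt (s + t) *\<^sub>R snd z))"
  shows "(\<integral>z. (\<integral>y. f ((r *\<^sub>R fst z, sqrt s *\<^sub>R snd z) + (0, sqrt t *\<^sub>R y)) \<partial>gauss) \<partial>gauss)
      = (\<integral>z. f (r *\<^sub>R fst z, sqrt (s + t) *\<^sub>R snd z) \<partial>gauss)"
    and "integrable gauss (\<lambda>z. \<integral>y. f ((r *\<^sub>R fst z, sqrt s *\<^sub>R snd z) + (0, sqrt t *\<^sub>R y)) \<partial>gauss)"
proof -
  define c d where "c = sqrt s / sqrt (s + t)" and "d = sqrt t / sqrt (s + t)"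
  have cd: "c\<^sup>2 + d\<^sup>2 = 1"
    using st by (simp add: c_def d_def power_divide add_divide_distrib[symmetric])
  define T where "T = (\<lambda>(z::'a\<times>'b, y::'b). (fst z, c *\<^sub>R snd z + d *\<^sub>R y))"
  define g where "g = (\<lambda>z. f (r *\<^sub>R fst z, sqrt (s + t) *\<^sub>R snd z))"
  have T: "distr gauss borel T = gauss"
    unfolding T_def by (rule distr_gauss_rotate_pair[OF cd])
  have mT: "T \<in> borel_measurable borel"
    unfolding T_def by (intro borel_measurable_continuous_onI) (auto simp: split_beta intro!: continuous_intros)
  have mg: "g \<in> borel_measurable borel"
    unfolding g_def
    by (rule measurable_compose[OF _ f]) (intro borel_measurable_continuous_onI continuous_intros)
  have eq: "g (T p) = (case p of (z, y) \<Rightarrow> f ((r *\<^sub>R fst z, sqrt s *\<^sub>R snd z) + (0, sqrt t *\<^sub>R y)))" for p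
    using st by (simp add: T_def c_def d_def g_def split_beta scaleR_add_right)
  have "integrable (distr gauss borel T) g"
    using int by (simp add: T g_def)
  then have "integrable gauss (\<lambda>p. g (T p))"
    using mg mT by (subst (asm) integrable_distr_eq) auto
  note * = gauss_integral_pair[OF this, unfolded integral_gauss_image[OF T mT mg], unfolded eq prod.case]
  from * show "(\<integral>z. (\<integral>y. f ((r *\<^sub>R fst z, sqrt s *\<^sub>R snd z) + (0, sqrt t *\<^sub>R y)) \<partial>gauss) \<partial>gauss)
      = (\<integral>z. f (r *\<^sub>R fst z, sqrt (s + t) *\<^sub>R snd z) \<partial>gauss)"
    "integrable gauss (\<lambda>z. \<integral>y. f ((r *\<^sub>R fst z, sqrt s *\<^sub>R snd z) + (0, sqrt t *\<^sub>R y)) \<partial>gauss)"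
    unfolding g_def by this
qed

lemma integrable_gauss_lipschitz_pair:
  fixes F :: "'a::euclidean_space \<times> 'b::euclidean_space \<Rightarrow> real"
  assumes F: "L-lipschitz_on UNIV F"
  shows "integrable gauss (\<lambda>z. F (r *\<^sub>R fst z, s *\<^sub>R snd z))"
proof -
  have "(L * (\<bar>r\<bar> + \<bar>s\<bar>))-lipschitz_on UNIV (\<lambda>z. F (r *\<^sub>R fst z, s *\<^sub>R snd z))"
  proof (rule lipschitz_onI)
    fix z w :: "'a \<times> 'b"
    have "dist (F (r *\<^sub>R fst z, s *\<^sub>R snd z)) (F (r *\<^sub>R fst w, s *\<^sub>R snd w))
        \<le> L * dist (r *\<^sub>R fst z, s *\<^sub>R snd z) (r *\<^sub>R fst w, s *\<^sub>R snd w)"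
      by (rule lipschitz_onD[OF F]) auto
    also have "dist (r *\<^sub>R fst z, s *\<^sub>R snd z) (r *\<^sub>R fst w, s *\<^sub>R snd w)
        = norm (r *\<^sub>R (fst (z - w)), s *\<^sub>R (snd (z - w)))"
      by (simp add: dist_norm scaleR_diff_right)
    also have "\<dots> \<le> norm (r *\<^sub>R fst (z - w)) + norm (s *\<^sub>R snd (z - w))"
      by (rule norm_Pair_le)
    also have "\<dots> \<le> \<bar>r\<bar> * norm (z - w) + \<bar>s\<bar> * norm (z - w)"
      unfolding norm_scaleR by (intro add_mono mult_left_mono)
        (metis abs_ge_zero norm_fst_le norm_snd_le prod.collapse)+
    finally show "dist (F (r *\<^sub>R fst z, s *\<^sub>R snd z)) (F (r *\<^sub>R fst w, s *\<^sub>R snd w)) \<le> L * (\<bar>r\<bar> + \<bar>s\<bar>) * dist z w"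
      using lipschitz_on_nonneg[OF F]
      by (smt (verit, best) combine_common_factor dist_norm mult.assoc mult_left_mono)
  qed (use lipschitz_on_nonneg[OF F] in auto)
  from integrable_gauss_lipschitz[OF this, of 0 1] show ?thesis by simp
qed

text \<open>Lindeberg replacement: the \<open>n\<close> increments of size \<open>1/n\<close> of the second variable are exchanged
  one at a time for increments of the first, at a total cost of order \<open>n * (1/n) powr (3/2)\<close>.\<close>

theorem gauss_lindeberg:
  fixes F :: "'a::euclidean_space \<times> 'b::euclidean_space \<Rightarrow> real"
  assumes F: "L-lipschitz_on UNIV F"
    and step: "\<And>z h. 0 < h \<Longrightarrow> h \<le> 1 \<Longrightarrow>
      (\<integral>y. F (z + (0, sqrt h *\<^sub>R y)) \<partial>gauss) \<le> (\<integral>x. F (z + (sqrt h *\<^sub>R x, 0)) \<partial>gauss) + K * (h * sqrt h)"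
  shows "(\<integral>y. F (0, y) \<partial>gauss) \<le> (\<integral>x. F (x, 0) \<partial>gauss)"
proof -
  note mF = lipschitz_on_borel_measurable[OF F]
  have marginal: "(\<integral>y. F (0, y) \<partial>gauss) = (\<integral>z. F (0, snd z) \<partial>(gauss :: ('a \<times> 'b) measure))"
    "(\<integral>x. F (x, 0) \<partial>gauss) = (\<integral>z. F (fst z, 0) \<partial>(gauss :: ('a \<times> 'b) measure))"
    using gauss_integral_pair(1)[OF integrable_gauss_lipschitz_pair[OF F, of 0 1]]
      gauss_integral_pair(1)[OF integrable_gauss_lipschitz_pair[OF F, of 1 0]] by simp_all
  have main: "(\<integral>y. F (0, y) \<partial>gauss) \<le> (\<integral>x. F (x, 0) \<partial>gauss) + K * sqrt (1 / real n)" if n: "0 < n" for n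
  proof -
    define h where "h = 1 / real n"
    have h: "0 < h" "h \<le> 1" using n by (auto simp: h_def)
    have nh: "real n * h = 1" using n by (simp add: h_def)
    \<comment> \<open>\<open>k\<close> increments come from the first space and \<open>n - k\<close>
      from the second; \<open>a 0\<close> and \<open>a n\<close> are the two sides of the
      claim.\<close>
    define a where "a k = (\<integral>z. F (sqrt (real k * h) *\<^sub>R fst z, sqrt (real (n - k) * h) *\<^sub>R snd z) \<partial>gauss)" for k
    have "a 0 \<le> a k + K * (real k * h * sqrt h)" if "k \<le> n" for k
      using that
    proof (induction k)
      case (Suc k)
      define r where "r = sqrt (real (n - Suc k) * h)"
      define q where "q = sqrt (real k * h)"
      have S: "real (Suc k) * h = real k * h + h" "real (n - k) * h = real (n - Suc k) * h + h"
        using Suc.prems by (simp_all add: algebra_simps of_nat_diff)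
      have pos: "0 < real k * h + h" "0 < real (n - Suc k) * h + h"
        using h by (auto intro: add_nonneg_pos)
      note A = gauss_add_fst[of F "real k * h" h r, OF mF _ _ pos(1) integrable_gauss_lipschitz_pair[OF F]]
      note B = gauss_add_snd[of F "real (n - Suc k) * h" h q, OF mF _ _ pos(2) integrable_gauss_lipschitz_pair[OF F]]
      \<comment> \<open>The common state \<open>(q *\<^sub>R fst z, r *\<^sub>R snd z)\<close> lacks
        one increment: one from the second space completes it to \<open>a k\<close>, one from the
        first space to \<open>a (Suc k)\<close>.\<close>
      have "a k = (\<integral>z. (\<integral>y. F ((q *\<^sub>R fst z, r *\<^sub>R snd z) + (0, sqrt h *\<^sub>R y)) \<partial>gauss) \<partial>gauss)"
        unfolding a_def S(2) q_def[symmetric] r_def by (rule B(1)[symmetric]) (use h in auto)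
      also have "\<dots> \<le> (\<integral>z. (\<integral>x. F ((q *\<^sub>R fst z, r *\<^sub>R snd z) + (sqrt h *\<^sub>R x, 0)) \<partial>gauss) + K * (h * sqrt h) \<partial>gauss)"
      proof (intro integral_mono step Bochner_Integration.integrable_add)
        show "integrable gauss (\<lambda>z. \<integral>y. F ((q *\<^sub>R fst z, r *\<^sub>R snd z) + (0, sqrt h *\<^sub>R y)) \<partial>gauss)"
          unfolding r_def by (rule B(2)) (use h in auto)
        show "integrable gauss (\<lambda>z. \<integral>x. F ((q *\<^sub>R fst z, r *\<^sub>R snd z) + (sqrt h *\<^sub>R x, 0)) \<partial>gauss)"
          unfolding q_def by (rule A(2)) (use h in auto)
      qed (use h in auto)
      also have "\<dots> = (\<integral>z. (\<integral>x. F ((q *\<^sub>R fst z, r *\<^sub>R snd z) + (sqrt h *\<^sub>R x, 0)) \<partial>gauss) \<partial>gauss) + K * (h * sqrt h)"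
      proof (subst Bochner_Integration.integral_add)
        show "integrable gauss (\<lambda>z. \<integral>x. F ((q *\<^sub>R fst z, r *\<^sub>R snd z) + (sqrt h *\<^sub>R x, 0)) \<partial>gauss)"
          unfolding q_def by (rule A(2)) (use h in auto)
      qed auto
      also have "(\<integral>z. (\<integral>x. F ((q *\<^sub>R fst z, r *\<^sub>R snd z) + (sqrt h *\<^sub>R x, 0)) \<partial>gauss) \<partial>gauss) = a (Suc k)"
        unfolding a_def S(1) r_def[symmetric] q_def by (rule A(1)) (use h in auto)
      finally show ?case
        using Suc by (simp add: algebra_simps)
    qed simp
    from this[of n] nh show ?thesis
      unfolding a_def marginal by (simp add: h_def)
  qed
  show ?thesis
  proof (rule LIMSEQ_le_const)
    have "(\<lambda>n. sqrt (1 / real n)) \<longlonglongrightarrow> sqrt 0"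
      by (intro tendsto_real_sqrt lim_1_over_n)
    then have "(\<lambda>n. (\<integral>x. F (x, 0) \<partial>gauss) + K * sqrt (1 / real n)) \<longlonglongrightarrow> (\<integral>x. F (x, 0) \<partial>gauss) + K * sqrt 0"
      by (intro tendsto_intros)
    then show "(\<lambda>n. (\<integral>x. F (x, 0) \<partial>gauss) + K * sqrt (1 / real n)) \<longlonglongrightarrow> (\<integral>x. F (x, 0) \<partial>gauss)"
      by simp
    show "\<exists>N. \<forall>n\<ge>N. (\<integral>y. F (0, y) \<partial>gauss) \<le> (\<integral>x. F (x, 0) \<partial>gauss) + K * sqrt (1 / real n)"
      using main by (intro exI[of _ 1]) auto
  qed
qed

section \<open>Soft minima\<close>

text \<open>With \<open>s = norm a\<close> and \<open>S = norm (a + e)\<close> the remainder is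
  exactly \<open>((norm e)\<^sup>2 - (S - s)\<^sup>2) / (2 * s)\<close>, and by the reverse triangle
  inequality the numerator lies between 0 and \<open>(norm e)\<^sup>2\<close>.\<close>

lemma norm_expansion:
  fixes a e :: "'a::real_inner"
  assumes "a \<noteq> 0"
  shows "\<bar>norm (a + e) - norm a - (a \<bullet> e) / norm a\<bar> \<le> (norm e)\<^sup>2 / (2 * norm a)"
proof -
  define s S where "s = norm a" and "S = norm (a + e)"
  have s: "0 < s" using assms by (simp add: s_def)
  have S2: "S\<^sup>2 = s\<^sup>2 + 2 * (a \<bullet> e) + (norm e)\<^sup>2"
    by (simp add: S_def s_def power2_norm_eq_inner inner_add_left inner_add_right inner_commute)
  have "\<bar>S - s\<bar> \<le> norm e"
    using norm_triangle_ineq3[of "a + e" a] by (simp add: S_def s_def)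
  then have le: "(S - s)\<^sup>2 \<le> (norm e)\<^sup>2"
    by (metis abs_ge_zero power2_abs power_mono)
  have "S - s - (a \<bullet> e) / s = ((norm e)\<^sup>2 - (S - s)\<^sup>2) / (2 * s)"
    using s S2 by (simp add: field_simps power2_eq_square)
  moreover have "\<bar>((norm e)\<^sup>2 - (S - s)\<^sup>2) / (2 * s)\<bar> \<le> (norm e)\<^sup>2 / (2 * s)"
    using s le by (simp add: divide_right_mono)
  ultimately show ?thesis
    by (simp add: S_def s_def)
qed

lemma exp_remainder:
  fixes z :: real
  shows "\<bar>exp z - 1\<bar> \<le> \<bar>z\<bar> * exp \<bar>z\<bar>" and "\<bar>exp z - 1 - z\<bar> \<le> z\<^sup>2 * exp \<bar>z\<bar>"
proof -
  obtain t where t: "\<bar>t\<bar> \<le> \<bar>z\<bar>" "exp z = (\<Sum>m<1. z ^ m / fact m) + exp t / fact 1 * z ^ 1"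
    using Maclaurin_exp_le[of z 1] by auto
  have "\<bar>exp z - 1\<bar> = \<bar>z\<bar> * exp t"
    using t(2) by (simp add: abs_mult)
  also have "\<dots> \<le> \<bar>z\<bar> * exp \<bar>z\<bar>"
    using t(1) by (intro mult_left_mono) auto
  finally show "\<bar>exp z - 1\<bar> \<le> \<bar>z\<bar> * exp \<bar>z\<bar>" .
  obtain t where t: "\<bar>t\<bar> \<le> \<bar>z\<bar>" "exp z = (\<Sum>m<2. z ^ m / fact m) + exp t / fact 2 * z ^ 2"
    using Maclaurin_exp_le[of z 2] by auto
  have "\<bar>exp z - 1 - z\<bar> = z\<^sup>2 * (exp t / 2)"
    using t(2) by (simp add: abs_mult eval_nat_numeral)
  also have "\<dots> \<le> z\<^sup>2 * exp \<bar>z\<bar>"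
  proof (rule mult_left_mono)
    have "exp t / 2 \<le> exp t" by simp
    also have "exp t \<le> exp \<bar>z\<bar>" using t(1) by simp
    finally show "exp t / 2 \<le> exp \<bar>z\<bar>" .
  qed simp
  finally show "\<bar>exp z - 1 - z\<bar> \<le> z\<^sup>2 * exp \<bar>z\<bar>" .
qed

text \<open>The remainder vanishes at 1 and has derivative \<open>(s - 1)\<^sup>2 / s\<close>. The
  mean value theorem applies, and \<open>exp (- r) \<le> t\<close> keeps the intermediate point
  above \<open>exp (- r)\<close>.\<close>

lemma ln_cubic_remainder:
  fixes t r :: real
  assumes "exp (- r) \<le> t" "0 \<le> r"
  shows "\<bar>ln t - (t - 1) + (t - 1)\<^sup>2 / 2\<bar> \<le> \<bar>t - 1\<bar> ^ 3 * exp r"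
proof -
  define f where "f s = ln s - (s - 1) + (s - 1)\<^sup>2 / 2" for s :: real
  have t: "0 < t" using assms(1) exp_gt_zero less_le_trans by blast
  have der: "(f has_real_derivative (s - 1)\<^sup>2 / s) (at s)" if "0 < s" for s
    unfolding f_def using that
    by (auto intro!: derivative_eq_intros simp: field_simps power2_eq_square)
  have er: "exp (- r) \<le> 1" using assms(2) by simp
  have "\<exists>s. exp (- r) \<le> s \<and> \<bar>s - 1\<bar> \<le> \<bar>t - 1\<bar> \<and> \<bar>f t\<bar> = \<bar>t - 1\<bar> * ((s - 1)\<^sup>2 / s)"
  proof (cases t "1::real" rule: linorder_cases)
    case less
    obtain s where s: "t < s" "s < 1" "f 1 - f t = (1 - t) * ((s - 1)\<^sup>2 / s)"
      using MVT2[OF less, of f "\<lambda>s. (s - 1)\<^sup>2 / s"] der t by (auto simp: order_less_le_trans)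
    have "f t = - ((1 - t) * ((s - 1)\<^sup>2 / s))" using s(3) by (simp add: f_def)
    then have "\<bar>f t\<bar> = \<bar>t - 1\<bar> * ((s - 1)\<^sup>2 / s)"
      using s t by (simp add: abs_mult)
    with s assms(1) less show ?thesis by (intro exI[of _ s]) auto
  next
    case equal
    then show ?thesis using er by (intro exI[of _ 1]) (simp add: f_def)
  next
    case greater
    obtain s where s: "1 < s" "s < t" "f t - f 1 = (t - 1) * ((s - 1)\<^sup>2 / s)"
      using MVT2[OF greater, of f "\<lambda>s. (s - 1)\<^sup>2 / s"] der by auto
    have "f t = (t - 1) * ((s - 1)\<^sup>2 / s)" using s(3) by (simp add: f_def)
    then have "\<bar>f t\<bar> = \<bar>t - 1\<bar> * ((s - 1)\<^sup>2 / s)"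
      using s by (simp add: abs_mult)
    moreover have "exp (- r) \<le> s" using s er by linarith
    ultimately show ?thesis using s by (intro exI[of _ s]) auto
  qed
  then obtain s where s: "exp (- r) \<le> s" "\<bar>s - 1\<bar> \<le> \<bar>t - 1\<bar>" "\<bar>f t\<bar> = \<bar>t - 1\<bar> * ((s - 1)\<^sup>2 / s)"
    by blast
  have "(s - 1)\<^sup>2 / s \<le> (t - 1)\<^sup>2 / exp (- r)"
    using s(1,2) by (intro frac_le) (auto simp: abs_le_square_iff)
  also have "\<dots> = \<bar>t - 1\<bar>\<^sup>2 * exp r"
    by (simp add: exp_minus field_simps)
  finally have "\<bar>t - 1\<bar> * ((s - 1)\<^sup>2 / s) \<le> \<bar>t - 1\<bar> * (\<bar>t - 1\<bar>\<^sup>2 * exp r)"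
    by (rule mult_left_mono) simp
  then show ?thesis
    using s(3) by (simp add: f_def power3_eq_cube power2_eq_square mult.assoc)
qed

text \<open>Free energy at inverse temperature \<open>\<beta>\<close>: for finite nonempty
  \<open>N\<close> and \<open>\<beta> > 0\<close> it lies below the minimum of \<open>c\<close> by
  at most \<open>ln (card N) / \<beta>\<close>.\<close>

definition softmin :: "real \<Rightarrow> 'i set \<Rightarrow> ('i \<Rightarrow> real) \<Rightarrow> real" where
  "softmin \<beta> N c = - (ln (\<Sum>u\<in>N. exp (- \<beta> * c u)) / \<beta>)"

text \<open>These weights are the partial derivatives of \<open>softmin \<beta> N\<close> in the
  values \<open>c u\<close>.\<close>

definition gibbs :: "real \<Rightarrow> 'i set \<Rightarrow> ('i \<Rightarrow> real) \<Rightarrow> 'i \<Rightarrow> real" where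
  "gibbs \<beta> N c u = exp (- \<beta> * c u) / (\<Sum>v\<in>N. exp (- \<beta> * c v))"

lemma gibbs_nonneg: "0 \<le> gibbs \<beta> N c u"
  by (simp add: gibbs_def sum_nonneg)

lemma gibbs_sum:
  assumes "finite N" "N \<noteq> {}"
  shows "(\<Sum>u\<in>N. gibbs \<beta> N c u) = 1"
proof -
  have "0 < (\<Sum>v\<in>N. exp (- \<beta> * c v))"
    using assms by (intro sum_pos) auto
  then show ?thesis
    unfolding gibbs_def by (simp add: sum_divide_distrib[symmetric])
qed

text \<open>The quotient of the two partition sums is a Gibbs average of exponential increments, so
  all Taylor errors become averages with probability weights.\<close>

lemma softmin_increment:
  assumes "finite N" "N \<noteq> {}"
  shows "softmin \<beta> N c' - softmin \<beta> N c = - (ln (\<Sum>u\<in>N. gibbs \<beta> N c u * exp (- \<beta> * (c' u - c u))) / \<beta>)"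
proof -
  have pos: "0 < (\<Sum>v\<in>N. exp (- \<beta> * c v))" for c
    using assms by (auto intro!: sum_pos)
  have "(\<Sum>u\<in>N. gibbs \<beta> N c u * exp (- \<beta> * (c' u - c u))) = (\<Sum>u\<in>N. exp (- \<beta> * c' u)) / (\<Sum>v\<in>N. exp (- \<beta> * c v))"
    unfolding gibbs_def sum_divide_distrib by (intro sum.cong refl) (simp add: mult_exp_exp algebra_simps)
  moreover note pos[of c] pos[of c']
  ultimately show ?thesis
    by (simp add: softmin_def ln_div diff_divide_distrib)
qed

lemma softmin_lower:
  assumes "finite N" "N \<noteq> {}" "0 < \<beta>" "\<And>u. u \<in> N \<Longrightarrow> m \<le> c u"
  shows "m - ln (card N) / \<beta> \<le> softmin \<beta> N c"
proof -
  have pos: "0 < (\<Sum>v\<in>N. exp (- \<beta> * c v))"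
    using assms by (auto intro!: sum_pos)
  have "(\<Sum>v\<in>N. exp (- \<beta> * c v)) \<le> (\<Sum>v\<in>N. exp (- \<beta> * m))"
    using assms by (intro sum_mono) auto
  then have "ln (\<Sum>v\<in>N. exp (- \<beta> * c v)) \<le> ln (card N * exp (- \<beta> * m))"
    using pos by simp
  also have "\<dots> = ln (card N) - \<beta> * m"
    using assms by (simp add: ln_mult card_gt_0_iff)
  finally have "ln (\<Sum>v\<in>N. exp (- \<beta> * c v)) / \<beta> \<le> (ln (card N) - \<beta> * m) / \<beta>"
    using assms by (intro divide_right_mono) auto
  then show ?thesis
    using assms by (simp add: softmin_def diff_divide_distrib)
qed

lemma softmin_upper:
  assumes "finite N" "u \<in> N" "0 < \<beta>"
  shows "softmin \<beta> N c \<le> c u"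
proof -
  have "exp (- \<beta> * c u) \<le> (\<Sum>v\<in>N. exp (- \<beta> * c v))"
    using assms by (intro member_le_sum) auto
  then have "- \<beta> * c u \<le> ln (\<Sum>v\<in>N. exp (- \<beta> * c v))"
    by (meson exp_gt_zero less_le_trans ln_ge_iff)
  then have "- \<beta> * c u / \<beta> \<le> ln (\<Sum>v\<in>N. exp (- \<beta> * c v)) / \<beta>"
    using assms by (intro divide_right_mono) auto
  then show ?thesis
    using assms by (simp add: softmin_def)
qed

lemma softmin_add_const:
  assumes "finite N" "N \<noteq> {}" "0 < \<beta>"
  shows "softmin \<beta> N (\<lambda>u. c u + k) = softmin \<beta> N c + k"
  using softmin_increment[OF assms(1,2), of \<beta> "\<lambda>u. c u + k" c] gibbs_sum[OF assms(1,2), of \<beta> c] assms(3)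
  by (simp add: sum_distrib_right[symmetric])

lemma abs_weighted_sum_le:
  fixes p :: "'i \<Rightarrow> real"
  assumes "\<And>u. u \<in> N \<Longrightarrow> 0 \<le> p u" "(\<Sum>u\<in>N. p u) = 1" "\<And>u. u \<in> N \<Longrightarrow> \<bar>f u\<bar> \<le> B"
  shows "\<bar>\<Sum>u\<in>N. p u * f u\<bar> \<le> B"
proof -
  have "\<bar>\<Sum>u\<in>N. p u * f u\<bar> \<le> (\<Sum>u\<in>N. p u * B)"
    by (rule order_trans[OF sum_abs]) (auto intro!: sum_mono mult_left_mono simp: abs_mult assms)
  then show ?thesis
    using assms(2) by (simp add: sum_distrib_right[symmetric])
qed

text \<open>All three expand the logarithm of the Gibbs average \<open>1 + e\<close>. The
  first-order bound is free of exponentials in \<open>\<rho>\<close> and can serve as a global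
  quadratic remainder. The second-order bound keeps \<open>e\<close> unexpanded on purpose: its
  expectation involves the increments only one \<open>u\<close> at a time, which two processes can
  share, while \<open>m\<^sup>2\<close> carries the covariances between different points.\<close>

lemma softmin_taylor:
  fixes \<beta> \<rho> :: real and c c' :: "'i \<Rightarrow> real"
  assumes N: "finite N" "N \<noteq> {}" and \<beta>: "0 < \<beta>"
    and d: "\<And>u. u \<in> N \<Longrightarrow> \<bar>c' u - c u\<bar> \<le> \<rho>"
  defines "p \<equiv> gibbs \<beta> N c"
  defines "m \<equiv> (\<Sum>u\<in>N. p u * (c' u - c u))"
  defines "e \<equiv> (\<Sum>u\<in>N. p u * (exp (- \<beta> * (c' u - c u)) - 1))"
  shows softmin_taylor0: "\<bar>softmin \<beta> N c' - softmin \<beta> N c\<bar> \<le> \<rho>"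
    and softmin_taylor1: "\<bar>softmin \<beta> N c' - softmin \<beta> N c - m\<bar> \<le> 3 * \<beta> * \<rho>\<^sup>2"
    and softmin_taylor2: "\<bar>softmin \<beta> N c' - softmin \<beta> N c + e / \<beta> - \<beta> / 2 * m\<^sup>2\<bar> \<le> 2 * \<beta>\<^sup>2 * \<rho> ^ 3 * exp (4 * \<beta> * \<rho>)"
proof -
  have p: "\<And>u. 0 \<le> p u" "(\<Sum>u\<in>N. p u) = 1"
    using gibbs_sum[OF N] by (auto simp: p_def gibbs_nonneg)
  obtain v where v: "v \<in> N" using N by auto
  have \<rho>: "0 \<le> \<rho>" using d[OF v] by linarith
  define S where "S = (\<Sum>u\<in>N. p u * exp (- \<beta> * (c' u - c u)))"
  define D where "D = softmin \<beta> N c' - softmin \<beta> N c"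
  have D: "D = - (ln S / \<beta>)"
    unfolding D_def S_def p_def by (rule softmin_increment[OF N])
  have Se: "S = 1 + e"
    unfolding S_def e_def using p(2) by (simp add: right_diff_distrib sum_subtractf)
  have z: "\<bar>- \<beta> * (c' u - c u)\<bar> \<le> \<beta> * \<rho>" if "u \<in> N" for u
    using d[OF that] \<beta> by (simp add: abs_mult)
  have "(\<Sum>u\<in>N. p u * exp (- (\<beta> * \<rho>))) \<le> S"
    unfolding S_def using z p by (intro sum_mono mult_left_mono) (force simp: abs_le_iff)+
  then have S1: "exp (- (\<beta> * \<rho>)) \<le> S"
    by (simp add: sum_distrib_right[symmetric] p)
  have "S \<le> (\<Sum>u\<in>N. p u * exp (\<beta> * \<rho>))"
    unfolding S_def using z p by (intro sum_mono mult_left_mono) (force simp: abs_le_iff)+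
  then have S2: "S \<le> exp (\<beta> * \<rho>)"
    by (simp add: sum_distrib_right[symmetric] p)
  have S0: "0 < S" using S1 exp_gt_zero less_le_trans by blast
  have lnS: "\<bar>ln S\<bar> \<le> \<beta> * \<rho>"
    using S1 S2 S0 by (simp add: abs_le_iff ln_ge_iff) (metis exp_gt_zero exp_minus inverse_minus_eq ln_exp ln_le_cancel_iff minus_le_iff)
  show A: "\<bar>softmin \<beta> N c' - softmin \<beta> N c\<bar> \<le> \<rho>"
    using lnS \<beta> unfolding D_def[symmetric] D by (simp add: divide_le_eq mult.commute)
  have m: "\<bar>m\<bar> \<le> \<rho>"
    unfolding m_def by (rule abs_weighted_sum_le) (use p d in auto)
  have em: "\<bar>e + \<beta> * m\<bar> \<le> (\<beta> * \<rho>)\<^sup>2 * exp (\<beta> * \<rho>)"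
  proof -
    have "e + \<beta> * m = (\<Sum>u\<in>N. p u * (exp (- \<beta> * (c' u - c u)) - 1 - (- \<beta> * (c' u - c u))))"
      unfolding e_def m_def by (simp add: sum_distrib_left sum.distrib[symmetric] algebra_simps)
    also have "\<bar>\<dots>\<bar> \<le> (\<beta> * \<rho>)\<^sup>2 * exp (\<beta> * \<rho>)"
    proof (rule abs_weighted_sum_le)
      fix u assume u: "u \<in> N"
      have "\<bar>exp (- \<beta> * (c' u - c u)) - 1 - (- \<beta> * (c' u - c u))\<bar> \<le> \<bar>- \<beta> * (c' u - c u)\<bar>\<^sup>2 * exp \<bar>- \<beta> * (c' u - c u)\<bar>"
        using exp_remainder(2)[of "- \<beta> * (c' u - c u)"] by simp
      also have "\<dots> \<le> (\<beta> * \<rho>)\<^sup>2 * exp (\<beta> * \<rho>)"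
        using z[OF u] by (intro mult_mono power_mono) auto
      finally show "\<bar>exp (- \<beta> * (c' u - c u)) - 1 - (- \<beta> * (c' u - c u))\<bar> \<le> (\<beta> * \<rho>)\<^sup>2 * exp (\<beta> * \<rho>)" .
    qed (use p in auto)
    finally show ?thesis .
  qed
  have e: "\<bar>e\<bar> \<le> \<beta> * \<rho> * exp (\<beta> * \<rho>)"
    unfolding e_def
  proof (rule abs_weighted_sum_le)
    fix u assume u: "u \<in> N"
    have "\<bar>exp (- \<beta> * (c' u - c u)) - 1\<bar> \<le> \<bar>- \<beta> * (c' u - c u)\<bar> * exp \<bar>- \<beta> * (c' u - c u)\<bar>"
      by (rule exp_remainder(1))
    also have "\<dots> \<le> \<beta> * \<rho> * exp (\<beta> * \<rho>)"
      using z[OF u] \<beta> \<rho> by (intro mult_mono) auto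
    finally show "\<bar>exp (- \<beta> * (c' u - c u)) - 1\<bar> \<le> \<beta> * \<rho> * exp (\<beta> * \<rho>)" .
  qed (use p in auto)
  show "\<bar>softmin \<beta> N c' - softmin \<beta> N c - m\<bar> \<le> 3 * \<beta> * \<rho>\<^sup>2"
  proof (cases "\<beta> * \<rho> \<le> 1")
    case True
    \<comment> \<open>Jensen's inequality for the exponential, derived from its tangent line at
      \<open>- \<beta> * m\<close>.\<close>
    have "- \<beta> * m \<le> ln S"
    proof -
      have "exp (- \<beta> * m) = (\<Sum>u\<in>N. p u * (exp (- \<beta> * m) * (1 + (- \<beta> * (c' u - c u) - - \<beta> * m))))"
      proof -
        have *: "(\<Sum>u\<in>N. p u * (exp (- \<beta> * m) * (1 + (- \<beta> * (c' u - c u) - - \<beta> * m))))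
          = exp (- \<beta> * m) * (1 + \<beta> * m) * (\<Sum>u\<in>N. p u) - exp (- \<beta> * m) * \<beta> * (\<Sum>u\<in>N. p u * (c' u - c u))"
          unfolding sum_distrib_left sum_subtractf[symmetric]
          by (intro sum.cong refl) (simp add: algebra_simps)
        show ?thesis
          unfolding * p(2) m_def[symmetric] by (simp add: algebra_simps)
      qed
      also have "\<dots> \<le> S"
        unfolding S_def
      proof (intro sum_mono mult_left_mono p)
        fix u
        have "exp (- \<beta> * m) * (1 + (- \<beta> * (c' u - c u) - - \<beta> * m)) \<le> exp (- \<beta> * m) * exp (- \<beta> * (c' u - c u) - - \<beta> * m)"
          by (intro mult_left_mono exp_ge_add_one_self) auto
        then show "exp (- \<beta> * m) * (1 + (- \<beta> * (c' u - c u) - - \<beta> * m)) \<le> exp (- \<beta> * (c' u - c u))"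
          by (simp add: mult_exp_exp)
      qed
      finally show ?thesis using S0 by (simp add: ln_ge_iff)
    qed
    then have up: "D - m \<le> 0"
      using \<beta> by (simp add: D field_simps)
    \<comment> \<open>The constant 3 of the bound is an upper estimate of
      \<open>exp 1\<close>.\<close>
    have "exp (\<beta> * \<rho>) \<le> exp 1" using True by simp
    also have "exp (1::real) \<le> 3" by (rule exp_le)
    finally have "(\<beta> * \<rho>)\<^sup>2 * exp (\<beta> * \<rho>) \<le> (\<beta> * \<rho>)\<^sup>2 * 3"
      by (intro mult_left_mono) auto
    then have "e \<le> - \<beta> * m + 3 * (\<beta> * \<rho>)\<^sup>2"
      using em by linarith
    moreover have "ln S \<le> e"
      using ln_le_minus_one[OF S0] Se by simp
    ultimately have "ln S \<le> - \<beta> * m + 3 * (\<beta> * \<rho>)\<^sup>2" by linarith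
    then have "ln S / \<beta> \<le> (- \<beta> * m + 3 * (\<beta> * \<rho>)\<^sup>2) / \<beta>"
      using \<beta> by (intro divide_right_mono) auto
    then have "- 3 * \<beta> * \<rho>\<^sup>2 \<le> D - m"
      using \<beta> by (simp add: D diff_divide_distrib add_divide_distrib power2_eq_square) (simp add: mult_ac)
    with up show ?thesis
      unfolding D_def[symmetric] using \<beta> by (simp add: abs_le_iff)
  next
    case False
    \<comment> \<open>For \<open>\<beta> * \<rho> > 1\<close> the trivial bound is already below the
      quadratic one.\<close>
    have "\<bar>D - m\<bar> \<le> 2 * \<rho>"
      using A m unfolding D_def by linarith
    also have "\<dots> \<le> 2 * (\<rho> * (\<beta> * \<rho>))"
      using False \<rho> mult_left_mono[of 1 "\<beta> * \<rho>" \<rho>] by simp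
    also have "\<dots> \<le> 3 * \<beta> * \<rho>\<^sup>2"
      using \<beta> by (simp add: power2_eq_square)
    finally show ?thesis unfolding D_def .
  qed
  have \<beta>\<rho>: "0 \<le> \<beta> * \<rho>" using \<beta> \<rho> by simp
  have "\<bar>ln S - e + e\<^sup>2 / 2\<bar> \<le> \<bar>e\<bar> ^ 3 * exp (\<beta> * \<rho>)"
    using ln_cubic_remainder[OF S1 \<beta>\<rho>] by (simp add: Se)
  also have "\<dots> \<le> (\<beta> * \<rho> * exp (\<beta> * \<rho>)) ^ 3 * exp (\<beta> * \<rho>)"
    by (intro mult_right_mono power_mono e) auto
  also have "\<dots> = (\<beta> * \<rho>) ^ 3 * exp (4 * (\<beta> * \<rho>))"
    by (simp add: power_mult_distrib exp_of_nat_mult[symmetric] mult_exp_exp)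
  finally have 1: "\<bar>ln S - e + e\<^sup>2 / 2\<bar> \<le> (\<beta> * \<rho>) ^ 3 * exp (4 * (\<beta> * \<rho>))" .
  \<comment> \<open>\<open>e\<close> agrees with \<open>- \<beta> * m\<close> up to second order, so
    exchanging their squares costs only third order.\<close>
  have "\<bar>e\<^sup>2 - (\<beta> * m)\<^sup>2\<bar> = \<bar>e + \<beta> * m\<bar> * \<bar>e - \<beta> * m\<bar>"
    by (simp add: abs_mult[symmetric] power2_eq_square algebra_simps)
  also have "\<dots> \<le> ((\<beta> * \<rho>)\<^sup>2 * exp (\<beta> * \<rho>)) * (2 * (\<beta> * \<rho>) * exp (\<beta> * \<rho>))"
  proof (intro mult_mono em)
    have "\<bar>\<beta> * m\<bar> \<le> \<beta> * \<rho> * 1"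
      using m \<beta> by (simp add: abs_mult)
    also have "\<dots> \<le> \<beta> * \<rho> * exp (\<beta> * \<rho>)"
      using \<beta>\<rho> by (intro mult_left_mono) auto
    finally show "\<bar>e - \<beta> * m\<bar> \<le> 2 * (\<beta> * \<rho>) * exp (\<beta> * \<rho>)"
      using e by linarith
  qed auto
  also have "\<dots> = 2 * (\<beta> * \<rho>) ^ 3 * exp (2 * (\<beta> * \<rho>))"
    by (simp add: power2_eq_square power3_eq_cube mult_exp_exp)
  also have "\<dots> \<le> 2 * (\<beta> * \<rho>) ^ 3 * exp (4 * (\<beta> * \<rho>))"
    using \<beta>\<rho> by (intro mult_left_mono) auto
  finally have 2: "\<bar>e\<^sup>2 - (\<beta> * m)\<^sup>2\<bar> \<le> 2 * (\<beta> * \<rho>) ^ 3 * exp (4 * (\<beta> * \<rho>))" .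
  have "\<bar>ln S - e + (\<beta> * m)\<^sup>2 / 2\<bar> \<le> 2 * (\<beta> * \<rho>) ^ 3 * exp (4 * (\<beta> * \<rho>))"
    using 1 2 by (simp add: abs_le_iff field_simps)
  then have "\<bar>ln S - e + (\<beta> * m)\<^sup>2 / 2\<bar> / \<beta> \<le> 2 * (\<beta> * \<rho>) ^ 3 * exp (4 * (\<beta> * \<rho>)) / \<beta>"
    using \<beta> by (intro divide_right_mono) auto
  moreover have "\<bar>D + e / \<beta> - \<beta> / 2 * m\<^sup>2\<bar> = \<bar>ln S - e + (\<beta> * m)\<^sup>2 / 2\<bar> / \<beta>"
  proof -
    have "D + e / \<beta> - \<beta> / 2 * m\<^sup>2 = - ((ln S - e + (\<beta> * m)\<^sup>2 / 2) / \<beta>)"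
      using \<beta> by (simp add: D field_simps power2_eq_square)
    then show ?thesis using \<beta> by simp
  qed
  moreover have "2 * (\<beta> * \<rho>) ^ 3 * exp (4 * (\<beta> * \<rho>)) / \<beta> = 2 * \<beta>\<^sup>2 * \<rho> ^ 3 * exp (4 * \<beta> * \<rho>)"
    using \<beta> by (simp add: power2_eq_square power3_eq_cube mult_ac)
  ultimately show "\<bar>softmin \<beta> N c' - softmin \<beta> N c + e / \<beta> - \<beta> / 2 * m\<^sup>2\<bar> \<le> 2 * \<beta>\<^sup>2 * \<rho> ^ 3 * exp (4 * \<beta> * \<rho>)"
    unfolding D_def by simp
qed

section \<open>Gordon's comparison\<close>

text \<open>The second-order expansion is averaged over one increment, with \<open>a u\<close> in
  the role of the gradient of the value at \<open>u\<close>; the Gaussian second moment turns the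
  squared mean increment into the squared norm of the averaged gradient. The factors 2 make room for
  two contributions of unit size, a norm and a linear term. \<open>K\<close> precedes
  \<open>c\<close>, so the error is uniform over base points.\<close>

lemma gauss_softmin_step:
  fixes \<beta> C :: real
  assumes N: "finite N" "N \<noteq> {}" and \<beta>: "0 < \<beta>" and C: "0 \<le> C"
  obtains K where "\<And>(c :: 'i \<Rightarrow> real) c' (a :: 'i \<Rightarrow> 'a::euclidean_space) h.
    0 < h \<Longrightarrow> h \<le> 1 \<Longrightarrow>
    (\<And>u. u \<in> N \<Longrightarrow> (\<lambda>x. c' x u) \<in> borel_measurable borel) \<Longrightarrow>
    (\<And>x u. u \<in> N \<Longrightarrow> \<bar>c' x u - c u\<bar> \<le> 2 * sqrt h * norm x) \<Longrightarrow>
    (\<And>x u. u \<in> N \<Longrightarrow> \<bar>c' x u - c u - sqrt h * (x \<bullet> a u)\<bar> \<le> C * h * (norm x)\<^sup>2) \<Longrightarrow>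
    (\<And>u. u \<in> N \<Longrightarrow> norm (a u) \<le> 2) \<Longrightarrow>
    \<bar>(\<integral>x. softmin \<beta> N (c' x) \<partial>gauss) - softmin \<beta> N c
      + (\<Sum>u\<in>N. gibbs \<beta> N c u * (\<integral>x. exp (- \<beta> * (c' x u - c u)) - 1 \<partial>gauss)) / \<beta>
      - \<beta> / 2 * (h * (norm (\<Sum>u\<in>N. gibbs \<beta> N c u *\<^sub>R a u))\<^sup>2)\<bar> \<le> K * (h * sqrt h)"
proof
  \<comment> \<open>The first summand is the cubic softmin remainder at
    \<open>\<rho> = 2 * sqrt h * norm x\<close> (\<open>16 = 2 * 2 ^ 3\<close>,
    \<open>8 = 4 * 2\<close>); the second is the error of replacing the squared mean increment by
    the square of its linear part.\<close>
  define q where "q x = 16 * \<beta>\<^sup>2 * (norm x ^ 3 * exp (8 * \<beta> * norm x)) + \<beta> / 2 * (4 * C * norm x ^ 3 + C\<^sup>2 * norm x ^ 4)" for x :: 'a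
  have iq: "integrable gauss q"
    unfolding q_def using integrable_gauss_growth[of 0 3 "8 * \<beta>", where 'a='a]
    by (intro Bochner_Integration.integrable_add integrable_mult_right integrable_gauss_norm_power) simp
  fix c :: "'i \<Rightarrow> real" and c' and a :: "'i \<Rightarrow> 'a" and h :: real
  assume h: "0 < h" "h \<le> 1"
    and mc [measurable]: "\<And>u. u \<in> N \<Longrightarrow> (\<lambda>x. c' x u) \<in> borel_measurable borel"
    and d1: "\<And>x u. u \<in> N \<Longrightarrow> \<bar>c' x u - c u\<bar> \<le> 2 * sqrt h * norm x"
    and d2: "\<And>x u. u \<in> N \<Longrightarrow> \<bar>c' x u - c u - sqrt h * (x \<bullet> a u)\<bar> \<le> C * h * (norm x)\<^sup>2"
    and a: "\<And>u. u \<in> N \<Longrightarrow> norm (a u) \<le> 2"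
  have sh: "sqrt h \<le> 1" "0 \<le> sqrt h" using h by auto
  have hh: "h * h \<le> h * sqrt h"
    using h by (intro mult_left_mono real_le_rsqrt) (auto simp: power2_eq_square mult_left_le)
  define p where "p = gibbs \<beta> N c"
  have p: "\<And>u. 0 \<le> p u" "(\<Sum>u\<in>N. p u) = 1"
    using gibbs_sum[OF N] by (auto simp: p_def gibbs_nonneg)
  define A where "A = (\<Sum>u\<in>N. p u *\<^sub>R a u)"
  define m where "m x = (\<Sum>u\<in>N. p u * (c' x u - c u))" for x
  define e where "e x = (\<Sum>u\<in>N. p u * (exp (- \<beta> * (c' x u - c u)) - 1))" for x
  have A: "norm A \<le> 2"
  proof -
    have "norm A \<le> (\<Sum>u\<in>N. norm (p u *\<^sub>R a u))" unfolding A_def by (rule norm_sum)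
    also have "\<dots> \<le> (\<Sum>u\<in>N. p u * 2)"
      using p a by (intro sum_mono) (auto intro: mult_left_mono)
    finally show ?thesis by (simp add: sum_distrib_right[symmetric] p)
  qed
  have m: "\<bar>m x - sqrt h * (x \<bullet> A)\<bar> \<le> C * h * (norm x)\<^sup>2" for x
  proof -
    have "m x - sqrt h * (x \<bullet> A) = (\<Sum>u\<in>N. p u * (c' x u - c u - sqrt h * (x \<bullet> a u)))"
      unfolding m_def A_def
      by (simp add: inner_sum_right sum_distrib_left sum_subtractf[symmetric] right_diff_distrib mult.left_commute)
    then show ?thesis
      using abs_weighted_sum_le[of N p "\<lambda>u. c' x u - c u - sqrt h * (x \<bullet> a u)"] p d2 by simp
  qed
  have m2: "\<bar>(m x)\<^sup>2 - h * (x \<bullet> A)\<^sup>2\<bar> \<le> (h * sqrt h) * (4 * C * norm x ^ 3 + C\<^sup>2 * norm x ^ 4)" for x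
  proof -
    define r where "r = m x - sqrt h * (x \<bullet> A)"
    have r: "\<bar>r\<bar> \<le> C * h * (norm x)\<^sup>2" using m by (simp add: r_def)
    have xA: "\<bar>x \<bullet> A\<bar> \<le> 2 * norm x"
      using Cauchy_Schwarz_ineq2[of x A] mult_left_mono[OF A norm_ge_zero[of x]] by linarith
    have "m x = sqrt h * (x \<bullet> A) + r" by (simp add: r_def)
    then have "(m x)\<^sup>2 - h * (x \<bullet> A)\<^sup>2 = 2 * sqrt h * ((x \<bullet> A) * r) + r\<^sup>2"
      using h by (simp add: power2_sum power_mult_distrib)
    also have "\<bar>\<dots>\<bar> \<le> 2 * sqrt h * (\<bar>x \<bullet> A\<bar> * \<bar>r\<bar>) + \<bar>r\<bar>\<^sup>2"
      using h by (intro order_trans[OF abs_triangle_ineq]) (simp add: abs_mult)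
    also have "\<dots> \<le> 2 * sqrt h * ((2 * norm x) * (C * h * (norm x)\<^sup>2)) + (C * h * (norm x)\<^sup>2)\<^sup>2"
      using h by (intro add_mono mult_left_mono mult_mono power_mono r xA) auto
    also have "(C * h * (norm x)\<^sup>2)\<^sup>2 = (h * h) * (C\<^sup>2 * norm x ^ 4)"
      by (simp add: power_mult_distrib power2_eq_square eval_nat_numeral mult_ac)
    also have "\<dots> \<le> (h * sqrt h) * (C\<^sup>2 * norm x ^ 4)"
      by (intro mult_right_mono hh) auto
    finally show ?thesis
      by (simp add: algebra_simps power2_eq_square power3_eq_cube)
  qed
  define L where "L x = softmin \<beta> N (c' x) - softmin \<beta> N c" for x
  have L: "\<bar>L x\<bar> \<le> 2 * sqrt h * norm x" for x
    unfolding L_def by (rule softmin_taylor0[OF N \<beta>]) (rule d1)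
  have Q: "\<bar>L x + e x / \<beta> - \<beta> / 2 * (h * (x \<bullet> A)\<^sup>2)\<bar> \<le> (h * sqrt h) * q x" for x
  proof -
    have "\<bar>L x + e x / \<beta> - \<beta> / 2 * (m x)\<^sup>2\<bar> \<le> 2 * \<beta>\<^sup>2 * (2 * sqrt h * norm x) ^ 3 * exp (4 * \<beta> * (2 * sqrt h * norm x))"
      unfolding L_def e_def m_def p_def by (rule softmin_taylor2[OF N \<beta>]) (rule d1)
    also have "\<dots> \<le> 2 * \<beta>\<^sup>2 * (2 * sqrt h * norm x) ^ 3 * exp (8 * \<beta> * norm x)"
    proof (rule mult_left_mono)
      have "\<beta> * norm x * sqrt h \<le> \<beta> * norm x * 1"
        using sh \<beta> by (intro mult_left_mono) auto
      then show "exp (4 * \<beta> * (2 * sqrt h * norm x)) \<le> exp (8 * \<beta> * norm x)"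
        by (simp add: mult_ac)
    qed (use h in auto)
    also have "\<dots> = (h * sqrt h) * (16 * \<beta>\<^sup>2 * (norm x ^ 3 * exp (8 * \<beta> * norm x)))"
      using h by (simp add: power_mult_distrib power3_eq_cube)
    finally have 1: "\<bar>L x + e x / \<beta> - \<beta> / 2 * (m x)\<^sup>2\<bar> \<le> (h * sqrt h) * (16 * \<beta>\<^sup>2 * (norm x ^ 3 * exp (8 * \<beta> * norm x)))" .
    have "\<bar>\<beta> / 2 * ((m x)\<^sup>2 - h * (x \<bullet> A)\<^sup>2)\<bar> = \<beta> / 2 * \<bar>(m x)\<^sup>2 - h * (x \<bullet> A)\<^sup>2\<bar>"
      using \<beta> by (simp add: abs_mult)
    also have "\<dots> \<le> \<beta> / 2 * ((h * sqrt h) * (4 * C * norm x ^ 3 + C\<^sup>2 * norm x ^ 4))"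
      using \<beta> by (intro mult_left_mono m2) auto
    finally have 2: "\<bar>\<beta> / 2 * ((m x)\<^sup>2 - h * (x \<bullet> A)\<^sup>2)\<bar> \<le> (h * sqrt h) * (\<beta> / 2 * (4 * C * norm x ^ 3 + C\<^sup>2 * norm x ^ 4))"
      by (simp add: mult_ac)
    have "L x + e x / \<beta> - \<beta> / 2 * (h * (x \<bullet> A)\<^sup>2) = (L x + e x / \<beta> - \<beta> / 2 * (m x)\<^sup>2) + \<beta> / 2 * ((m x)\<^sup>2 - h * (x \<bullet> A)\<^sup>2)"
      by (simp add: right_diff_distrib)
    with 1 2 show ?thesis
      unfolding q_def distrib_left[of "h * sqrt h"] by linarith
  qed
  have mL: "L \<in> borel_measurable borel"
    unfolding L_def softmin_def by measurable
  have iL: "integrable gauss L"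
  proof (rule Bochner_Integration.integrable_bound)
    show "integrable gauss (\<lambda>x::'a. 2 * sqrt h * norm x)"
      using integrable_gauss_norm_power[of 1, where 'a='a] by simp
    show "AE x in gauss. norm (L x) \<le> norm (2 * sqrt h * norm x)"
      using L h by (intro AE_I2) (simp add: abs_mult)
  qed (use mL in simp)
  have ie: "integrable gauss (\<lambda>x. exp (- \<beta> * (c' x u - c u)) - 1)" if u: "u \<in> N" for u
  proof -
    note [measurable] = mc[OF u]
    have "norm (exp (- \<beta> * (c' x u - c u))) \<le> 1 * exp ((\<beta> * 2 * sqrt h) * norm x)" for x
    proof -
      have "- \<beta> * (c' x u - c u) \<le> \<bar>- \<beta> * (c' x u - c u)\<bar>" by (rule abs_ge_self)
      also have "\<dots> = \<beta> * \<bar>c' x u - c u\<bar>" using \<beta> by (simp add: abs_mult)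
      also have "\<dots> \<le> \<beta> * (2 * sqrt h * norm x)"
        using \<beta> d1[OF u] by (intro mult_left_mono) auto
      finally show ?thesis by (simp add: mult.assoc)
    qed
    then have "integrable gauss (\<lambda>x. exp (- \<beta> * (c' x u - c u)))"
      by (rule integrable_gauss_exp_bound[rotated]) measurable
    then show ?thesis by simp
  qed
  have ie': "integrable gauss e"
    unfolding e_def using ie by (intro Bochner_Integration.integrable_sum integrable_mult_right) auto
  have Ee: "(\<integral>x. e x \<partial>gauss) = (\<Sum>u\<in>N. p u * (\<integral>x. exp (- \<beta> * (c' x u - c u)) - 1 \<partial>gauss))"
    unfolding e_def using ie by (subst Bochner_Integration.integral_sum) auto
  have iA: "integrable gauss (\<lambda>x. (x \<bullet> A)\<^sup>2)"
  proof (rule Bochner_Integration.integrable_bound)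
    show "integrable gauss (\<lambda>x::'a. (norm A)\<^sup>2 * norm x ^ 2)"
      by (intro integrable_mult_right integrable_gauss_norm_power)
    have "(x \<bullet> A)\<^sup>2 \<le> (norm x * norm A)\<^sup>2" for x
      using Cauchy_Schwarz_ineq2[of x A] by (intro abs_le_square_iff[THEN iffD1]) simp
    then show "AE x in gauss. norm ((x \<bullet> A)\<^sup>2) \<le> norm ((norm A)\<^sup>2 * norm x ^ 2)"
      by (intro AE_I2) (simp add: power_mult_distrib mult.commute)
  qed simp
  have EL: "(\<integral>x. L x \<partial>gauss) = (\<integral>x. softmin \<beta> N (c' x) \<partial>gauss) - softmin \<beta> N c"
  proof -
    have "integrable gauss (\<lambda>x. L x + softmin \<beta> N c)"
      by (intro Bochner_Integration.integrable_add iL) simp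
    then have "integrable gauss (\<lambda>x. softmin \<beta> N (c' x))" by (simp add: L_def)
    then show ?thesis by (simp add: L_def)
  qed
  have "(\<integral>x. L x + e x / \<beta> - \<beta> / 2 * (h * (x \<bullet> A)\<^sup>2) \<partial>gauss)
      = (\<integral>x. L x \<partial>gauss) + (\<integral>x. e x \<partial>gauss) / \<beta> - \<beta> / 2 * (h * (norm A)\<^sup>2)"
    using iL ie' iA by (simp add: gauss_inner_square)
  also have "\<dots> = (\<integral>x. softmin \<beta> N (c' x) \<partial>gauss) - softmin \<beta> N c
      + (\<Sum>u\<in>N. gibbs \<beta> N c u * (\<integral>x. exp (- \<beta> * (c' x u - c u)) - 1 \<partial>gauss)) / \<beta>
      - \<beta> / 2 * (h * (norm (\<Sum>u\<in>N. gibbs \<beta> N c u *\<^sub>R a u))\<^sup>2)"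
    unfolding EL Ee A_def p_def by (rule refl)
  finally have eq: "\<bar>(\<integral>x. softmin \<beta> N (c' x) \<partial>gauss) - softmin \<beta> N c
      + (\<Sum>u\<in>N. gibbs \<beta> N c u * (\<integral>x. exp (- \<beta> * (c' x u - c u)) - 1 \<partial>gauss)) / \<beta>
      - \<beta> / 2 * (h * (norm (\<Sum>u\<in>N. gibbs \<beta> N c u *\<^sub>R a u))\<^sup>2)\<bar>
      = \<bar>\<integral>x. L x + e x / \<beta> - \<beta> / 2 * (h * (x \<bullet> A)\<^sup>2) \<partial>gauss\<bar>" by (simp only:)
  have "\<bar>\<integral>x. L x + e x / \<beta> - \<beta> / 2 * (h * (x \<bullet> A)\<^sup>2) \<partial>gauss\<bar>
      \<le> (\<integral>x. \<bar>L x + e x / \<beta> - \<beta> / 2 * (h * (x \<bullet> A)\<^sup>2)\<bar> \<partial>gauss)"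
    by (rule integral_abs_bound)
  also have "\<dots> \<le> (\<integral>x. (h * sqrt h) * q x \<partial>gauss)"
    using iL ie' iA iq Q by (intro integral_mono) auto
  finally show "\<bar>(\<integral>x. softmin \<beta> N (c' x) \<partial>gauss) - softmin \<beta> N c
      + (\<Sum>u\<in>N. gibbs \<beta> N c u * (\<integral>x. exp (- \<beta> * (c' x u - c u)) - 1 \<partial>gauss)) / \<beta>
      - \<beta> / 2 * (h * (norm (\<Sum>u\<in>N. gibbs \<beta> N c u *\<^sub>R a u))\<^sup>2)\<bar> \<le> (\<integral>x. q x \<partial>gauss) * (h * sqrt h)"
    unfolding eq by (simp add: mult_ac)
qed

section \<open>Rank-one matrices and the Frobenius inner product\<close>

definition outer :: "real^'m \<Rightarrow> real^'n \<Rightarrow> real^'n^'m" where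
  "outer v u = (\<chi> i. (v $ i) *\<^sub>R u)"

text \<open>The inner product on the matrix type is entrywise, so the rank-one matrix
  \<open>outer v u\<close> represents the functional sending \<open>A\<close> to
  \<open>(A *v u) \<bullet> v\<close>. Gradients in \<open>A\<close> of functions of
  \<open>A *v u\<close> take this form.\<close>

lemma inner_outer: "A \<bullet> outer v u = (A *v u) \<bullet> v"
  by (simp add: outer_def inner_vec_def[of A] inner_vec_def[of "A *v u"] matrix_vector_mul_component mult.commute)

lemma outer_mult_vec: "outer v u *v w = (u \<bullet> w) *\<^sub>R v"
  by (simp add: vec_eq_iff matrix_vector_mul_component outer_def mult.commute)

lemma outer_inner_outer: "outer v u \<bullet> outer v' u' = (v \<bullet> v') * (u \<bullet> u')"
  by (simp add: inner_outer outer_mult_vec)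

lemma norm_outer: "norm (outer v u) = norm v * norm u"
  by (simp add: norm_eq_sqrt_inner outer_inner_outer real_sqrt_mult)

lemma outer_zero [simp]: "outer 0 u = 0"
  by (simp add: outer_def vec_eq_iff)

lemma outer_inner_axis: "outer v u \<bullet> axis k w = v $ k * (u \<bullet> w)"
  by (simp add: outer_def inner_axis)

text \<open>\<open>norm A\<close> is the Frobenius norm; the bound is the Cauchy-Schwarz inequality
  against \<open>outer (A *v u) u\<close>.\<close>

lemma norm_matrix_vector_mult_le:
  fixes A :: "real^'n^'m"
  shows "norm (A *v u) \<le> norm A * norm u"
proof -
  have "(norm (A *v u))\<^sup>2 = A \<bullet> outer (A *v u) u"
    by (simp add: inner_outer power2_norm_eq_inner)
  also have "\<dots> \<le> norm A * (norm (A *v u) * norm u)"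
    using norm_cauchy_schwarz[of A "outer (A *v u) u"] by (simp add: norm_outer)
  finally show ?thesis
    by (cases "norm (A *v u) = 0") (auto simp: power2_eq_square)
qed

text \<open>Different coordinates of \<open>A *v u\<close> use different rows of \<open>A\<close>.
  Together with \<open>distr_gauss_vec_inner\<close> this gives both Gordon processes the same
  increment law at each single unit vector \<open>u\<close>.\<close>

lemma distr_gauss_matrix_vec:
  fixes u :: "real^'n"
  assumes u: "norm u = 1"
  shows "distr gauss borel (\<lambda>(A, t). (A *v u, t)) = (gauss :: ((real^'m) \<times> real) measure)"
proof (rule distr_gauss_image[where a="\<lambda>b. (outer (fst b) u, snd b)"])
  show "(\<lambda>(A, t). (A *v u, t)) \<in> borel_measurable (borel :: ((real^'n^'m) \<times> real) measure)"
    by (intro borel_measurable_continuous_onI)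
      (auto simp: split_beta matrix_vector_mult_def intro!: continuous_intros)
  show "(case x of (A, t) \<Rightarrow> (A *v u, t)) \<bullet> b = x \<bullet> (outer (fst b) u, snd b)" for x b
    by (cases x; cases b) (simp add: inner_outer)
  show "norm (outer (fst b) u, snd b) = 1" if "b \<in> Basis" for b :: "(real^'m) \<times> real"
    using that u by (auto simp: Basis_prod_def norm_outer norm_Pair)
  fix b b' :: "(real^'m) \<times> real" and i :: "(real^'n^'m) \<times> real"
  assume *: "b \<in> Basis" "b' \<in> Basis" "b \<noteq> b'" "i \<in> Basis"
  then consider k l where "i = (axis k (axis l 1), 0)" | "i = (0, 1)"
    by (auto simp: Basis_prod_def Basis_vec_def)
  then show "((outer (fst b) u, snd b) \<bullet> i) * ((outer (fst b') u, snd b') \<bullet> i) = 0"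
    by cases (use * in \<open>auto simp: Basis_prod_def Basis_vec_def outer_inner_axis, auto simp: axis_def split: if_splits\<close>)
qed

lemma distr_gauss_vec_inner:
  fixes u :: "real^'n"
  assumes u: "norm u = 1"
  shows "distr gauss borel (\<lambda>(v, g). (v, g \<bullet> u)) = (gauss :: ((real^'m) \<times> real) measure)"
proof (rule distr_gauss_image[where a="\<lambda>b. (fst b, snd b *\<^sub>R u)"])
  show "(\<lambda>(v, g). (v, g \<bullet> u)) \<in> borel_measurable (borel :: ((real^'m) \<times> (real^'n)) measure)"
    by (intro borel_measurable_continuous_onI) (auto simp: split_beta intro!: continuous_intros)
  show "(case x of (v, g) \<Rightarrow> (v, g \<bullet> u)) \<bullet> b = x \<bullet> (fst b, snd b *\<^sub>R u)" for x :: "(real^'m) \<times> (real^'n)" and b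
    by (cases x; cases b) (simp add: mult.commute)
  show "norm (fst b, snd b *\<^sub>R u) = 1" if "b \<in> Basis" for b :: "(real^'m) \<times> real"
    using that u by (auto simp: Basis_prod_def)
  fix b b' :: "(real^'m) \<times> real" and i :: "(real^'m) \<times> (real^'n)"
  assume "b \<in> Basis" "b' \<in> Basis" "b \<noteq> b'" "i \<in> Basis"
  then show "((fst b, snd b *\<^sub>R u) \<bullet> i) * ((fst b', snd b' *\<^sub>R u) \<bullet> i) = 0"
    by (auto simp: Basis_prod_def inner_Basis split: if_splits)
qed

text \<open>Both Gaussian processes of Gordon's comparison live on one space: \<open>((A, t), 0)\<close> gives
  \<open>norm (A u) + t\<close> and \<open>(0, (v, g))\<close> gives \<open>norm v + g \<bullet> u\<close>. The norm is smoothed by \<open>\<delta>\<close>.\<close>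

definition gordon_cost ::
  "real \<Rightarrow> ((real^'n^'m) \<times> real) \<times> ((real^'m) \<times> (real^'n)) \<Rightarrow> real^'n \<Rightarrow> real" where
  "gordon_cost \<delta> = (\<lambda>((A, t), (v, g)) u. norm (\<delta>, A *v u + v) + t + g \<bullet> u)"

lemma norm_Pair_increment:
  fixes v w :: "'a::real_normed_vector" and \<delta> :: real
  shows "\<bar>norm (\<delta>, v + w) - norm (\<delta>, v)\<bar> \<le> norm w"
  using norm_triangle_ineq3[of "(\<delta>, v + w)" "(\<delta>, v)"] by (simp add: norm_Pair)

text \<open>\<open>norm (\<delta>, v)\<close> is
  \<open>sqrt (\<delta>\<^sup>2 + (norm v)\<^sup>2)\<close> and never drops below
  \<open>\<delta>\<close>, which makes the remainder of \<open>norm_expansion\<close> uniform in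
  \<open>v\<close>.\<close>

lemma norm_Pair_taylor:
  fixes v w :: "'a::real_inner" and \<delta> :: real
  assumes "0 < \<delta>"
  shows "\<bar>norm (\<delta>, v + w) - norm (\<delta>, v) - w \<bullet> (v /\<^sub>R norm (\<delta>, v))\<bar> \<le> (norm w)\<^sup>2 / \<delta>"
proof -
  have "(\<delta>, v) \<noteq> 0" using assms by (simp add: zero_prod_def)
  from norm_expansion[OF this, of "(0, w)"]
  have "\<bar>norm (\<delta>, v + w) - norm (\<delta>, v) - (v \<bullet> w) / norm (\<delta>, v)\<bar> \<le> (norm w)\<^sup>2 / (2 * norm (\<delta>, v))"
    by simp
  also have "\<dots> \<le> (norm w)\<^sup>2 / \<delta>"
  proof (rule divide_left_mono)
    show "\<delta> \<le> 2 * norm (\<delta>, v)"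
      using norm_fst_le[of \<delta> v] assms by simp
  qed (use assms in \<open>auto simp: zero_prod_def\<close>)
  finally show ?thesis by (simp add: divide_inverse inner_commute mult.commute)
qed

lemma norm_Pair_gradient:
  fixes v :: "'a::real_normed_vector" and \<delta> :: real
  shows "norm (v /\<^sub>R norm (\<delta>, v)) \<le> 1"
proof -
  have "norm v \<le> norm (\<delta>, v)" by (rule norm_snd_le)
  then show ?thesis
    by (cases "norm (\<delta>, v) = 0") (auto simp: divide_simps)
qed

text \<open>One unit for each of the four components of \<open>y\<close>; the existence of a
  Lipschitz constant is what matters here, for integrability.\<close>

lemma gordon_cost_lipschitz:
  fixes z y :: "((real^'n^'m) \<times> real) \<times> ((real^'m) \<times> (real^'n))"
  assumes "norm u = 1"
  shows "\<bar>gordon_cost \<delta> (z + y) u - gordon_cost \<delta> z u\<bar> \<le> 4 * norm y"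
proof -
  obtain A t v g B s w k where zy: "z = ((A, t), (v, g))" "y = ((B, s), (w, k))"
    by (metis prod.exhaust)
  have n: "norm B \<le> norm y" "\<bar>s\<bar> \<le> norm y" "norm w \<le> norm y" "norm k \<le> norm y"
    unfolding zy
    using norm_fst_le[of "(B, s)" "(w, k)"] norm_snd_le[of "(w, k)" "(B, s)"] norm_fst_le[of B s]
      norm_snd_le[of s B] norm_fst_le[of w k] norm_snd_le[of k w]
    by auto
  have 1: "norm (B *v u) \<le> norm B" "\<bar>k \<bullet> u\<bar> \<le> norm k"
    using norm_matrix_vector_mult_le[of B u] Cauchy_Schwarz_ineq2[of k u] assms by auto
  have "\<bar>norm (\<delta>, (A *v u + v) + (B *v u + w)) - norm (\<delta>, A *v u + v)\<bar> \<le> norm (B *v u + w)"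
    by (rule norm_Pair_increment)
  also have "\<dots> \<le> norm B + norm w"
    using norm_triangle_ineq[of "B *v u" w] 1 by linarith
  finally have "\<bar>gordon_cost \<delta> (z + y) u - gordon_cost \<delta> z u\<bar> \<le> norm B + norm w + \<bar>s\<bar> + norm k"
    using 1(2) unfolding zy
    by (simp add: gordon_cost_def matrix_vector_mult_add_rdistrib inner_add_left add_ac)
  then show ?thesis using n by linarith
qed

lemma continuous_gordon_cost:
  "continuous_on UNIV (\<lambda>z :: ((real^'n^'m) \<times> real) \<times> ((real^'m) \<times> (real^'n)). gordon_cost \<delta> z u)"
  unfolding gordon_cost_def split_beta matrix_vector_mult_def
  by (intro continuous_intros)

lemma norm_weighted_sum_square:
  fixes f :: "'i \<Rightarrow> 'a::real_inner"
  shows "(norm (\<Sum>u\<in>N. p u *\<^sub>R f u))\<^sup>2 = (\<Sum>u\<in>N. \<Sum>v\<in>N. (p u * p v) * (f u \<bullet> f v))"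
  unfolding power2_norm_eq_inner
  by (simp add: inner_sum_left inner_sum_right sum_distrib_left mult.assoc) (subst sum.swap, simp add: mult.left_commute mult.commute inner_commute)

text \<open>Both averages are expanded around the same point. Their exponential terms coincide,
  since they involve one \<open>u\<close> at a time; the remaining terms are squared norms of
  Gibbs-averaged gradients, ordered by Gordon's covariance inequality.\<close>

lemma gordon_step:
  fixes N :: "(real^'n) set"
  assumes N: "finite N" "N \<noteq> {}" "N \<subseteq> sphere 0 1" and \<beta>: "0 < \<beta>" and \<delta>: "0 < \<delta>"
  obtains K where "\<And>(z :: ((real^'n^'m) \<times> real) \<times> ((real^'m) \<times> (real^'n))) h. 0 < h \<Longrightarrow> h \<le> 1 \<Longrightarrow>
    (\<integral>y. softmin \<beta> N (gordon_cost \<delta> (z + (0, sqrt h *\<^sub>R y))) \<partial>gauss)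
    \<le> (\<integral>x. softmin \<beta> N (gordon_cost \<delta> (z + (sqrt h *\<^sub>R x, 0))) \<partial>gauss) + K * (h * sqrt h)"
proof -
  have C: "0 \<le> 1 / \<delta>" using \<delta> by simp
  obtain K1 where K1: "\<And>(c :: (real^'n) \<Rightarrow> real) c' (a :: real^'n \<Rightarrow> (real^'n^'m) \<times> real) h.
    0 < h \<Longrightarrow> h \<le> 1 \<Longrightarrow>
    (\<And>u. u \<in> N \<Longrightarrow> (\<lambda>x. c' x u) \<in> borel_measurable borel) \<Longrightarrow>
    (\<And>x u. u \<in> N \<Longrightarrow> \<bar>c' x u - c u\<bar> \<le> 2 * sqrt h * norm x) \<Longrightarrow>
    (\<And>x u. u \<in> N \<Longrightarrow> \<bar>c' x u - c u - sqrt h * (x \<bullet> a u)\<bar> \<le> 1 / \<delta> * h * (norm x)\<^sup>2) \<Longrightarrow>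
    (\<And>u. u \<in> N \<Longrightarrow> norm (a u) \<le> 2) \<Longrightarrow>
    \<bar>(\<integral>x. softmin \<beta> N (c' x) \<partial>gauss) - softmin \<beta> N c
      + (\<Sum>u\<in>N. gibbs \<beta> N c u * (\<integral>x. exp (- \<beta> * (c' x u - c u)) - 1 \<partial>gauss)) / \<beta>
      - \<beta> / 2 * (h * (norm (\<Sum>u\<in>N. gibbs \<beta> N c u *\<^sub>R a u))\<^sup>2)\<bar> \<le> K1 * (h * sqrt h)"
    using gauss_softmin_step[OF N(1,2) \<beta> C, where 'a="(real^'n^'m) \<times> real"] by blast
  obtain K2 where K2: "\<And>(c :: (real^'n) \<Rightarrow> real) c' (a :: real^'n \<Rightarrow> (real^'m) \<times> (real^'n)) h.
    0 < h \<Longrightarrow> h \<le> 1 \<Longrightarrow>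
    (\<And>u. u \<in> N \<Longrightarrow> (\<lambda>x. c' x u) \<in> borel_measurable borel) \<Longrightarrow>
    (\<And>x u. u \<in> N \<Longrightarrow> \<bar>c' x u - c u\<bar> \<le> 2 * sqrt h * norm x) \<Longrightarrow>
    (\<And>x u. u \<in> N \<Longrightarrow> \<bar>c' x u - c u - sqrt h * (x \<bullet> a u)\<bar> \<le> 1 / \<delta> * h * (norm x)\<^sup>2) \<Longrightarrow>
    (\<And>u. u \<in> N \<Longrightarrow> norm (a u) \<le> 2) \<Longrightarrow>
    \<bar>(\<integral>x. softmin \<beta> N (c' x) \<partial>gauss) - softmin \<beta> N c
      + (\<Sum>u\<in>N. gibbs \<beta> N c u * (\<integral>x. exp (- \<beta> * (c' x u - c u)) - 1 \<partial>gauss)) / \<beta>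
      - \<beta> / 2 * (h * (norm (\<Sum>u\<in>N. gibbs \<beta> N c u *\<^sub>R a u))\<^sup>2)\<bar> \<le> K2 * (h * sqrt h)"
    using gauss_softmin_step[OF N(1,2) \<beta> C, where 'a="(real^'m) \<times> (real^'n)"] by blast
  show thesis
  proof
    fix z :: "((real^'n^'m) \<times> real) \<times> ((real^'m) \<times> (real^'n))" and h :: real
    assume h: "0 < h" "h \<le> 1"
    obtain A t v g where z: "z = ((A, t), (v, g))" by (metis prod.exhaust)
    define V where "V u = A *v u + v" for u
    define G where "G u = V u /\<^sub>R norm (\<delta>, V u)" for u
    have G: "norm (G u) \<le> 1" for u unfolding G_def by (rule norm_Pair_gradient)
    define c where "c = gordon_cost \<delta> z"
    define p where "p = gibbs \<beta> N c"
    define f where "f u = (\<lambda>(w, s). exp (- \<beta> * (norm (\<delta>, V u + sqrt h *\<^sub>R w) - norm (\<delta>, V u) + sqrt h * s)) - 1)" for u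
    have nu: "norm u = 1" if "u \<in> N" for u using that N(3) by auto
    have mc: "(\<lambda>x. gordon_cost \<delta> (z + T x) u) \<in> borel_measurable borel"
      if "continuous_on UNIV T" for T :: "'x::euclidean_space \<Rightarrow> _" and u
      by (rule borel_measurable_continuous_onI)
        (intro continuous_on_compose2[OF continuous_gordon_cost] continuous_intros that subset_UNIV)
    have dX: "gordon_cost \<delta> (z + (sqrt h *\<^sub>R x, 0)) u - c u
        = norm (\<delta>, V u + sqrt h *\<^sub>R (fst x *v u)) - norm (\<delta>, V u) + sqrt h * snd x" for x u
      by (cases x) (simp add: c_def z gordon_cost_def V_def matrix_vector_mult_add_rdistrib scaleR_matrix_vector_assoc add_ac)
    have dY: "gordon_cost \<delta> (z + (0, sqrt h *\<^sub>R y)) u - c u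
        = norm (\<delta>, V u + sqrt h *\<^sub>R fst y) - norm (\<delta>, V u) + sqrt h * (snd y \<bullet> u)" for y u
      by (cases y) (simp add: c_def z gordon_cost_def V_def inner_add_left add_ac)
    have inc: "\<bar>norm (\<delta>, V u + sqrt h *\<^sub>R w) - norm (\<delta>, V u) + sqrt h * s\<bar> \<le> 2 * sqrt h * r"
      if "norm w \<le> r" "\<bar>s\<bar> \<le> r" for w u s r
    proof -
      have "\<bar>norm (\<delta>, V u + sqrt h *\<^sub>R w) - norm (\<delta>, V u)\<bar> \<le> sqrt h * norm w"
        using norm_Pair_increment[of \<delta> "V u" "sqrt h *\<^sub>R w"] h by simp
      also have "\<dots> \<le> sqrt h * r" using that h by (intro mult_left_mono) auto
      finally have "\<bar>norm (\<delta>, V u + sqrt h *\<^sub>R w) - norm (\<delta>, V u)\<bar> \<le> sqrt h * r" .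
      moreover have "\<bar>sqrt h * s\<bar> \<le> sqrt h * r"
        using that h by (simp add: abs_mult mult_left_mono)
      ultimately show ?thesis by linarith
    qed
    have tay: "\<bar>norm (\<delta>, V u + sqrt h *\<^sub>R w) - norm (\<delta>, V u) - sqrt h * (w \<bullet> G u)\<bar> \<le> 1 / \<delta> * h * r\<^sup>2"
      if "norm w \<le> r" for w u r
    proof -
      have "\<bar>norm (\<delta>, V u + sqrt h *\<^sub>R w) - norm (\<delta>, V u) - sqrt h * (w \<bullet> G u)\<bar> \<le> (norm (sqrt h *\<^sub>R w))\<^sup>2 / \<delta>"
        using norm_Pair_taylor[OF \<delta>, of "V u" "sqrt h *\<^sub>R w"] by (simp add: G_def mult.left_commute)
      also have "\<dots> = h * (norm w)\<^sup>2 / \<delta>" using h by (simp add: power_mult_distrib)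
      also have "\<dots> \<le> h * r\<^sup>2 / \<delta>"
        using that h \<delta> by (intro divide_right_mono mult_left_mono power_mono) auto
      finally show ?thesis by simp
    qed
    have mf: "f u \<in> borel_measurable borel" for u
      unfolding f_def split_beta by (intro borel_measurable_continuous_onI continuous_intros)
    \<comment> \<open>The gradients of the cost at \<open>u\<close> in the two blocks of variables;
      the entry 1 belongs to the scalar \<open>t\<close>.\<close>
    let ?aX = "\<lambda>u. (outer (G u) u, 1 :: real)" and ?aY = "\<lambda>u. (G u, u)"
    have X: "\<bar>(\<integral>x. softmin \<beta> N (gordon_cost \<delta> (z + (sqrt h *\<^sub>R x, 0))) \<partial>gauss) - softmin \<beta> N c
      + (\<Sum>u\<in>N. p u * (\<integral>x. exp (- \<beta> * (gordon_cost \<delta> (z + (sqrt h *\<^sub>R x, 0)) u - c u)) - 1 \<partial>gauss)) / \<beta>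
      - \<beta> / 2 * (h * (norm (\<Sum>u\<in>N. p u *\<^sub>R ?aX u))\<^sup>2)\<bar> \<le> K1 * (h * sqrt h)"
      unfolding p_def
    proof (rule K1[OF h])
      fix u assume u: "u \<in> N"
      show "(\<lambda>x. gordon_cost \<delta> (z + (sqrt h *\<^sub>R x, 0)) u) \<in> borel_measurable borel"
        by (rule mc) (intro continuous_intros)
      show "norm (?aX u) \<le> 2"
        using G[of u] nu[OF u] norm_Pair_le[of "outer (G u) u" "1::real"] by (simp add: norm_outer)
      fix x :: "(real^'n^'m) \<times> real"
      have x: "norm (fst x *v u) \<le> norm x" "\<bar>snd x\<bar> \<le> norm x"
        using norm_matrix_vector_mult_le[of "fst x" u] nu[OF u] norm_fst_le[of "fst x" "snd x"] norm_snd_le[of "snd x" "fst x"]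
        by auto
      show "\<bar>gordon_cost \<delta> (z + (sqrt h *\<^sub>R x, 0)) u - c u\<bar> \<le> 2 * sqrt h * norm x"
        unfolding dX by (rule inc[OF x])
      show "\<bar>gordon_cost \<delta> (z + (sqrt h *\<^sub>R x, 0)) u - c u - sqrt h * (x \<bullet> ?aX u)\<bar> \<le> 1 / \<delta> * h * (norm x)\<^sup>2"
        using tay[OF x(1), of u] unfolding dX by (cases x) (simp add: inner_outer algebra_simps)
    qed
    have Y: "\<bar>(\<integral>y. softmin \<beta> N (gordon_cost \<delta> (z + (0, sqrt h *\<^sub>R y))) \<partial>gauss) - softmin \<beta> N c
      + (\<Sum>u\<in>N. p u * (\<integral>y. exp (- \<beta> * (gordon_cost \<delta> (z + (0, sqrt h *\<^sub>R y)) u - c u)) - 1 \<partial>gauss)) / \<beta>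
      - \<beta> / 2 * (h * (norm (\<Sum>u\<in>N. p u *\<^sub>R ?aY u))\<^sup>2)\<bar> \<le> K2 * (h * sqrt h)"
      unfolding p_def
    proof (rule K2[OF h])
      fix u assume u: "u \<in> N"
      show "(\<lambda>y. gordon_cost \<delta> (z + (0, sqrt h *\<^sub>R y)) u) \<in> borel_measurable borel"
        by (rule mc) (intro continuous_intros)
      show "norm (?aY u) \<le> 2"
        using G[of u] nu[OF u] norm_Pair_le[of "G u" u] by simp
      fix y :: "(real^'m) \<times> (real^'n)"
      have y: "norm (fst y) \<le> norm y" "\<bar>snd y \<bullet> u\<bar> \<le> norm y"
        using Cauchy_Schwarz_ineq2[of "snd y" u] nu[OF u] norm_fst_le[of "fst y" "snd y"] norm_snd_le[of "snd y" "fst y"]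
        by auto
      show "\<bar>gordon_cost \<delta> (z + (0, sqrt h *\<^sub>R y)) u - c u\<bar> \<le> 2 * sqrt h * norm y"
        unfolding dY by (rule inc[OF y])
      show "\<bar>gordon_cost \<delta> (z + (0, sqrt h *\<^sub>R y)) u - c u - sqrt h * (y \<bullet> ?aY u)\<bar> \<le> 1 / \<delta> * h * (norm y)\<^sup>2"
        using tay[OF y(1), of u] unfolding dY by (cases y) (simp add: algebra_simps)
    qed
    have EX: "(\<integral>x. exp (- \<beta> * (gordon_cost \<delta> (z + (sqrt h *\<^sub>R x, 0)) u - c u)) - 1 \<partial>gauss) = (\<integral>ws. f u ws \<partial>gauss)"
      if "u \<in> N" for u
    proof -
      have "(\<lambda>(A, t). (A *v u, t)) \<in> borel_measurable (borel :: ((real^'n^'m) \<times> real) measure)"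
        by (intro borel_measurable_continuous_onI)
          (auto simp: split_beta matrix_vector_mult_def intro!: continuous_intros)
      from integral_gauss_image[OF distr_gauss_matrix_vec[OF nu[OF that]] this mf[of u]]
      show ?thesis unfolding dX by (simp add: f_def split_beta)
    qed
    have EY: "(\<integral>y. exp (- \<beta> * (gordon_cost \<delta> (z + (0, sqrt h *\<^sub>R y)) u - c u)) - 1 \<partial>gauss) = (\<integral>ws. f u ws \<partial>gauss)"
      if "u \<in> N" for u
    proof -
      have "(\<lambda>(v, g). (v, g \<bullet> u)) \<in> borel_measurable (borel :: ((real^'m) \<times> (real^'n)) measure)"
        by (intro borel_measurable_continuous_onI) (auto simp: split_beta intro!: continuous_intros)
      from integral_gauss_image[OF distr_gauss_vec_inner[OF nu[OF that]] this mf[of u]]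
      show ?thesis unfolding dY by (simp add: f_def split_beta)
    qed
    have key: "(norm (\<Sum>u\<in>N. p u *\<^sub>R ?aY u))\<^sup>2 \<le> (norm (\<Sum>u\<in>N. p u *\<^sub>R ?aX u))\<^sup>2"
      unfolding norm_weighted_sum_square
    proof (intro sum_mono mult_left_mono)
      fix u w assume uw: "u \<in> N" "w \<in> N"
      have "\<bar>G u \<bullet> G w\<bar> \<le> 1 * 1" "\<bar>u \<bullet> w\<bar> \<le> 1 * 1"
        using Cauchy_Schwarz_ineq2[of "G u" "G w"] mult_mono[OF G[of u] G[of w]] Cauchy_Schwarz_ineq2[of u w] nu uw
        by auto
      \<comment> \<open>Expanded: \<open>G u \<bullet> G w + u \<bullet> w \<le> (G u \<bullet> G w)
        * (u \<bullet> w) + 1\<close>. The 1 on the right is the contribution of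
        \<open>t\<close>.\<close>
      then have "0 \<le> (1 - G u \<bullet> G w) * (1 - u \<bullet> w)"
        by (intro mult_nonneg_nonneg) auto
      then show "?aY u \<bullet> ?aY w \<le> ?aX u \<bullet> ?aX w"
        by (simp add: outer_inner_outer algebra_simps)
      show "0 \<le> p u * p w" by (simp add: p_def gibbs_nonneg)
    qed
    define e where "e = (\<Sum>u\<in>N. p u * (\<integral>ws. f u ws \<partial>gauss)) / \<beta>"
    have eX: "(\<Sum>u\<in>N. p u * (\<integral>x. exp (- \<beta> * (gordon_cost \<delta> (z + (sqrt h *\<^sub>R x, 0)) u - c u)) - 1 \<partial>gauss)) / \<beta> = e"
      unfolding e_def by (simp only: EX cong: sum.cong)
    have eY: "(\<Sum>u\<in>N. p u * (\<integral>y. exp (- \<beta> * (gordon_cost \<delta> (z + (0, sqrt h *\<^sub>R y)) u - c u)) - 1 \<partial>gauss)) / \<beta> = e"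
      unfolding e_def by (simp only: EY cong: sum.cong)
    have "\<beta> / 2 * (h * (norm (\<Sum>u\<in>N. p u *\<^sub>R ?aY u))\<^sup>2) \<le> \<beta> / 2 * (h * (norm (\<Sum>u\<in>N. p u *\<^sub>R ?aX u))\<^sup>2)"
      using key \<beta> h by (intro mult_left_mono) auto
    then show "(\<integral>y. softmin \<beta> N (gordon_cost \<delta> (z + (0, sqrt h *\<^sub>R y))) \<partial>gauss)
      \<le> (\<integral>x. softmin \<beta> N (gordon_cost \<delta> (z + (sqrt h *\<^sub>R x, 0))) \<partial>gauss) + (K1 + K2) * (h * sqrt h)"
      using X Y unfolding eX eY distrib_right by linarith
  qed
qed

lemma gordon_comparison:
  fixes N :: "(real^'n) set"
  assumes N: "finite N" "N \<noteq> {}" "N \<subseteq> sphere 0 1" and \<beta>: "0 < \<beta>" and \<delta>: "0 < \<delta>"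
  shows "(\<integral>y. softmin \<beta> N (gordon_cost \<delta> ((0 :: (real^'n^'m) \<times> real), y)) \<partial>gauss)
    \<le> (\<integral>A. softmin \<beta> N (\<lambda>u. norm (\<delta>, (A :: real^'n^'m) *v u)) \<partial>gauss)"
proof -
  define F where "F z = softmin \<beta> N (gordon_cost \<delta> z)" for z :: "((real^'n^'m) \<times> real) \<times> ((real^'m) \<times> (real^'n))"
  have L: "4-lipschitz_on UNIV F"
  proof (rule lipschitz_onI)
    fix z w :: "((real^'n^'m) \<times> real) \<times> ((real^'m) \<times> (real^'n))"
    have "\<bar>F z - F w\<bar> \<le> 4 * norm (z - w)"
      unfolding F_def
    proof (rule softmin_taylor0[OF N(1,2) \<beta>])
      show "\<bar>gordon_cost \<delta> z u - gordon_cost \<delta> w u\<bar> \<le> 4 * norm (z - w)" if "u \<in> N" for u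
        using gordon_cost_lipschitz[of u \<delta> w "z - w"] that N(3) by auto
    qed
    then show "dist (F z) (F w) \<le> 4 * dist z w" by (simp add: dist_norm)
  qed simp
  obtain K where "\<And>(z :: ((real^'n^'m) \<times> real) \<times> ((real^'m) \<times> (real^'n))) h. 0 < h \<Longrightarrow> h \<le> 1 \<Longrightarrow>
    (\<integral>y. softmin \<beta> N (gordon_cost \<delta> (z + (0, sqrt h *\<^sub>R y))) \<partial>gauss)
    \<le> (\<integral>x. softmin \<beta> N (gordon_cost \<delta> (z + (sqrt h *\<^sub>R x, 0))) \<partial>gauss) + K * (h * sqrt h)"
    using gordon_step[OF N \<beta> \<delta>] by blast
  then have "(\<integral>y. F (0, y) \<partial>gauss) \<le> (\<integral>x. F (x, 0) \<partial>gauss)"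
    by (intro gauss_lindeberg[OF L]) (simp add: F_def)
  also have "(\<integral>x. F (x, 0) \<partial>gauss) = (\<integral>A. softmin \<beta> N (\<lambda>u. norm (\<delta>, (A :: real^'n^'m) *v u)) \<partial>gauss)"
  proof -
    define H where "H A = softmin \<beta> N (\<lambda>u. norm (\<delta>, A *v u))" for A :: "real^'n^'m"
    \<comment> \<open>The scalar \<open>t\<close> shifts all costs alike and therefore leaves the
      softmin as an additive term, whose mean is zero.\<close>
    have eq: "F (x, 0) = H (fst x) + snd x" for x
    proof -
      have "gordon_cost \<delta> (x, 0) = (\<lambda>u. norm (\<delta>, fst x *v u) + snd x)"
        by (cases x) (simp add: gordon_cost_def zero_prod_def fun_eq_iff)
      then show ?thesis
        unfolding F_def H_def by (simp add: softmin_add_const[OF N(1,2) \<beta>])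
    qed
    have "4-lipschitz_on UNIV (\<lambda>x. F (x, 0))"
    proof (rule lipschitz_onI)
      show "dist (F (x, 0)) (F (y, 0)) \<le> 4 * dist x y" for x y
        using lipschitz_onD[OF L, of "(x, 0)" "(y, 0)"] by (simp add: dist_Pair_Pair)
    qed simp
    from integrable_gauss_lipschitz[OF this, of 0 1]
    have iF: "integrable gauss (\<lambda>x. F (x, 0))" by simp
    have t: "integrable gauss (\<lambda>t::real. t)" "(\<integral>t. t \<partial>(gauss :: real measure)) = 0"
      using gauss_inner_mean[of "1::real"] integrable_gauss_lipschitz[of 1 "\<lambda>t::real. t" 0 1]
      by (auto simp: lipschitz_on_def)
    have "(\<integral>x. F (x, 0) \<partial>gauss) = (\<integral>A. (\<integral>t. F ((A, t), 0) \<partial>gauss) \<partial>gauss)"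
      by (rule gauss_integral_pair(1)[OF iF, symmetric])
    also have "\<dots> = (\<integral>A. H A \<partial>gauss)"
      using t by (simp add: eq)
    finally show ?thesis by (simp add: H_def)
  qed
  finally show ?thesis by (simp add: F_def)
qed


section \<open>Mean and exponential moment of the smoothed minimum\<close>

lemma softmin_gradient_continuous:
  fixes N :: "(real^'n) set" and \<delta> :: real
  assumes "finite N" "N \<noteq> {}" "0 < \<delta>"
  shows "continuous_on UNIV (\<lambda>A :: real^'n^'m.
    \<Sum>u\<in>N. gibbs \<beta> N (\<lambda>u. norm (\<delta>, A *v u)) u *\<^sub>R outer ((A *v u) /\<^sub>R norm (\<delta>, A *v u)) u)"
proof -
  have "(\<Sum>v\<in>N. exp (- \<beta> * norm (\<delta>, A *v v))) \<noteq> 0" for A :: "real^'n^'m"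
    using assms by (intro less_imp_neq[THEN not_sym] sum_pos) auto
  moreover have "norm (\<delta>, A *v u) \<noteq> 0" for A :: "real^'n^'m" and u
    using assms by (simp add: zero_prod_def)
  moreover have "continuous_on UNIV (\<lambda>A :: real^'n^'m. A *v u)" for u
    unfolding matrix_vector_mult_def by (intro continuous_intros)
  ultimately show ?thesis
    unfolding gibbs_def outer_def by (intro continuous_intros) auto
qed

text \<open>The Lipschitz constant and the bound on the gradient, a Gibbs average of rank-one
  matrices of norm at most 1, are both 1 for all \<open>\<beta>\<close> and \<open>\<delta>\<close>.
  Hence the estimate does not deteriorate when the smoothing is removed.\<close>

lemma gordon_softmin_exp:
  fixes N :: "(real^'n) set" and \<beta> \<delta> l :: real
  assumes N: "finite N" "N \<noteq> {}" "N \<subseteq> sphere 0 1" and \<beta>: "0 < \<beta>" and \<delta>: "0 < \<delta>" and l: "0 \<le> l"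
  defines "H \<equiv> (\<lambda>A :: real^'n^'m. softmin \<beta> N (\<lambda>u. norm (\<delta>, A *v u)))"
  shows "(\<integral>A. exp (- l * H A) \<partial>gauss) \<le> exp (- l * (\<integral>A. H A \<partial>gauss) + l\<^sup>2 / 2)"
    and "1-lipschitz_on UNIV H"
proof -
  define G where "G A u = (A *v u) /\<^sub>R norm (\<delta>, A *v u)" for A :: "real^'n^'m" and u
  define D where "D A = (\<Sum>u\<in>N. gibbs \<beta> N (\<lambda>u. norm (\<delta>, A *v u)) u *\<^sub>R outer (G A u) u)" for A :: "real^'n^'m"
  have Bu: "norm (B *v u) \<le> norm B" if "u \<in> N" for B :: "real^'n^'m" and u
    using norm_matrix_vector_mult_le[of B u] that N(3) by auto
  have inc: "\<bar>norm (\<delta>, (A + B) *v u) - norm (\<delta>, A *v u)\<bar> \<le> norm B" if "u \<in> N" for A B :: "real^'n^'m" and u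
    using norm_Pair_increment[of \<delta> "A *v u" "B *v u"] Bu[OF that, of B]
    by (simp add: matrix_vector_mult_add_rdistrib)
  show L: "1-lipschitz_on UNIV H"
  proof (rule lipschitz_onI)
    fix A B :: "real^'n^'m"
    have "\<bar>H (B + (A - B)) - H B\<bar> \<le> norm (A - B)"
      unfolding H_def by (rule softmin_taylor0[OF N(1,2) \<beta>]) (rule inc)
    then show "dist (H A) (H B) \<le> 1 * dist A B" by (simp add: dist_norm)
  qed simp
  show "(\<integral>A. exp (- l * H A) \<partial>gauss) \<le> exp (- l * (\<integral>A. H A \<partial>gauss) + l\<^sup>2 / 2)"
  proof (rule gauss_concentration[OF L _ _ _ _ l])
    show "D \<in> borel_measurable borel"
      unfolding D_def G_def
      by (intro borel_measurable_continuous_onI softmin_gradient_continuous N \<delta>)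
    show "norm (D A) \<le> 1" for A
    proof -
      have "norm (D A) \<le> (\<Sum>u\<in>N. norm (gibbs \<beta> N (\<lambda>u. norm (\<delta>, A *v u)) u *\<^sub>R outer (G A u) u))"
        unfolding D_def by (rule norm_sum)
      also have "\<dots> \<le> (\<Sum>u\<in>N. gibbs \<beta> N (\<lambda>u. norm (\<delta>, A *v u)) u)"
      proof (rule sum_mono)
        fix u assume "u \<in> N"
        then have "norm (outer (G A u) u) \<le> 1"
          using N(3) norm_Pair_gradient[where v="A *v u" and \<delta>=\<delta>] unfolding norm_outer G_def by auto
        then show "norm (gibbs \<beta> N (\<lambda>u. norm (\<delta>, A *v u)) u *\<^sub>R outer (G A u) u) \<le> gibbs \<beta> N (\<lambda>u. norm (\<delta>, A *v u)) u"
          by (simp add: gibbs_nonneg mult_left_le)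
      qed
      finally show ?thesis by (simp add: gibbs_sum[OF N(1,2)])
    qed
    \<comment> \<open>\<open>3 * \<beta>\<close> comes from the first-order expansion of the
      softmin, \<open>1 / \<delta>\<close> from that of the smoothed norms.\<close>
    show "0 \<le> 3 * \<beta> + 1 / \<delta>" using \<beta> \<delta> by simp
    fix A B :: "real^'n^'m"
    define p where "p = gibbs \<beta> N (\<lambda>u. norm (\<delta>, A *v u))"
    define m where "m = (\<Sum>u\<in>N. p u * (norm (\<delta>, (A + B) *v u) - norm (\<delta>, A *v u)))"
    have 1: "\<bar>H (A + B) - H A - m\<bar> \<le> 3 * \<beta> * (norm B)\<^sup>2"
      unfolding H_def m_def p_def by (rule softmin_taylor1[OF N(1,2) \<beta>]) (rule inc)
    have "m - D A \<bullet> B = (\<Sum>u\<in>N. p u * (norm (\<delta>, (A + B) *v u) - norm (\<delta>, A *v u) - (B *v u) \<bullet> G A u))"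
      unfolding m_def D_def p_def
      by (simp add: inner_commute[of _ B] inner_sum_right inner_outer right_diff_distrib sum_subtractf)
    also have "\<bar>\<dots>\<bar> \<le> (norm B)\<^sup>2 / \<delta>"
    proof (rule abs_weighted_sum_le)
      fix u assume u: "u \<in> N"
      have "\<bar>norm (\<delta>, (A + B) *v u) - norm (\<delta>, A *v u) - (B *v u) \<bullet> G A u\<bar> \<le> (norm (B *v u))\<^sup>2 / \<delta>"
        using norm_Pair_taylor[OF \<delta>, of "A *v u" "B *v u"]
        by (simp add: G_def matrix_vector_mult_add_rdistrib)
      also have "\<dots> \<le> (norm B)\<^sup>2 / \<delta>"
        using Bu[OF u] \<delta> by (intro divide_right_mono power_mono) auto
      finally show "\<bar>norm (\<delta>, (A + B) *v u) - norm (\<delta>, A *v u) - (B *v u) \<bullet> G A u\<bar> \<le> (norm B)\<^sup>2 / \<delta>" .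
    qed (auto simp: p_def gibbs_nonneg gibbs_sum[OF N(1,2)])
    finally have "\<bar>m - D A \<bullet> B\<bar> \<le> (norm B)\<^sup>2 / \<delta>" .
    with 1 show "\<bar>H (A + B) - H A - D A \<bullet> B\<bar> \<le> (3 * \<beta> + 1 / \<delta>) * (norm B)\<^sup>2"
      by (simp add: algebra_simps)
  qed
qed

lemma sup_inner_lipschitz:
  fixes S :: "'a::euclidean_space set"
  assumes "S \<noteq> {}" "S \<subseteq> sphere 0 1"
  shows "1-lipschitz_on UNIV (\<lambda>g. SUP u\<in>S. g \<bullet> u)"
    and "\<And>g u. u \<in> S \<Longrightarrow> g \<bullet> u \<le> (SUP u\<in>S. g \<bullet> u)"
proof -
  have ub: "g \<bullet> u \<le> norm g" if "u \<in> S" for g u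
    using norm_cauchy_schwarz[of g u] that assms(2) by auto
  have bdd: "bdd_above ((\<lambda>u. g \<bullet> u) ` S)" for g
    using ub by (intro bdd_aboveI2)
  show 1: "\<And>g u. u \<in> S \<Longrightarrow> g \<bullet> u \<le> (SUP u\<in>S. g \<bullet> u)"
    by (rule cSUP_upper[OF _ bdd])
  have le: "(SUP u\<in>S. g \<bullet> u) \<le> (SUP u\<in>S. h \<bullet> u) + norm (g - h)" for g h
  proof (rule cSUP_least[OF assms(1)])
    fix u assume "u \<in> S"
    then show "g \<bullet> u \<le> (SUP u\<in>S. h \<bullet> u) + norm (g - h)"
      using 1[of u h] ub[of u "g - h"] by (simp add: inner_diff_left)
  qed
  show "1-lipschitz_on UNIV (\<lambda>g. SUP u\<in>S. g \<bullet> u)"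
  proof (rule lipschitz_onI)
    show "dist (SUP u\<in>S. g \<bullet> u) (SUP u\<in>S. h \<bullet> u) \<le> 1 * dist g h" for g h
      using le[of g h] le[of h g] by (simp add: dist_norm norm_minus_commute abs_le_iff)
  qed simp
qed

text \<open>In the decoupled process \<open>norm v + g \<bullet> u\<close> the minimum is at least
  \<open>norm v\<close> minus the supremum of \<open>- g \<bullet> u\<close>, and \<open>- g\<close>
  has the law of \<open>g\<close>. Taking the supremum over \<open>S\<close> makes the width term
  independent of the net \<open>N\<close>.\<close>

lemma gordon_expectation:
  fixes N S :: "(real^'n) set" and \<beta> \<delta> :: real
  assumes N: "finite N" "N \<noteq> {}" "N \<subseteq> S" and S: "S \<subseteq> sphere 0 1" and \<beta>: "0 < \<beta>" and \<delta>: "0 < \<delta>"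
  shows "(\<integral>v. norm v \<partial>(gauss :: (real^'m) measure)) - (\<integral>g. (SUP u\<in>S. g \<bullet> u) \<partial>gauss) - ln (card N) / \<beta>
    \<le> (\<integral>A. softmin \<beta> N (\<lambda>u. norm (\<delta>, (A :: real^'n^'m) *v u)) \<partial>gauss)"
proof -
  define M where "M g = (SUP u\<in>S. g \<bullet> u)" for g :: "real^'n"
  have S0: "S \<noteq> {}" using N by auto
  note M = sup_inner_lipschitz[OF S0 S, folded M_def]
  define F where "F y = softmin \<beta> N (gordon_cost \<delta> ((0 :: (real^'n^'m) \<times> real), y))" for y
  have eq: "gordon_cost \<delta> ((0 :: (real^'n^'m) \<times> real), y) u = norm (\<delta>, fst y) + snd y \<bullet> u" for y u
    by (cases y) (simp add: gordon_cost_def zero_prod_def)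
  have F1: "norm (fst y) - M (- snd y) - ln (card N) / \<beta> \<le> F y" for y
    unfolding F_def
  proof (rule softmin_lower[OF N(1,2) \<beta>])
    fix u assume "u \<in> N"
    then have "- snd y \<bullet> u \<le> M (- snd y)" using M(2)[of u "- snd y"] N(3) by auto
    then show "norm (fst y) - M (- snd y) \<le> gordon_cost \<delta> ((0 :: (real^'n^'m) \<times> real), y) u"
      using norm_snd_le[of "fst y" \<delta>] unfolding eq by simp
  qed
  have iN: "integrable gauss (\<lambda>y :: (real^'m) \<times> (real^'n). norm (fst y))"
  proof (rule Bochner_Integration.integrable_bound[OF integrable_gauss_norm_power[of 1]])
    show "AE y in gauss. norm (norm (fst y)) \<le> norm (norm y ^ 1)"
      by (intro AE_I2) (simp, metis norm_fst_le prod.collapse)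
    show "(\<lambda>y :: (real^'m) \<times> (real^'n). norm (fst y)) \<in> borel_measurable gauss"
      using borel_measurable_continuous_onI[OF continuous_on_norm[OF continuous_on_fst[OF continuous_on_id]]]
      by (subst measurable_cong_sets[OF sets_gauss refl])
  qed
  have lipM: "1-lipschitz_on UNIV (\<lambda>y :: (real^'m) \<times> (real^'n). M (- snd y))"
  proof (rule lipschitz_onI)
    fix y z :: "(real^'m) \<times> (real^'n)"
    have "dist (M (- snd y)) (M (- snd z)) \<le> 1 * dist (- snd y) (- snd z)"
      by (rule lipschitz_onD[OF M(1)]) auto
    also have "\<dots> \<le> 1 * dist y z"
      using dist_snd_le[of y z] by (simp add: dist_minus)
    finally show "dist (M (- snd y)) (M (- snd z)) \<le> 1 * dist y z" .
  qed simp
  from integrable_gauss_lipschitz[OF this, of 0 1]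
  have iM: "integrable gauss (\<lambda>y :: (real^'m) \<times> (real^'n). M (- snd y))" by simp
  have FL: "4-lipschitz_on UNIV F"
  proof (rule lipschitz_onI)
    fix y z :: "(real^'m) \<times> (real^'n)"
    have "\<bar>F y - F z\<bar> \<le> 4 * norm (y - z)"
      unfolding F_def
    proof (rule softmin_taylor0[OF N(1,2) \<beta>])
      show "\<bar>gordon_cost \<delta> ((0 :: (real^'n^'m) \<times> real), y) u - gordon_cost \<delta> (0, z) u\<bar> \<le> 4 * norm (y - z)" if "u \<in> N" for u
        using gordon_cost_lipschitz[of u \<delta> "((0 :: (real^'n^'m) \<times> real), z)" "(0, y - z)"] that N(3) S
        by (auto simp: norm_Pair)
    qed
    then show "dist (F y) (F z) \<le> 4 * dist y z" by (simp add: dist_norm)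
  qed simp
  from integrable_gauss_lipschitz[OF this, of 0 1] have iF: "integrable gauss F" by simp
  have "(\<integral>y. norm (fst y) - M (- snd y) - ln (card N) / \<beta> \<partial>(gauss :: ((real^'m) \<times> (real^'n)) measure)) \<le> (\<integral>y. F y \<partial>gauss)"
    by (intro integral_mono iF F1 Bochner_Integration.integrable_diff iN iM) simp
  also have "(\<integral>y. norm (fst y) - M (- snd y) - ln (card N) / \<beta> \<partial>(gauss :: ((real^'m) \<times> (real^'n)) measure))
      = (\<integral>y. norm (fst y) \<partial>(gauss :: ((real^'m) \<times> (real^'n)) measure))
        - (\<integral>y. M (- snd y) \<partial>(gauss :: ((real^'m) \<times> (real^'n)) measure)) - ln (card N) / \<beta>"
    using iN iM by simp
  also have "(\<integral>y. norm (fst y) \<partial>(gauss :: ((real^'m) \<times> (real^'n)) measure)) = (\<integral>v. norm v \<partial>(gauss :: (real^'m) measure))"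
    using gauss_integral_pair(1)[OF iN] by simp
  also have "(\<integral>y. M (- snd y) \<partial>(gauss :: ((real^'m) \<times> (real^'n)) measure)) = (\<integral>g. M (- g) \<partial>gauss)"
    using gauss_integral_pair(1)[OF iM] by simp
  also have "(\<integral>g. M (- g) \<partial>gauss) = (\<integral>g. M g \<partial>gauss)"
    by (rule integral_gauss_image[OF distr_gauss_uminus _ lipschitz_on_borel_measurable[OF M(1)]]) simp
  finally have "(\<integral>v. norm v \<partial>(gauss :: (real^'m) measure)) - (\<integral>g. M g \<partial>gauss) - ln (card N) / \<beta> \<le> (\<integral>y. F y \<partial>gauss)" .
  also have "\<dots> \<le> (\<integral>A. softmin \<beta> N (\<lambda>u. norm (\<delta>, (A :: real^'n^'m) *v u)) \<partial>gauss)"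
    unfolding F_def using N S by (intro gordon_comparison \<beta> \<delta>) auto
  finally show ?thesis by (simp add: M_def)
qed

section \<open>Escape through a mesh\<close>

text \<open>Projection along a compact factor preserves closedness.\<close>

lemma closed_singular_compact:
  fixes K :: "(real^'n) set"
  assumes "compact K"
  shows "closed {A :: real^'n^'m. \<exists>u\<in>K. A *v u = 0}"
proof -
  have "closed {p :: (real^'n) \<times> (real^'n^'m). snd p *v fst p = 0}"
    unfolding matrix_vector_mult_def by (intro closed_Collect_eq continuous_intros)
  from closed_compact_projection[OF assms this] show ?thesis
    by (simp add: Bex_def)
qed

text \<open>An open set is a countable union of compact sets, so the event is a countable union of
  closed ones. The shape \<open>V \<inter> W\<close> fits a closure without 0 as well as a relative
  interior, which is open in the affine hull.\<close>

lemma singular_borel: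
  fixes V W :: "(real^'n) set"
  assumes "open V" "closed W"
  shows "{A :: real^'n^'m. \<exists>u\<in>V \<inter> W. A *v u = 0} \<in> sets borel"
proof -
  obtain C where C: "\<And>n::nat. compact (C n)" "(\<Union>n. C n) = V"
    using open_Union_compact_subsets[OF assms(1)] by metis
  have "{A :: real^'n^'m. \<exists>u\<in>V \<inter> W. A *v u = 0} = (\<Union>n. {A. \<exists>u\<in>C n \<inter> W. A *v u = 0})"
    using C(2) by auto
  also have "\<dots> \<in> sets borel"
    by (intro sets.countable_UN image_subsetI borel_closed closed_singular_compact compact_Int_closed C assms)
  finally show ?thesis .
qed

lemma singular_closure_borel:
  fixes U :: "(real^'n) set"
  shows "{A :: real^'n^'m. \<exists>u\<in>closure U - {0}. A *v u = 0} \<in> sets borel"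
  using singular_borel[OF open_Compl[OF closed_singleton] closed_closure, of 0 U]
  by (simp add: Diff_eq Int_commute)

text \<open>An exponential Markov inequality for the smoothed minimum over a net. The net is taken
  inside \<open>S\<close> but covers \<open>closure S\<close>, so the event may speak of the closure
  while the width is that of \<open>U\<close>.\<close>

theorem gauss_escape:
  fixes U :: "(real^'n) set"
  assumes cone: "\<And>c u. 0 < c \<Longrightarrow> u \<in> U \<Longrightarrow> c *\<^sub>R u \<in> U"
    and le: "gaussian_width U \<le> (\<integral>v. norm v \<partial>(gauss :: (real^'m) measure))"
  shows "measure gauss {A :: real^'n^'m. \<exists>u\<in>closure U - {0}. A *v u = 0}
    \<le> exp (- (((\<integral>v. norm v \<partial>(gauss :: (real^'m) measure)) - gaussian_width U)\<^sup>2 / 2))"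
proof -
  define S where "S = U \<inter> sphere 0 1"
  define E where "E = {A :: real^'n^'m. \<exists>u\<in>closure U - {0}. A *v u = 0}"
  have mE [measurable]: "E \<in> sets borel"
    unfolding E_def by (rule singular_closure_borel)
  have normalize: "\<exists>u\<in>closure S. A *v u = 0" if A: "A \<in> E" for A
  proof -
    obtain u where u: "u \<in> closure U" "u \<noteq> 0" "A *v u = 0"
      using A by (auto simp: E_def)
    \<comment> \<open>A nonzero limit can be approached by nonzero points of \<open>U\<close>, which
      can then be normalised.\<close>
    have "U \<subseteq> (U - {0}) \<union> {0}" by auto
    then have "closure U \<subseteq> closure (U - {0}) \<union> {0}"
      by (metis closure_Un closure_closed closed_singleton closure_mono)
    with u have "u \<in> closure (U - {0})" by auto
    then obtain x where x: "\<And>n::nat. x n \<in> U - {0}" "x \<longlonglongrightarrow> u"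
      by (auto simp: closure_sequential)
    have "sgn (x n) \<in> S" for n
      using cone[of "inverse (norm (x n))" "x n"] x(1)[of n] by (simp add: S_def sgn_div_norm norm_sgn)
    moreover have "(\<lambda>n. sgn (x n)) \<longlonglongrightarrow> sgn u"
      using x(2) u(2) by (rule tendsto_sgn)
    ultimately have "sgn u \<in> closure S"
      unfolding closure_sequential by (intro exI[of _ "\<lambda>n. sgn (x n)"] conjI allI)
    moreover have "A *v sgn u = 0"
      using u(3) by (simp add: sgn_div_norm matrix_vector_mult_scaleR)
    ultimately show ?thesis by blast
  qed
  define a where "a = (\<integral>v. norm v \<partial>(gauss :: (real^'m) measure))"
  \<comment> \<open>Up to \<open>e\<close>, this bounds the mean of \<open>H\<close> from below; it
    also is the exponential parameter \<open>r\<close> that minimises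
    \<open>- r * l + r\<^sup>2 / 2\<close>.\<close>
  define l where "l = a - gaussian_width U"
  have l: "0 \<le> l" using le by (simp add: l_def a_def)
  show ?thesis
  proof (cases "S = {}")
    case True
    then have "E = {}" using normalize by auto
    then show ?thesis unfolding E_def[symmetric] by simp
  next
    case False
    have width: "gaussian_width U = (\<integral>g. (SUP u\<in>S. g \<bullet> u) \<partial>gauss)"
      using False unfolding gaussian_width_def S_def std_gaussian_eq_gauss by simp
    have S: "S \<subseteq> sphere 0 1" by (auto simp: S_def)
    \<comment> \<open>\<open>3 * e\<close> collects \<open>2 * e\<close>, the bound for
      \<open>H\<close> on the event, and \<open>e\<close>, the loss
      \<open>ln (card N) / \<beta>\<close> in its mean. The ball bounds the error
      \<open>R * \<eta>\<close> of passing to the net.\<close>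
    have bound: "measure gauss (E \<inter> cball 0 R) \<le> exp (l * (3 * e) - l\<^sup>2 / 2)" if R: "0 \<le> R" and e: "0 < e" for R e :: real
    proof -
      define \<eta> where "\<eta> = e / (R + 1)"
      have \<eta>: "0 < \<eta>" "R * \<eta> \<le> e"
        using R e by (auto simp: \<eta>_def divide_simps algebra_simps)
      have cover: "closure S \<subseteq> (\<Union>s\<in>S. ball s \<eta>)"
        using \<eta>(1) by (force simp: closure_approachable)
      have "bounded S"
        using S bounded_subset[OF bounded_sphere] by blast
      then have "compact (closure S)"
        by (simp add: compact_closure)
      from compactE_image[OF this _ cover] obtain N where N: "N \<subseteq> S" "finite N" "closure S \<subseteq> (\<Union>s\<in>N. ball s \<eta>)"
        by (metis open_ball)
      have N0: "N \<noteq> {}"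
        using False N(3) closure_subset[of S] by auto
      then have cN: "1 \<le> real (card N)"
        using N(2) by (simp add: Suc_le_eq card_gt_0_iff)
      \<comment> \<open>The summand 1 keeps \<open>\<beta>\<close> positive when the net has a
        single point.\<close>
      define \<beta> where "\<beta> = (ln (card N) + 1) / e"
      have \<beta>: "0 < \<beta>" "ln (card N) / \<beta> \<le> e"
        using e ln_ge_zero[OF cN] by (auto simp: \<beta>_def divide_simps algebra_simps add_nonneg_pos)
      define H where "H A = softmin \<beta> N (\<lambda>u. norm (e, A *v u))" for A :: "real^'n^'m"
      have NS: "N \<subseteq> sphere 0 1" using N(1) S by auto
      note H = gordon_softmin_exp[OF N(2) N0 NS \<beta>(1) e l, where 'm='m, folded H_def]
      have EH: "l - e \<le> (\<integral>A. H A \<partial>gauss)"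
        using gordon_expectation[OF N(2) N0 N(1) S \<beta>(1) e, where 'm='m] \<beta>(2)
        unfolding H_def l_def a_def width by linarith
      have HE: "H A \<le> 2 * e" if A: "A \<in> E \<inter> cball 0 R" for A
      proof -
        obtain u where u: "u \<in> closure S" "A *v u = 0" using normalize A by auto
        then obtain s where s: "s \<in> N" "dist s u < \<eta>" using N(3) by auto
        have "norm (A *v s) = norm (A *v (s - u))"
          using u(2) by (simp add: matrix_vector_mult_diff_distrib)
        also have "\<dots> \<le> norm A * norm (s - u)" by (rule norm_matrix_vector_mult_le)
        also have "\<dots> \<le> R * \<eta>"
          using A s(2) R by (intro mult_mono) (auto simp: dist_norm)
        finally have "norm (A *v s) \<le> e" using \<eta>(2) by linarith
        moreover have "H A \<le> norm (e, A *v s)"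
          unfolding H_def by (rule softmin_upper[OF N(2) s(1) \<beta>(1)])
        moreover have "norm (e, A *v s) \<le> e + norm (A *v s)"
          using norm_Pair_le[of e "A *v s"] e by simp
        ultimately show ?thesis by linarith
      qed
      have "measure gauss (E \<inter> cball 0 R) = (\<integral>A. indicator (E \<inter> cball 0 R) A \<partial>gauss)"
        by simp
      also have "\<dots> \<le> (\<integral>A. exp (l * (2 * e)) * exp (- l * H A) \<partial>gauss)"
      proof (rule integral_mono)
        show "integrable gauss (indicator (E \<inter> cball 0 R) :: real^'n^'m \<Rightarrow> real)"
          using mE by (intro gauss.integrable_const_bound[where B=1] borel_measurable_indicator) auto
        show "integrable gauss (\<lambda>A. exp (l * (2 * e)) * exp (- l * H A))"
          using integrable_gauss_exp_lipschitz[OF H(2), of "- l" 0 1] by simp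
        show "indicator (E \<inter> cball 0 R) A \<le> exp (l * (2 * e)) * exp (- l * H A)" for A
        proof (cases "A \<in> E \<inter> cball 0 R")
          case True
          from HE[OF True] have "0 \<le> l * (2 * e) - l * H A"
            using l by (simp add: mult_left_mono)
          then show ?thesis using True by (simp add: mult_exp_exp)
        qed simp
      qed
      also have "\<dots> = exp (l * (2 * e)) * (\<integral>A. exp (- l * H A) \<partial>gauss)"
        by simp
      also have "\<dots> \<le> exp (l * (2 * e)) * exp (- l * (\<integral>A. H A \<partial>gauss) + l\<^sup>2 / 2)"
        by (intro mult_left_mono H(1)) simp
      also have "\<dots> \<le> exp (l * (3 * e) - l\<^sup>2 / 2)"
      proof -
        have "l * (l - e) \<le> l * (\<integral>A. H A \<partial>gauss)"
          by (intro mult_left_mono EH l)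
        then show ?thesis by (simp add: mult_exp_exp algebra_simps power2_eq_square)
      qed
      finally show ?thesis .
    qed
    have bound': "measure gauss (E \<inter> cball 0 R) \<le> exp (- (l\<^sup>2 / 2))" if R: "0 \<le> R" for R
    proof (rule tendsto_lowerbound)
      have "((\<lambda>e. exp (l * (3 * e) - l\<^sup>2 / 2)) \<longlongrightarrow> exp (l * (3 * 0) - l\<^sup>2 / 2)) (at_right 0)"
        by (intro tendsto_intros)
      then show "((\<lambda>e. exp (l * (3 * e) - l\<^sup>2 / 2)) \<longlongrightarrow> exp (- (l\<^sup>2 / 2))) (at_right 0)"
        by simp
      show "\<forall>\<^sub>F e in at_right 0. measure gauss (E \<inter> cball 0 R) \<le> exp (l * (3 * e) - l\<^sup>2 / 2)"
        using bound[OF R] by (auto simp: eventually_at_filter)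
    qed simp
    have "(\<lambda>n. measure gauss (E \<inter> cball 0 (real n))) \<longlonglongrightarrow> measure gauss (\<Union>n. E \<inter> cball 0 (real n))"
      by (rule gauss.finite_Lim_measure_incseq) (auto simp: incseq_def intro: order_trans)
    moreover have "(\<Union>n. E \<inter> cball 0 (real n)) = E"
      using real_arch_simple by (auto simp: dist_norm)
    ultimately have "measure gauss E \<le> exp (- (l\<^sup>2 / 2))"
      using bound' by (intro LIMSEQ_le_const2[where X="\<lambda>n. measure gauss (E \<inter> cball 0 (real n))"]) auto
    then show ?thesis by (simp add: E_def l_def a_def)
  qed
qed

section \<open>Null vectors on the boundary of a convex cone\<close>

text \<open>The density is positive everywhere. Negligibility is the form that can be transported by
  linear maps.\<close>

lemma null_sets_gauss_iff:
  fixes B :: "'a::euclidean_space set"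
  assumes "B \<in> sets borel"
  shows "B \<in> null_sets gauss \<longleftrightarrow> negligible B"
proof -
  have "0 < (\<Prod>b\<in>Basis. std_normal_density (x \<bullet> b))" for x :: 'a
    by (intro prod_pos) (simp add: normal_density_pos)
  then have "B \<in> null_sets gauss \<longleftrightarrow> (AE x in lborel. x \<in> B \<longrightarrow> False)"
    unfolding gauss_def using assms by (subst null_sets_density_iff) (auto simp: less_le)
  also have "\<dots> \<longleftrightarrow> B \<in> null_sets lborel"
    using assms by (subst AE_iff_null_sets) (auto simp: Compl_eq)
  also have "\<dots> \<longleftrightarrow> negligible B"
    using assms by (simp add: negligible_iff_null_sets null_sets_completion_iff)
  finally show ?thesis .
qed

text \<open>The linear maps \<open>A \<mapsto> A (I - c u\<^sub>0 v\<^sup>T)\<close>, for small \<open>c > 0\<close>, are invertible and preserve null sets.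
  A set met by every orbit \<open>c \<mapsto> A (I - c u\<^sub>0 v\<^sup>T)\<close> at most once is null by Fubini's theorem.\<close>

definition shear :: "real^'n \<Rightarrow> real^'n \<Rightarrow> real \<Rightarrow> real^'n^'m \<Rightarrow> real^'n^'m" where
  "shear u\<^sub>0 v c A = A - c *\<^sub>R outer (A *v u\<^sub>0) v"

lemma shear_mult_vec: "shear u\<^sub>0 v c A *v w = A *v (w - (c * (v \<bullet> w)) *\<^sub>R u\<^sub>0)"
  by (simp add: shear_def matrix_vector_mult_diff_rdistrib matrix_vector_mult_diff_distrib
      scaleR_matrix_vector_assoc[symmetric] outer_mult_vec matrix_vector_mult_scaleR)

lemma linear_shear: "linear (shear u\<^sub>0 v c)"
  by (intro linearI)
    (auto simp: shear_def outer_def vec_eq_iff matrix_vector_mult_add_rdistrib scaleR_matrix_vector_assoc[symmetric] algebra_simps)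

text \<open>Evaluation at \<open>u\<^sub>0\<close> multiplies \<open>A *v u\<^sub>0\<close> by
  \<open>1 - c * (v \<bullet> u\<^sub>0)\<close>, which is positive; so
  \<open>A *v u\<^sub>0\<close> vanishes for \<open>A\<close> in the kernel, and with it the
  correction term of the shear.\<close>

lemma inj_shear:
  assumes "c * (v \<bullet> u\<^sub>0) < 1"
  shows "inj (shear u\<^sub>0 v c :: real^'n^'m \<Rightarrow> _)"
proof (rule linear_injective_0[OF linear_shear, THEN iffD2], intro allI impI)
  fix A :: "real^'n^'m" assume A: "shear u\<^sub>0 v c A = 0"
  have "0 = shear u\<^sub>0 v c A *v u\<^sub>0" by (simp add: A)
  also have "\<dots> = (1 - c * (v \<bullet> u\<^sub>0)) *\<^sub>R (A *v u\<^sub>0)"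
    by (simp add: shear_mult_vec matrix_vector_mult_diff_distrib matrix_vector_mult_scaleR scaleR_left_diff_distrib)
  finally have "A *v u\<^sub>0 = 0" using assms by simp
  then show "A = 0" using A by (simp add: shear_def)
qed

lemma null_sets_gauss_orbit:
  fixes B :: "(real^'n^'m) set"
  assumes B: "B \<in> sets borel"
    and once: "\<And>A c c'. 0 < c \<Longrightarrow> c < c' \<Longrightarrow> c' * (v \<bullet> u\<^sub>0) < 1 \<Longrightarrow> shear u\<^sub>0 v c A \<in> B \<Longrightarrow> shear u\<^sub>0 v c' A \<in> B \<Longrightarrow> False"
  shows "B \<in> null_sets gauss"
proof -
  \<comment> \<open>For \<open>0 < c < d\<close> this forces
    \<open>c * (v \<bullet> u\<^sub>0) < 1\<close>, the range where shears are injective and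
    \<open>once\<close> applies.\<close>
  define d where "d = 1 / (\<bar>v \<bullet> u\<^sub>0\<bar> + 1)"
  have d: "0 < d" by (simp add: d_def)
  have small: "c * (v \<bullet> u\<^sub>0) < 1" if "0 < c" "c < d" for c
  proof -
    have "c * (v \<bullet> u\<^sub>0) \<le> c * \<bar>v \<bullet> u\<^sub>0\<bar>" using that by (intro mult_left_mono) auto
    also have "\<dots> < c * (\<bar>v \<bullet> u\<^sub>0\<bar> + 1)" using that by (intro mult_strict_left_mono) auto
    also have "\<dots> < d * (\<bar>v \<bullet> u\<^sub>0\<bar> + 1)" using that by (intro mult_strict_right_mono) auto
    also have "\<dots> = 1" by (simp add: d_def)
    finally show ?thesis .
  qed
  define P where "P A c \<longleftrightarrow> 0 < c \<and> c < d \<and> shear u\<^sub>0 v c A \<in> B" for A c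
  have "continuous_on UNIV (\<lambda>p :: (real^'n^'m) \<times> real. shear u\<^sub>0 v (snd p) (fst p))"
    unfolding shear_def outer_def matrix_vector_mult_def by (intro continuous_intros)
  then have m: "(\<lambda>p :: (real^'n^'m) \<times> real. shear u\<^sub>0 v (snd p) (fst p)) \<in> borel_measurable borel"
    by (rule borel_measurable_continuous_onI)
  have mP: "{p :: (real^'n^'m) \<times> real. \<not> P (fst p) (snd p)} \<in> sets borel"
  proof -
    have "{p :: (real^'n^'m) \<times> real. \<not> P (fst p) (snd p)}
      = - (snd -` {0<..<d} \<inter> (\<lambda>p. shear u\<^sub>0 v (snd p) (fst p)) -` B)"
      by (auto simp: P_def)
    moreover have "(\<lambda>p :: (real^'n^'m) \<times> real. shear u\<^sub>0 v (snd p) (fst p)) -` B \<in> sets borel"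
      using measurable_sets[OF m B] by simp
    moreover have "snd -` {0<..<d} \<in> sets (borel :: ((real^'n^'m) \<times> real) measure)"
      by (intro borel_open open_vimage_snd) simp
    ultimately show ?thesis by (simp only: borel_comp sets.Int)
  qed
  interpret pair_sigma_finite "gauss :: (real^'n^'m) measure" "lborel :: real measure"
    by unfold_locales
  have "AE A in gauss. AE c in lborel. \<not> P A c"
  proof (rule AE_I2)
    fix A :: "real^'n^'m"
    have "c = c'" if "P A c" "P A c'" for c c'
      using that once[of c c' A] once[of c' c A] small[of c] small[of c']
      unfolding P_def by (cases c c' rule: linorder_cases) auto
    then obtain c0 where "\<And>c. P A c \<Longrightarrow> c = c0" by metis
    with AE_lborel_singleton[of c0] show "AE c in lborel. \<not> P A c"
      by (auto elim: eventually_mono)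
  qed
  \<comment> \<open>Every orbit has at most one bad parameter, hence almost every parameter has a
    null set of bad matrices. One such \<open>c\<close> inside \<open>{0<..<d}\<close> suffices: its
    shear maps the null set \<open>B'\<close> onto \<open>B\<close>.\<close>
  then have "AE c in lborel. AE A in gauss. \<not> P A c"
    using mP by (subst AE_commute[symmetric]) (simp_all add: borel_prod[symmetric] space_pair_measure cong: sets_pair_measure_cong)
  moreover have "\<not> (AE c in lborel. c \<notin> {0<..<d})"
    using d by (subst AE_iff_null_sets[symmetric]) (auto simp: null_sets_def)
  ultimately have "\<exists>c. c \<in> {0<..<d} \<and> (AE A in gauss. \<not> P A c)"
    using eventually_mono[of "\<lambda>c. AE A in gauss. \<not> P A c" "ae_filter lborel" "\<lambda>c. c \<notin> {0<..<d}"] by blast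
  then obtain c where c: "0 < c" "c < d" "AE A in gauss. \<not> P A c"
    by auto
  define B' where "B' = {A :: real^'n^'m. shear u\<^sub>0 v c A \<in> B}"
  have "shear u\<^sub>0 v c \<in> borel_measurable (borel :: (real^'n^'m) measure)"
    using linear_continuous_on[OF linear_conv_bounded_linear[THEN iffD1, OF linear_shear]]
    by (rule borel_measurable_continuous_onI)
  then have B': "B' \<in> sets borel"
    using B measurable_sets by (fastforce simp: B'_def vimage_def)
  have "B' \<in> null_sets gauss"
    using c B' by (subst AE_iff_null_sets) (auto simp: P_def B'_def)
  then have "negligible (shear u\<^sub>0 v c ` B')"
    using B' linear_shear
    by (intro negligible_differentiable_image_negligible linear_imp_differentiable_on) (auto simp: null_sets_gauss_iff)
  moreover have "shear u\<^sub>0 v c ` B' = B"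
  proof -
    have "B' = shear u\<^sub>0 v c -` B" by (auto simp: B'_def)
    moreover have "surj (shear u\<^sub>0 v c :: real^'n^'m \<Rightarrow> _)"
      by (rule linear_injective_imp_surjective[OF linear_shear inj_shear[OF small[OF c(1,2)]] refl])
    ultimately show ?thesis
      by (simp only: image_vimage_eq Int_UNIV_right)
  qed
  ultimately show ?thesis using B by (simp add: null_sets_gauss_iff)
qed

text \<open>The point is \<open>1 + t\<close> times a convex combination of \<open>u\<close> and
  \<open>u\<^sub>0\<close> with positive weight \<open>t / (1 + t)\<close> on
  \<open>u\<^sub>0\<close>. Such a combination is in the relative interior, which inherits the
  invariance of \<open>U\<close> under positive scaling.\<close>

lemma cone_rel_interior_add:
  fixes U :: "'a::euclidean_space set"
  assumes "convex U" and cone: "\<And>c u. 0 < c \<Longrightarrow> u \<in> U \<Longrightarrow> c *\<^sub>R u \<in> U"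
    and "u\<^sub>0 \<in> rel_interior U" "u \<in> closure U" "0 < t"
  shows "u + t *\<^sub>R u\<^sub>0 \<in> rel_interior U"
proof -
  define e where "e = t / (1 + t)"
  have e: "0 < e" "e < 1" using assms(5) by (auto simp: e_def)
  have r: "u - e *\<^sub>R (u - u\<^sub>0) \<in> rel_interior U"
    using rel_interior_closure_convex_shrink[OF assms(1,3,4)] e by simp
  have img: "(\<lambda>x. (1 + t) *\<^sub>R x) ` U = U"
  proof
    show "(\<lambda>x. (1 + t) *\<^sub>R x) ` U \<subseteq> U" using cone assms(5) by auto
    show "U \<subseteq> (\<lambda>x. (1 + t) *\<^sub>R x) ` U"
    proof
      fix x assume "x \<in> U"
      then have "inverse (1 + t) *\<^sub>R x \<in> U" using cone assms(5) by simp
      then show "x \<in> (\<lambda>x. (1 + t) *\<^sub>R x) ` U" using assms(5) by (intro image_eqI) auto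
    qed
  qed
  have "(1 + t) *\<^sub>R (u - e *\<^sub>R (u - u\<^sub>0)) \<in> rel_interior U"
    using r rel_interior_scaleR[of "1 + t" U] assms(5) unfolding img by auto
  moreover have "(1 + t) *\<^sub>R (u - e *\<^sub>R (u - u\<^sub>0)) = u + t *\<^sub>R u\<^sub>0"
  proof -
    have "(1 + t) * e = t" using assms(5) by (simp add: e_def)
    then show ?thesis by (simp add: scaleR_right_diff_distrib algebra_simps)
  qed
  ultimately show ?thesis by simp
qed

text \<open>If \<open>A\<close> kills a nonzero \<open>u\<close> in the closure of \<open>U\<close>, then moving along the orbit of a shear with
  \<open>v \<bullet> u > 0\<close> moves the null vector into the relative interior.\<close>

lemma null_sets_singular_boundary:
  fixes U :: "(real^'n) set"
  assumes "convex U" and cone: "\<And>c u. 0 < c \<Longrightarrow> u \<in> U \<Longrightarrow> c *\<^sub>R u \<in> U"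
  shows "{A :: real^'n^'m. \<exists>u\<in>closure U - {0}. A *v u = 0} - {A. \<exists>u\<in>rel_interior U - {0}. A *v u = 0} \<in> null_sets gauss"
proof (cases "U = {} \<or> 0 \<in> rel_interior U")
  case True
  \<comment> \<open>If 0 is a relative interior point, adding it moves every point of the closure
    into the relative interior without changing it, so no boundary is left.\<close>
  have "closure U - {0} \<subseteq> rel_interior U - {0}"
  proof (cases "U = {}")
    case False
    then have "0 \<in> rel_interior U" using True by simp
    from cone_rel_interior_add[OF assms this _ zero_less_one] show ?thesis by auto
  qed simp
  then have "{A :: real^'n^'m. \<exists>u\<in>closure U - {0}. A *v u = 0} - {A. \<exists>u\<in>rel_interior U - {0}. A *v u = 0} = {}"
    by blast
  then show ?thesis by (simp only: null_sets.empty_sets)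
next
  case False
  then obtain u\<^sub>0 where u\<^sub>0: "u\<^sub>0 \<in> rel_interior U"
    using rel_interior_eq_empty[OF assms(1)] by auto
  have nz: "0 \<notin> rel_interior U" using False by simp
  define R where "R = {A :: real^'n^'m. \<exists>u\<in>rel_interior U - {0}. A *v u = 0}"
  have R: "R \<in> sets borel"
  proof -
    obtain V where V: "open V" "rel_interior U = V \<inter> affine hull U"
      using openin_rel_interior[of U] by (auto simp: openin_open Int_commute)
    have "closed (affine hull U)" by (rule closed_affine_hull)
    from singular_borel[OF open_delete[OF V(1)] this, of 0] show ?thesis
      unfolding R_def V(2) by (simp add: Int_Diff Diff_Int_distrib2 Diff_eq Int_ac)
  qed
  \<comment> \<open>The half-space fixes the sign of the displacement caused by the shear; the
    half-spaces of the signed coordinate axes cover all nonzero \<open>u\<close>.\<close>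
  define B where "B v = {A :: real^'n^'m. \<exists>u\<in>{u. 0 < v \<bullet> u} \<inter> closure U. A *v u = 0} - R" for v
  have "B v \<in> null_sets gauss" for v
  proof (rule null_sets_gauss_orbit)
    show "B v \<in> sets borel"
      unfolding B_def by (intro sets.Diff R singular_borel open_halfspace_gt closed_closure)
    fix A :: "real^'n^'m" and c c' :: real
    assume c: "0 < c" "c < c'" "c' * (v \<bullet> u\<^sub>0) < 1" and A: "shear u\<^sub>0 v c A \<in> B v" "shear u\<^sub>0 v c' A \<in> B v"
    obtain u where u: "0 < v \<bullet> u" "u \<in> closure U" "A *v (u - (c * (v \<bullet> u)) *\<^sub>R u\<^sub>0) = 0"
      using A(1) by (auto simp: B_def shear_mult_vec)
    \<comment> \<open>Chosen so that \<open>u + t *\<^sub>R u\<^sub>0\<close> is displaced at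
      parameter \<open>c'\<close> to the same vector as \<open>u\<close> at parameter
      \<open>c\<close>, a vector killed by \<open>A\<close>.\<close>
    define t where "t = (c' - c) * (v \<bullet> u) / (1 - c' * (v \<bullet> u\<^sub>0))"
    have t: "0 < t" using c u(1) by (simp add: t_def)
    have "t * (1 - c' * (v \<bullet> u\<^sub>0)) = (c' - c) * (v \<bullet> u)" using c(3) by (simp add: t_def)
    then have "t - c' * (v \<bullet> (u + t *\<^sub>R u\<^sub>0)) = - (c * (v \<bullet> u))"
      by (simp add: inner_add_right algebra_simps)
    moreover have "(u + t *\<^sub>R u\<^sub>0) - (c' * (v \<bullet> (u + t *\<^sub>R u\<^sub>0))) *\<^sub>R u\<^sub>0 = u + (t - c' * (v \<bullet> (u + t *\<^sub>R u\<^sub>0))) *\<^sub>R u\<^sub>0"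
      by (simp add: scaleR_left_diff_distrib)
    ultimately have "(u + t *\<^sub>R u\<^sub>0) - (c' * (v \<bullet> (u + t *\<^sub>R u\<^sub>0))) *\<^sub>R u\<^sub>0 = u - (c * (v \<bullet> u)) *\<^sub>R u\<^sub>0"
      by simp
    then have "shear u\<^sub>0 v c' A *v (u + t *\<^sub>R u\<^sub>0) = 0"
      using u(3) by (simp only: shear_mult_vec)
    moreover have "u + t *\<^sub>R u\<^sub>0 \<in> rel_interior U"
      by (rule cone_rel_interior_add[OF assms u\<^sub>0 u(2) t])
    ultimately have "shear u\<^sub>0 v c' A \<in> R"
      using nz unfolding R_def by (metis (mono_tags, lifting) Diff_iff mem_Collect_eq singletonD)
    with A(2) show False by (simp add: B_def)
  qed
  then have "(\<Union>k. B (axis k 1)) \<union> (\<Union>k. B (axis k (- 1))) \<in> null_sets gauss"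
    by (intro null_sets.Un null_sets.finite_UN) auto
  then show ?thesis
  proof (rule null_sets_subset)
    show "{A :: real^'n^'m. \<exists>u\<in>closure U - {0}. A *v u = 0} - {A. \<exists>u\<in>rel_interior U - {0}. A *v u = 0} \<in> sets gauss"
      using sets.Diff[OF singular_closure_borel[of U] R] by (simp add: R_def)
    show "{A :: real^'n^'m. \<exists>u\<in>closure U - {0}. A *v u = 0} - {A. \<exists>u\<in>rel_interior U - {0}. A *v u = 0}
        \<subseteq> (\<Union>k. B (axis k 1)) \<union> (\<Union>k. B (axis k (- 1)))"
    proof
      fix A :: "real^'n^'m"
      assume A: "A \<in> {A. \<exists>u\<in>closure U - {0}. A *v u = 0} - {A. \<exists>u\<in>rel_interior U - {0}. A *v u = 0}"
      then obtain u where u: "u \<in> closure U" "u \<noteq> 0" "A *v u = 0" by auto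
      then obtain k where "u $ k \<noteq> 0" by (auto simp: vec_eq_iff)
      then consider "0 < axis k 1 \<bullet> u" | "0 < axis k (- 1) \<bullet> u"
        by (auto simp: inner_axis' neq_iff)
      then show "A \<in> (\<Union>k. B (axis k 1)) \<union> (\<Union>k. B (axis k (- 1)))"
        using A u unfolding B_def R_def by cases blast+
    qed
  qed
qed

section \<open>The event in the probability space\<close>

lemma distr_iid_std_normal_entries:
  fixes A :: "'w \<Rightarrow> real^'n^'m"
  assumes "prob_space \<Omega>" and iid: "iid_std_normal_entries \<Omega> A"
  shows "A \<in> borel_measurable \<Omega>" and "distr \<Omega> borel A = gauss"
proof -
  define e :: "'m \<times> 'n \<Rightarrow> real^'n^'m" where "e = (\<lambda>(i, j). axis i (axis j 1))"
  have Ae: "A w \<bullet> e p = A w $ fst p $ snd p" for w p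
    by (simp add: e_def split_beta inner_axis)
  have e: "bij_betw e UNIV Basis"
    unfolding bij_betw_def
  proof
    show "inj e"
      by (auto simp: inj_def e_def axis_eq_axis)
    show "range e = Basis"
    proof (intro equalityI subsetI)
      show "b \<in> Basis" if "b \<in> range e" for b
        using that unfolding e_def Basis_vec_def by auto
      show "b \<in> range e" if b: "b \<in> Basis" for b
      proof -
        obtain i u where u: "u \<in> Basis" "b = axis i u"
          using b unfolding Basis_vec_def by blast
        obtain j where "u = axis j 1"
          using u(1) unfolding Basis_vec_def by auto
        with u(2) have "b = e (i, j)"
          by (simp add: e_def)
        then show ?thesis by (rule range_eqI)
      qed
    qed
  qed
  have dist: "distributed \<Omega> lborel (\<lambda>w. A w \<bullet> e p) std_normal_density" for p
    using iid unfolding Ae iid_std_normal_entries_def by blast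
  have coord: "(\<lambda>w. A w \<bullet> e p) \<in> borel_measurable \<Omega>" for p
    using distributed_measurable[OF dist[of p]] by simp
  show m: "A \<in> borel_measurable \<Omega>"
  proof (rule borel_measurable_euclidean_space[where f=A, THEN iffD2], rule ballI)
    fix b :: "real^'n^'m" assume "b \<in> Basis"
    then have "b \<in> range e" using e by (simp add: bij_betw_def)
    then show "(\<lambda>w. A w \<bullet> b) \<in> borel_measurable \<Omega>"
      using coord by (elim imageE) simp
  qed
  have "prob_space.indep_vars \<Omega> (\<lambda>_. borel) (\<lambda>p w. A w \<bullet> e p) UNIV"
    using iid unfolding Ae iid_std_normal_entries_def by (simp add: case_prod_unfold)
  then show "distr \<Omega> borel A = gauss"
    by (rule distr_eq_gauss[OF assms(1) m e]) (rule dist)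
qed

lemma convex_cone_singular_event:
  fixes A :: "'w \<Rightarrow> real^'n^'m" and U :: "(real^'n) set"
  assumes \<Omega>: "prob_space \<Omega>" and iid: "iid_std_normal_entries \<Omega> A"
    and U: "convex U" and cone: "\<And>c u. 0 < c \<Longrightarrow> u \<in> U \<Longrightarrow> c *\<^sub>R u \<in> U"
  defines "F \<equiv> {w \<in> space \<Omega>. \<exists>u\<in>U - {0}. A w *v u = 0}"
  shows "F \<in> sets (completion \<Omega>)"
    and "gaussian_width U \<le> (\<integral>v. norm v \<partial>(gauss :: (real^'m) measure)) \<Longrightarrow>
      measure (completion \<Omega>) F \<le> exp (- (((\<integral>v. norm v \<partial>(gauss :: (real^'m) measure)) - gaussian_width U)\<^sup>2 / 2))"
proof -
  interpret prob_space \<Omega> by fact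
  interpret completion: prob_space "completion \<Omega>" by (rule prob_space_completion)
  note A [measurable] = distr_iid_std_normal_entries(1)[OF \<Omega> iid]
  define E where "E = {A :: real^'n^'m. \<exists>u\<in>closure U - {0}. A *v u = 0}"
  define R where "R = {A :: real^'n^'m. \<exists>u\<in>rel_interior U - {0}. A *v u = 0}"
  have E: "E \<in> sets borel" unfolding E_def by (rule singular_closure_borel)
  have N: "E - R \<in> null_sets gauss"
    unfolding E_def R_def by (rule null_sets_singular_boundary[OF U cone])
  then have ER: "E - R \<in> sets borel" by auto
  have mono: "\<exists>u\<in>V' - {0}. B *v u = 0" if "\<exists>u\<in>V - {0}. B *v u = 0" "V \<subseteq> V'"
    for B :: "real^'n^'m" and V V'
    using that by blast
  have FE: "F \<subseteq> A -` E \<inter> space \<Omega>"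
  proof
    fix w assume "w \<in> F"
    then have "w \<in> space \<Omega>" "\<exists>u\<in>U - {0}. A w *v u = 0"
      unfolding F_def mem_Collect_eq by iprover+
    with mono[OF this(2) closure_subset] show "w \<in> A -` E \<inter> space \<Omega>"
      by (simp only: E_def vimage_eq Int_iff mem_Collect_eq)
  qed
  have RF: "A -` R \<inter> space \<Omega> \<subseteq> F"
  proof
    fix w assume "w \<in> A -` R \<inter> space \<Omega>"
    then have "w \<in> space \<Omega>" "\<exists>u\<in>rel_interior U - {0}. A w *v u = 0"
      unfolding R_def vimage_eq Int_iff mem_Collect_eq by iprover+
    with mono[OF this(2) rel_interior_subset] show "w \<in> F"
      by (simp only: F_def mem_Collect_eq)
  qed
  have null: "A -` (E - R) \<inter> space \<Omega> \<in> null_sets \<Omega>"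
  proof (rule null_setsI)
    show "emeasure \<Omega> (A -` (E - R) \<inter> space \<Omega>) = 0"
      using N emeasure_distr[OF A ER]
      unfolding distr_iid_std_normal_entries(2)[OF \<Omega> iid] null_sets_def by simp
  qed (rule measurable_sets[OF A ER])
  have mE: "A -` E \<inter> space \<Omega> \<in> sets \<Omega>" by (rule measurable_sets[OF A E])
  \<comment> \<open>What \<open>F\<close> misses of the closure event is contained in a null set,
    hence measurable in the completion; so is \<open>F\<close>, as a difference.\<close>
  have "A -` E \<inter> space \<Omega> - F \<in> sets (completion \<Omega>)"
    by (rule null_sets_completion[OF null]) (use RF in blast)
  then have D: "(A -` E \<inter> space \<Omega>) - (A -` E \<inter> space \<Omega> - F) \<in> sets (completion \<Omega>)"
    by (rule sets.Diff[rotated]) (rule sets_completionI_sets[OF mE])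
  have eq: "(A -` E \<inter> space \<Omega>) - (A -` E \<inter> space \<Omega> - F) = F"
    using FE by blast
  show F: "F \<in> sets (completion \<Omega>)" using D unfolding eq .
  assume w: "gaussian_width U \<le> (\<integral>v. norm v \<partial>(gauss :: (real^'m) measure))"
  have "measure (completion \<Omega>) F \<le> measure (completion \<Omega>) (A -` E \<inter> space \<Omega>)"
    using mE by (intro completion.finite_measure_mono FE) auto
  also have "\<dots> = measure \<Omega> (A -` E \<inter> space \<Omega>)"
    using mE by simp
  also have "\<dots> = measure gauss E"
    using measure_distr[OF A E] unfolding distr_iid_std_normal_entries(2)[OF \<Omega> iid] by (rule sym)
  also have "\<dots> \<le> exp (- (((\<integral>v. norm v \<partial>(gauss :: (real^'m) measure)) - gaussian_width U)\<^sup>2 / 2))"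
    unfolding E_def by (rule gauss_escape[OF cone w])
  finally show "measure (completion \<Omega>) F \<le> exp (- (((\<integral>v. norm v \<partial>(gauss :: (real^'m) measure)) - gaussian_width U)\<^sup>2 / 2))" .
qed

section \<open>Convexity and scaling of the cones in the theorem\<close>

lemma l1_norm_triangle: "l1_norm (x + y) \<le> l1_norm x + l1_norm y"
  unfolding l1_norm_def sum.distrib[symmetric] by (intro sum_mono) (simp add: abs_triangle_ineq)

lemma l1_norm_scaleR: "l1_norm (c *\<^sub>R x) = \<bar>c\<bar> * l1_norm x"
  by (simp add: l1_norm_def abs_mult sum_distrib_left)

lemma l1_tangent_cone_scaleR:
  assumes "0 < c" "u \<in> l1_tangent_cone x"
  shows "c *\<^sub>R u \<in> l1_tangent_cone x"
proof -
  obtain t where "0 < t" "l1_norm (x + t *\<^sub>R u) \<le> l1_norm x"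
    using assms(2) by (auto simp: l1_tangent_cone_def)
  then show ?thesis
    unfolding l1_tangent_cone_def using assms(1) by (auto intro!: exI[of _ "t / c"])
qed

text \<open>By convexity of the norm, every step shorter than an admissible one is admissible. Two
  directions therefore share the step \<open>r = min s t\<close>, for which the claim is convexity
  of a sublevel set.\<close>

lemma convex_l1_tangent_cone:
  fixes x :: "real^'n"
  shows "convex (l1_tangent_cone x)"
proof (rule convexI)
  fix u v :: "real^'n" and a b :: real
  assume u: "u \<in> l1_tangent_cone x" and v: "v \<in> l1_tangent_cone x" and ab: "0 \<le> a" "0 \<le> b" "a + b = 1"
  have shrink: "l1_norm (x + r *\<^sub>R w) \<le> l1_norm x" if "0 < r" "r \<le> t" "l1_norm (x + t *\<^sub>R w) \<le> l1_norm x" for r t w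
  proof -
    define q where "q = r / t"
    have q: "0 \<le> q" "q \<le> 1" "q * t = r" using that by (auto simp: q_def)
    have "x + r *\<^sub>R w = (1 - q) *\<^sub>R x + q *\<^sub>R (x + t *\<^sub>R w)"
      by (simp add: q(3)[symmetric] algebra_simps)
    then have "l1_norm (x + r *\<^sub>R w) \<le> l1_norm ((1 - q) *\<^sub>R x) + l1_norm (q *\<^sub>R (x + t *\<^sub>R w))"
      by (metis l1_norm_triangle)
    also have "\<dots> = (1 - q) * l1_norm x + q * l1_norm (x + t *\<^sub>R w)"
      using q by (simp add: l1_norm_scaleR)
    also have "\<dots> \<le> (1 - q) * l1_norm x + q * l1_norm x"
      using q that by (intro add_left_mono mult_left_mono) auto
    finally show ?thesis by (simp add: algebra_simps)
  qed
  obtain s where s: "0 < s" "l1_norm (x + s *\<^sub>R u) \<le> l1_norm x" using u by (auto simp: l1_tangent_cone_def)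
  obtain t where t: "0 < t" "l1_norm (x + t *\<^sub>R v) \<le> l1_norm x" using v by (auto simp: l1_tangent_cone_def)
  define r where "r = min s t"
  have r: "0 < r" "l1_norm (x + r *\<^sub>R u) \<le> l1_norm x" "l1_norm (x + r *\<^sub>R v) \<le> l1_norm x"
    using s t shrink[of r s u] shrink[of r t v] by (auto simp: r_def)
  have "x + r *\<^sub>R (a *\<^sub>R u + b *\<^sub>R v) = a *\<^sub>R (x + r *\<^sub>R u) + b *\<^sub>R (x + r *\<^sub>R v)"
  proof -
    have "a *\<^sub>R x + b *\<^sub>R x = x"
      unfolding scaleR_left_distrib[symmetric] ab(3) by simp
    then have "x + r *\<^sub>R (a *\<^sub>R u + b *\<^sub>R v) = (a *\<^sub>R x + b *\<^sub>R x) + r *\<^sub>R (a *\<^sub>R u + b *\<^sub>R v)"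
      by (simp only:)
    also have "\<dots> = a *\<^sub>R (x + r *\<^sub>R u) + b *\<^sub>R (x + r *\<^sub>R v)"
      by (simp add: scaleR_add_right mult.commute)
    finally show ?thesis .
  qed
  then have "l1_norm (x + r *\<^sub>R (a *\<^sub>R u + b *\<^sub>R v)) \<le> l1_norm (a *\<^sub>R (x + r *\<^sub>R u)) + l1_norm (b *\<^sub>R (x + r *\<^sub>R v))"
    by (metis l1_norm_triangle)
  also have "\<dots> = a * l1_norm (x + r *\<^sub>R u) + b * l1_norm (x + r *\<^sub>R v)"
    using ab by (simp add: l1_norm_scaleR)
  also have "\<dots> \<le> a * l1_norm x + b * l1_norm x"
    using ab r by (intro add_mono mult_left_mono) auto
  also have "\<dots> = l1_norm x" unfolding distrib_right[symmetric] ab(3) by simp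
  finally show "a *\<^sub>R u + b *\<^sub>R v \<in> l1_tangent_cone x"
    using r(1) by (auto simp: l1_tangent_cone_def)
qed

lemma difference_coneI: "0 < t \<Longrightarrow> y \<in> C \<Longrightarrow> z \<in> D \<Longrightarrow> t *\<^sub>R (y - z) \<in> difference_cone C D"
  by (auto simp: difference_cone_def)

lemma difference_cone_scaleR:
  assumes "0 < c" "u \<in> difference_cone C D"
  shows "c *\<^sub>R u \<in> difference_cone C D"
proof -
  obtain t y z where "0 < t" "y \<in> C" "z \<in> D" "u = t *\<^sub>R (y - z)"
    using assms(2) by (auto simp: difference_cone_def)
  then show ?thesis
    unfolding difference_cone_def using assms(1) by (auto intro!: exI[of _ "c * t"])
qed

text \<open>For \<open>s *\<^sub>R (y - z)\<close> and \<open>t *\<^sub>R (y' - z')\<close> the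
  common scale is \<open>r = a * s + b * t\<close>; the weights \<open>a * s / r\<close> and
  \<open>b * t / r\<close> then form the same convex combination in \<open>C\<close> and in
  \<open>D\<close>.\<close>

lemma convex_difference_cone:
  fixes C D :: "(real^'n) set"
  assumes "convex C" "convex D"
  shows "convex (difference_cone C D)"
proof (rule convexI)
  fix u v :: "real^'n" and a b :: real
  assume u: "u \<in> difference_cone C D" and v: "v \<in> difference_cone C D" and ab: "0 \<le> a" "0 \<le> b" "a + b = 1"
  obtain s y z where s: "0 < s" "y \<in> C" "z \<in> D" "u = s *\<^sub>R (y - z)"
    using u by (auto simp: difference_cone_def)
  obtain t y' z' where t: "0 < t" "y' \<in> C" "z' \<in> D" "v = t *\<^sub>R (y' - z')"
    using v by (auto simp: difference_cone_def)
  define r where "r = a * s + b * t"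
  have r: "0 < r"
    using ab s(1) t(1) unfolding r_def
    by (cases "a = 0") (auto intro: add_pos_nonneg)
  have w: "0 \<le> a * s / r" "0 \<le> b * t / r" "a * s / r + b * t / r = 1"
    using ab s(1) t(1) r by (auto simp: r_def add_divide_distrib[symmetric])
  have mem: "(a * s / r) *\<^sub>R y + (b * t / r) *\<^sub>R y' \<in> C" "(a * s / r) *\<^sub>R z + (b * t / r) *\<^sub>R z' \<in> D"
    using convexD[OF assms(1) s(2) t(2) w] convexD[OF assms(2) s(3) t(3) w] by auto
  have eq: "a *\<^sub>R u + b *\<^sub>R v = r *\<^sub>R (((a * s / r) *\<^sub>R y + (b * t / r) *\<^sub>R y') - ((a * s / r) *\<^sub>R z + (b * t / r) *\<^sub>R z'))"
    using r by (simp add: s(4) t(4) scaleR_right_diff_distrib scaleR_add_right)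
  show "a *\<^sub>R u + b *\<^sub>R v \<in> difference_cone C D"
    unfolding eq by (rule difference_coneI[OF r mem])
qed

lemma difference_cone_uminus:
  assumes "u \<in> difference_cone C D"
  shows "- u \<in> difference_cone D C"
proof -
  obtain t y z where t: "0 < t" "y \<in> C" "z \<in> D" "u = t *\<^sub>R (y - z)"
    using assms by (auto simp: difference_cone_def)
  have "- u = t *\<^sub>R (z - y)"
    by (simp add: t(4) scaleR_right_diff_distrib)
  then show ?thesis
    using difference_coneI[OF t(1,3,2)] by (simp only:)
qed


theorem theorem1:
  fixes \<Omega> :: "'w measure"
    and A :: "'w \<Rightarrow> real ^ 'n ^ 'm"
    and C :: "nat \<Rightarrow> (real ^ 'n) set"
    and L K :: nat
    and x :: "real ^ 'n"
    and \<epsilon> a\<^sub>M P\<^sub>1 P\<^sub>2 :: real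
    and T :: "(real ^ 'n) set"
    and Ct :: "nat \<Rightarrow> nat \<Rightarrow> (real ^ 'n) set"
  assumes "prob_space \<Omega>"
    and "iid_std_normal_entries \<Omega> A"
    and "\<And>i. i \<in> {1..L} \<Longrightarrow> convex (C i)"
    and "x \<in> (\<Union>i\<in>{1..L}. C i)"
    and "sparse K x"
    and T_def: "T = l1_tangent_cone x"
    and Ct_def: "\<And>i j. Ct i j = difference_cone (C i) (C j)"
    and aM_def: "a\<^sub>M = (LINT g|(std_gaussian :: (real ^ 'm) measure). norm g)"
    and "\<epsilon> > 0"
    and "a\<^sub>M \<ge> gaussian_width T"
    and "\<And>i j. i \<in> {1..L} \<Longrightarrow> j \<in> {1..L} \<Longrightarrow> (1 - 2 * \<epsilon>) * a\<^sub>M \<ge> gaussian_width (Ct i j)"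
    and P1_def: "P\<^sub>1 = Pr \<Omega> (\<lambda>w. \<not> min_norm_pos (A w) T)"
    and P2_def: "P\<^sub>2 = Pr \<Omega> (\<lambda>w. \<not> min_norm_pos (A w) (\<Union>i\<in>{1..L}. \<Union>j\<in>{1..L}. Ct i j))"
  shows "Pr \<Omega> (\<lambda>w. (\<Union>i\<in>{1..L}. \<Union>j\<in>{1..L}. null_space (A w) \<inter> T \<inter> Ct i j) = {0})
           \<ge> 1 - min P\<^sub>1 P\<^sub>2
         \<and> P\<^sub>1 \<le> min 1 (exp (- ((a\<^sub>M - gaussian_width T)\<^sup>2 / 2)))
         \<and> P\<^sub>2 \<le> min 1 (3 / 2 * exp (- (\<epsilon>\<^sup>2 * a\<^sub>M\<^sup>2 / 2))
             + (\<Sum>j\<in>{1..L}. \<Sum>i\<in>{1..j}. exp (- (((1 - 2 * \<epsilon>) * a\<^sub>M - gaussian_width (Ct i j))\<^sup>2 / 2))))"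
proof -
  interpret prob_space \<Omega> by fact
  interpret completion: prob_space "completion \<Omega>" by (rule prob_space_completion)
  \<comment> \<open>\<open>F\<close> commutes with unions, so measurability and bounds for the
    nonconvex union of cones follow from those for its convex pieces.\<close>
  define F where "F U = {w \<in> space \<Omega>. \<exists>u\<in>U - {0}. A w *v u = 0}" for U
  have aM: "(\<integral>v. norm v \<partial>(gauss :: (real^'m) measure)) = a\<^sub>M"
    by (simp add: aM_def std_gaussian_eq_gauss)
  have aM0: "0 \<le> a\<^sub>M" unfolding aM[symmetric] by simp
  note event = convex_cone_singular_event[OF \<open>prob_space \<Omega>\<close> \<open>iid_std_normal_entries \<Omega> A\<close>, folded F_def, unfolded aM]
  have T: "convex T" "\<And>c u. 0 < c \<Longrightarrow> u \<in> T \<Longrightarrow> c *\<^sub>R u \<in> T"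
    unfolding T_def by (rule convex_l1_tangent_cone l1_tangent_cone_scaleR; assumption?)+
  have Ct: "convex (Ct i j)" if "i \<in> {1..L}" "j \<in> {1..L}" for i j
    unfolding Ct_def using that assms(3) by (intro convex_difference_cone)
  have Ct': "c *\<^sub>R u \<in> Ct i j" if "0 < c" "u \<in> Ct i j" for c u i j
    using that unfolding Ct_def by (rule difference_cone_scaleR)
  have F_UN: "F (\<Union>i\<in>{1..L}. \<Union>j\<in>{1..L}. U i j) = (\<Union>i\<in>{1..L}. \<Union>j\<in>{1..L}. F (U i j))" for U
    unfolding F_def by blast
  have mF_UN: "F (\<Union>i\<in>{1..L}. \<Union>j\<in>{1..L}. U i j) \<in> sets (completion \<Omega>)"
    if "\<And>i j. i \<in> {1..L} \<Longrightarrow> j \<in> {1..L} \<Longrightarrow> F (U i j) \<in> sets (completion \<Omega>)" for U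
    unfolding F_UN using that by (intro sets.finite_UN) auto
  have mT: "F T \<in> sets (completion \<Omega>)"
    by (rule event(1)[OF T])
  have mCt: "F (Ct i j) \<in> sets (completion \<Omega>)" if "i \<in> {1..L}" "j \<in> {1..L}" for i j
    by (rule event(1)[OF Ct[OF that] Ct'])
  \<comment> \<open>The intersections are convex cones too. Measurability of their events is what
    allows the probability of the main event to be computed from its complement.\<close>
  have mTCt: "F (T \<inter> Ct i j) \<in> sets (completion \<Omega>)" if "i \<in> {1..L}" "j \<in> {1..L}" for i j
    using T(2) Ct' by (intro event(1) convex_Int T(1) Ct[OF that]) auto
  let ?V = "\<Union>i\<in>{1..L}. \<Union>j\<in>{1..L}. Ct i j"
  let ?W = "\<Union>i\<in>{1..L}. \<Union>j\<in>{1..L}. T \<inter> Ct i j"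
  have Pr_F: "Pr \<Omega> (\<lambda>w. \<not> min_norm_pos (A w) U) = measure (completion \<Omega>) (F U)" for U
    unfolding Pr_def F_def min_norm_pos_def by (rule arg_cong[where f="measure (completion \<Omega>)"]) auto
  have P1: "P\<^sub>1 = measure (completion \<Omega>) (F T)" unfolding P1_def by (rule Pr_F)
  have P2: "P\<^sub>2 = measure (completion \<Omega>) (F ?V)" unfolding P2_def by (rule Pr_F)
  have "P\<^sub>1 \<le> exp (- ((a\<^sub>M - gaussian_width T)\<^sup>2 / 2))"
    unfolding P1 using assms(10) by (intro event(2) T)
  moreover have "P\<^sub>1 \<le> 1" "P\<^sub>2 \<le> 1"
    unfolding P1 P2 by auto
  moreover have "P\<^sub>2 \<le> 3 / 2 * exp (- (\<epsilon>\<^sup>2 * a\<^sub>M\<^sup>2 / 2))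
      + (\<Sum>j\<in>{1..L}. \<Sum>i\<in>{1..j}. exp (- (((1 - 2 * \<epsilon>) * a\<^sub>M - gaussian_width (Ct i j))\<^sup>2 / 2)))"
  proof -
    have sym: "F (Ct i j) \<subseteq> F (Ct j i)" for i j
    proof
      fix w assume "w \<in> F (Ct i j)"
      then obtain u where "w \<in> space \<Omega>" "u \<in> Ct i j" "u \<noteq> 0" "A w *v u = 0"
        by (auto simp: F_def)
      moreover have "A w *v (- u) = 0"
        using \<open>A w *v u = 0\<close> matrix_vector_mult_scaleR[of "A w" "- 1" u] by simp
      ultimately show "w \<in> F (Ct j i)"
        using difference_cone_uminus[of u "C i" "C j"] unfolding F_def Ct_def by force
    qed
    have half: "F ?V \<subseteq> (\<Union>j\<in>{1..L}. \<Union>i\<in>{1..j}. F (Ct i j))"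
    proof
      fix w assume "w \<in> F ?V"
      then obtain i j where ij: "i \<in> {1..L}" "j \<in> {1..L}" "w \<in> F (Ct i j)"
        unfolding F_UN by auto
      show "w \<in> (\<Union>j\<in>{1..L}. \<Union>i\<in>{1..j}. F (Ct i j))"
      proof (cases "i \<le> j")
        case True
        then show ?thesis using ij by (intro UN_I[of j] UN_I[of i]) auto
      next
        case False
        then show ?thesis using ij sym[of i j] by (intro UN_I[of i] UN_I[of j]) auto
      qed
    qed
    have bound: "measure (completion \<Omega>) (F (Ct i j)) \<le> exp (- (((1 - 2 * \<epsilon>) * a\<^sub>M - gaussian_width (Ct i j))\<^sup>2 / 2))"
      if ij: "i \<in> {1..L}" "j \<in> {1..L}" for i j
    proof -
      have w: "gaussian_width (Ct i j) \<le> (1 - 2 * \<epsilon>) * a\<^sub>M" by (rule assms(11)[OF ij])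
      \<comment> \<open>The escape bound holds with the full \<open>a\<^sub>M\<close>; replacing it
        by the smaller value shrinks a nonnegative gap and only weakens the exponential.\<close>
      also have le: "(1 - 2 * \<epsilon>) * a\<^sub>M \<le> a\<^sub>M"
        using mult_nonneg_nonneg[of "2 * \<epsilon>" a\<^sub>M] aM0 \<open>0 < \<epsilon>\<close> by (simp add: left_diff_distrib)
      finally have "measure (completion \<Omega>) (F (Ct i j)) \<le> exp (- ((a\<^sub>M - gaussian_width (Ct i j))\<^sup>2 / 2))"
        by (intro event(2) Ct[OF ij] Ct')
      also have "\<dots> \<le> exp (- (((1 - 2 * \<epsilon>) * a\<^sub>M - gaussian_width (Ct i j))\<^sup>2 / 2))"
      proof -
        have "((1 - 2 * \<epsilon>) * a\<^sub>M - gaussian_width (Ct i j))\<^sup>2 \<le> (a\<^sub>M - gaussian_width (Ct i j))\<^sup>2"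
          using w le by (intro power_mono) auto
        then show ?thesis by simp
      qed
      finally show ?thesis .
    qed
    have mj: "F (Ct i j) \<in> sets (completion \<Omega>)" if "j \<in> {1..L}" "i \<in> {1..j}" for i j
      using that by (intro mCt) auto
    have mj': "(\<Union>i\<in>{1..j}. F (Ct i j)) \<in> sets (completion \<Omega>)" if "j \<in> {1..L}" for j
      using mj[OF that] by (intro sets.finite_UN) auto
    have "P\<^sub>2 \<le> measure (completion \<Omega>) (\<Union>j\<in>{1..L}. \<Union>i\<in>{1..j}. F (Ct i j))"
      unfolding P2 by (rule completion.finite_measure_mono[OF half], rule sets.finite_UN) (use mj' in auto)
    also have "\<dots> \<le> (\<Sum>j\<in>{1..L}. measure (completion \<Omega>) (\<Union>i\<in>{1..j}. F (Ct i j)))"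
      using mj' by (intro completion.finite_measure_subadditive_finite) auto
    also have "\<dots> \<le> (\<Sum>j\<in>{1..L}. \<Sum>i\<in>{1..j}. measure (completion \<Omega>) (F (Ct i j)))"
      using mj by (intro sum_mono completion.finite_measure_subadditive_finite) auto
    also have "\<dots> \<le> (\<Sum>j\<in>{1..L}. \<Sum>i\<in>{1..j}. exp (- (((1 - 2 * \<epsilon>) * a\<^sub>M - gaussian_width (Ct i j))\<^sup>2 / 2)))"
      by (intro sum_mono bound) auto
    finally show ?thesis
      by (rule order_trans) simp
  qed
  moreover have "1 - min P\<^sub>1 P\<^sub>2 \<le> Pr \<Omega> (\<lambda>w. (\<Union>i\<in>{1..L}. \<Union>j\<in>{1..L}. null_space (A w) \<inter> T \<inter> Ct i j) = {0})"
  proof -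
    \<comment> \<open>The point \<open>x\<close> puts 0 into \<open>Ct k k\<close>. Thus the union
      always contains 0, and being \<open>{0}\<close> means having no nonzero element.\<close>
    obtain k where k: "k \<in> {1..L}" "x \<in> C k" using assms(4) by auto
    have "0 \<in> T" unfolding T_def l1_tangent_cone_def by (auto intro: exI[of _ 1])
    moreover have "0 \<in> Ct k k" using difference_coneI[OF zero_less_one k(2,2)] by (simp add: Ct_def)
    ultimately have zero: "0 \<in> (\<Union>i\<in>{1..L}. \<Union>j\<in>{1..L}. null_space (A w) \<inter> T \<inter> Ct i j)" for w
      using k(1) by (intro UN_I[of k]) (auto simp: null_space_def)
    have "{w \<in> space \<Omega>. (\<Union>i\<in>{1..L}. \<Union>j\<in>{1..L}. null_space (A w) \<inter> T \<inter> Ct i j) = {0}} = space (completion \<Omega>) - F ?W"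
    proof (rule set_eqI)
      fix w
      have "(\<Union>i\<in>{1..L}. \<Union>j\<in>{1..L}. null_space (A w) \<inter> T \<inter> Ct i j) = {u \<in> ?W. A w *v u = 0}"
        by (auto simp: null_space_def)
      with zero[of w] show "w \<in> {w \<in> space \<Omega>. (\<Union>i\<in>{1..L}. \<Union>j\<in>{1..L}. null_space (A w) \<inter> T \<inter> Ct i j) = {0}}
          \<longleftrightarrow> w \<in> space (completion \<Omega>) - F ?W"
        unfolding F_def by auto
    qed
    then have "Pr \<Omega> (\<lambda>w. (\<Union>i\<in>{1..L}. \<Union>j\<in>{1..L}. null_space (A w) \<inter> T \<inter> Ct i j) = {0})
        = 1 - measure (completion \<Omega>) (F ?W)"
      unfolding Pr_def using completion.prob_compl[OF mF_UN[of "\<lambda>i j. T \<inter> Ct i j", OF mTCt]] by simp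
    \<comment> \<open>A failure produces one nonzero null vector lying in \<open>T\<close> and in
      some \<open>Ct i j\<close>, so both failure events occur; this is the origin of the
      minimum.\<close>
    moreover have "F ?W \<subseteq> F T" "F ?W \<subseteq> F ?V"
      unfolding F_def by auto
    then have "measure (completion \<Omega>) (F ?W) \<le> P\<^sub>1" "measure (completion \<Omega>) (F ?W) \<le> P\<^sub>2"
      unfolding P1 P2 using mT mF_UN[of Ct, OF mCt] by (auto intro: completion.finite_measure_mono)
    ultimately show ?thesis by auto
  qed
  ultimately show ?thesis by simp
qed

end
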